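(* Let $c\in\mathbb{R}$, let $N^4(c)$ be a $4$-dimensional space form, i.e. a $4$-dimensional Riemannian manifold of constant sectional curvature $c$, and let $M^3$ be a hypersurface of $N^4(c)$, with isometric inclusion (immersion) $\iota: M^3\to N^4(c)$. Then $M^3$ is an $H$-tensional submanifold of $N^4(c)$ if and only if $M^3$ is minimal, i.e. its mean curvature vector field $H$ vanishes identically.
   Context: All manifolds and maps are smooth. For a smooth map $\psi:(M,g)\to(N,h)$ between Riemannian manifolds, the tension field is $\tau(\psi)=\operatorname{Tr}_g(\nabla d\psi)$, a section of the pullback bundle $\psi^{*}TN$. The rough Laplacian $\Delta^{\psi}$ acts on sections $V$ of $\psi^{*}TN$ by $$\Delta^{\psi}V=-\sum_{i=1}^{m}\left(\nabla^{\psi}_{e_i}\nabla^{\psi}_{e_i}V-\nabla^{\psi}_{\nabla^{M}_{e_i}e_i}V\right),$$ where $m=\dim M$, $\{e_i\}_{i=1}^m$ is a local orthonormal frame on $M$, $\nabla^{M}$ is the Levi-Civita connection of $(M,g)$, and $\nabla^{\psi}$ is the connection on $\psi^{*}TN$ induced by the Levi-Civita connection of $(N,h)$. The map $\psi$ is called $H$-tensional if $\Delta^{\psi}\tau(\psi)=0$. For an isometric immersion $\iota:M^m\to N^n$ with second fundamental form $B$, the mean curvature vector field is $H=\frac1m\operatorname{Tr}_g B$, so that $\tau(\iota)=mH$. The submanifold $M$ is called $H$-tensional if $\iota$ is an $H$-tensional map, i.e. $\Delta^{\iota}\tau(\iota)=\Delta^{\iota}(mH)=0$ on $M$. No completeness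 or compactness of $M$ is assumed. *)

theory Defs
  imports "HOL-Analysis.Analysis"
begin

section \<open>Smooth maps between Euclidean spaces\<close>

text \<open>On an open set, the maps all of whose iterated directional derivatives up to order \<open>k\<close>
  exist and are continuous; only used for open \<open>S\<close>.\<close>

primrec Ck_on :: "nat \<Rightarrow> 'a::euclidean_space set \<Rightarrow> ('a \<Rightarrow> 'b::real_normed_vector) \<Rightarrow> bool" where
  "Ck_on 0 S f \<longleftrightarrow> continuous_on S f"
| "Ck_on (Suc k) S f \<longleftrightarrow>
     f differentiable_on S \<and> (\<forall>v. Ck_on k S (\<lambda>x. frechet_derivative f (at x) v))"

definition smooth_on :: "'a::euclidean_space set \<Rightarrow> ('a \<Rightarrow> 'b::real_normed_vector) \<Rightarrow> bool" where
  "smooth_on S f \<longleftrightarrow> (\<forall>k. Ck_on k S f)"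


section \<open>Riemannian geometry in a coordinate domain\<close>

text \<open>A metric on an open set of a Euclidean space \<open>'e\<close> is a function \<open>g\<close> with \<open>g x v w\<close> the
  inner product of \<open>v\<close> and \<open>w\<close> at \<open>x\<close>. Vector fields are functions \<open>'e \<Rightarrow> 'e\<close>, and a section of
  the pullback bundle of a map \<open>f :: 'e \<Rightarrow> 'f\<close> is a function \<open>'e \<Rightarrow> 'f\<close>. All operators below
  depend only on germs, so values outside the open set under consideration are irrelevant.\<close>

definition riemannian_metric_on ::
  "'e::euclidean_space set \<Rightarrow> ('e \<Rightarrow> 'e \<Rightarrow> 'e \<Rightarrow> real) \<Rightarrow> bool" where
  "riemannian_metric_on S g \<longleftrightarrow>
     (\<forall>x\<in>S. bilinear (g x) \<and> (\<forall>v w. g x v w = g x w v) \<and> (\<forall>v. v \<noteq> 0 \<longrightarrow> g x v v > 0)) \<and>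
     (\<forall>v w. smooth_on S (\<lambda>x. g x v w))"

text \<open>\<open>christoffel g x v w\<close> is \<open>\<nabla>\<^sub>v w\<close> at \<open>x\<close> for the constant fields \<open>v\<close>, \<open>w\<close>. Symmetry of \<open>G\<close>
  says that the connection is torsion-free; the last clause says that it is compatible with
  the metric. These conditions determine \<open>G\<close> uniquely.\<close>

definition christoffel ::
  "('e::euclidean_space \<Rightarrow> 'e \<Rightarrow> 'e \<Rightarrow> real) \<Rightarrow> 'e \<Rightarrow> 'e \<Rightarrow> 'e \<Rightarrow> 'e" where
  "christoffel g x = (THE G. bilinear G \<and> (\<forall>v w. G v w = G w v) \<and>
     (\<forall>u v w. frechet_derivative (\<lambda>y. g y v w) (at x) u = g x (G u v) w + g x v (G u w)))"

definition levi_civita ::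
  "('e::euclidean_space \<Rightarrow> 'e \<Rightarrow> 'e \<Rightarrow> real) \<Rightarrow> ('e \<Rightarrow> 'e) \<Rightarrow> ('e \<Rightarrow> 'e) \<Rightarrow> 'e \<Rightarrow> 'e" where
  "levi_civita g X Y x = frechet_derivative Y (at x) (X x) + christoffel g x (X x) (Y x)"

definition lie_bracket :: "('e::euclidean_space \<Rightarrow> 'e) \<Rightarrow> ('e \<Rightarrow> 'e) \<Rightarrow> 'e \<Rightarrow> 'e" where
  "lie_bracket X Y x = frechet_derivative Y (at x) (X x) - frechet_derivative X (at x) (Y x)"

definition curvature ::
  "('e::euclidean_space \<Rightarrow> 'e \<Rightarrow> 'e \<Rightarrow> real) \<Rightarrow> ('e \<Rightarrow> 'e) \<Rightarrow> ('e \<Rightarrow> 'e) \<Rightarrow> ('e \<Rightarrow> 'e) \<Rightarrow> 'e \<Rightarrow> 'e" where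
  "curvature g X Y Z x =
     levi_civita g X (levi_civita g Y Z) x - levi_civita g Y (levi_civita g X Z) x
     - levi_civita g (lie_bracket X Y) Z x"

text \<open>The curvature is tensorial, so vectors may be extended to constant fields.\<close>

definition sectional_curvature ::
  "('e::euclidean_space \<Rightarrow> 'e \<Rightarrow> 'e \<Rightarrow> real) \<Rightarrow> 'e \<Rightarrow> 'e \<Rightarrow> 'e \<Rightarrow> real" where
  "sectional_curvature g x v w =
     g x (curvature g (\<lambda>_. v) (\<lambda>_. w) (\<lambda>_. w) x) v / (g x v v * g x w w - (g x v w)\<^sup>2)"

text \<open>Orthonormal bases and frames are indexed by \<^term>\<open>Basis\<close>, which has \<open>DIM('e)\<close> elements.\<close>

definition orthonormal_basis_at ::
  "('e::euclidean_space \<Rightarrow> 'e \<Rightarrow> 'e \<Rightarrow> real) \<Rightarrow> 'e \<Rightarrow> ('e \<Rightarrow> 'e) \<Rightarrow> bool" where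
  "orthonormal_basis_at g x b \<longleftrightarrow>
     (\<forall>i\<in>Basis. \<forall>j\<in>Basis. g x (b i) (b j) = (if i = j then 1 else 0))"

definition orthonormal_frame_on ::
  "'e::euclidean_space set \<Rightarrow> ('e \<Rightarrow> 'e \<Rightarrow> 'e \<Rightarrow> real) \<Rightarrow> ('e \<Rightarrow> 'e \<Rightarrow> 'e) \<Rightarrow> bool" where
  "orthonormal_frame_on S g e \<longleftrightarrow>
     (\<forall>i\<in>Basis. smooth_on S (e i)) \<and> (\<forall>x\<in>S. orthonormal_basis_at g x (\<lambda>i. e i x))"

text \<open>The trace of a bilinear map \<open>B\<close> does not depend on the orthonormal basis.\<close>

definition metric_trace ::
  "('e::euclidean_space \<Rightarrow> 'e \<Rightarrow> 'e \<Rightarrow> real) \<Rightarrow> 'e \<Rightarrow> ('e \<Rightarrow> 'e \<Rightarrow> 'f::real_vector) \<Rightarrow> 'f" where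
  "metric_trace g x B = (let b = (SOME b. orthonormal_basis_at g x b) in \<Sum>i\<in>Basis. B (b i) (b i))"

definition pushforward ::
  "('e::euclidean_space \<Rightarrow> 'f::euclidean_space) \<Rightarrow> ('e \<Rightarrow> 'e) \<Rightarrow> 'e \<Rightarrow> 'f" where
  "pushforward f X x = frechet_derivative f (at x) (X x)"

text \<open>The connection on the pullback bundle of \<open>f\<close> induced by the Levi-Civita connection of
  the metric \<open>h\<close> of the target.\<close>

definition pullback_connection ::
  "('f::euclidean_space \<Rightarrow> 'f \<Rightarrow> 'f \<Rightarrow> real) \<Rightarrow> ('e::euclidean_space \<Rightarrow> 'f) \<Rightarrow>
   ('e \<Rightarrow> 'e) \<Rightarrow> ('e \<Rightarrow> 'f) \<Rightarrow> 'e \<Rightarrow> 'f" where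
  "pullback_connection h f X V x =
     frechet_derivative V (at x) (X x) + christoffel h (f x) (pushforward f X x) (V x)"

definition nabla_d ::
  "('e::euclidean_space \<Rightarrow> 'e \<Rightarrow> 'e \<Rightarrow> real) \<Rightarrow> ('f::euclidean_space \<Rightarrow> 'f \<Rightarrow> 'f \<Rightarrow> real) \<Rightarrow>
   ('e \<Rightarrow> 'f) \<Rightarrow> ('e \<Rightarrow> 'e) \<Rightarrow> ('e \<Rightarrow> 'e) \<Rightarrow> 'e \<Rightarrow> 'f" where
  "nabla_d g h f X Y x =
     pullback_connection h f X (pushforward f Y) x - pushforward f (levi_civita g X Y) x"

definition tension_field ::
  "('e::euclidean_space \<Rightarrow> 'e \<Rightarrow> 'e \<Rightarrow> real) \<Rightarrow> ('f::euclidean_space \<Rightarrow> 'f \<Rightarrow> 'f \<Rightarrow> real) \<Rightarrow>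
   ('e \<Rightarrow> 'f) \<Rightarrow> 'e \<Rightarrow> 'f" where
  "tension_field g h f x = metric_trace g x (\<lambda>v w. nabla_d g h f (\<lambda>_. v) (\<lambda>_. w) x)"

definition rough_laplacian ::
  "('e::euclidean_space \<Rightarrow> 'e \<Rightarrow> 'e \<Rightarrow> real) \<Rightarrow> ('f::euclidean_space \<Rightarrow> 'f \<Rightarrow> 'f \<Rightarrow> real) \<Rightarrow>
   ('e \<Rightarrow> 'f) \<Rightarrow> ('e \<Rightarrow> 'e \<Rightarrow> 'e) \<Rightarrow> ('e \<Rightarrow> 'f) \<Rightarrow> 'e \<Rightarrow> 'f" where
  "rough_laplacian g h f e V x =
     - (\<Sum>i\<in>Basis. pullback_connection h f (e i) (pullback_connection h f (e i) V) x
                   - pullback_connection h f (levi_civita g (e i) (e i)) V x)"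

text \<open>The component of \<open>u\<close> orthogonal to the image of the differential of \<open>f\<close> at \<open>x\<close>.\<close>

definition normal_part ::
  "('f::euclidean_space \<Rightarrow> 'f \<Rightarrow> 'f \<Rightarrow> real) \<Rightarrow> ('e::euclidean_space \<Rightarrow> 'f) \<Rightarrow> 'e \<Rightarrow> 'f \<Rightarrow> 'f" where
  "normal_part h f x u =
     (THE n. u - n \<in> range (frechet_derivative f (at x)) \<and>
             (\<forall>t \<in> range (frechet_derivative f (at x)). h (f x) n t = 0))"

definition second_fundamental_form ::
  "('f::euclidean_space \<Rightarrow> 'f \<Rightarrow> 'f \<Rightarrow> real) \<Rightarrow> ('e::euclidean_space \<Rightarrow> 'f) \<Rightarrow>
   ('e \<Rightarrow> 'e) \<Rightarrow> ('e \<Rightarrow> 'e) \<Rightarrow> 'e \<Rightarrow> 'f" where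
  "second_fundamental_form h f X Y x =
     normal_part h f x (pullback_connection h f X (pushforward f Y) x)"

definition mean_curvature_field ::
  "('e::euclidean_space \<Rightarrow> 'e \<Rightarrow> 'e \<Rightarrow> real) \<Rightarrow> ('f::euclidean_space \<Rightarrow> 'f \<Rightarrow> 'f \<Rightarrow> real) \<Rightarrow>
   ('e \<Rightarrow> 'f) \<Rightarrow> 'e \<Rightarrow> 'f" where
  "mean_curvature_field g h f x =
     (1 / real DIM('e)) *\<^sub>R
       metric_trace g x (\<lambda>v w. second_fundamental_form h f (\<lambda>_. v) (\<lambda>_. w) x)"


section \<open>Riemannian manifolds\<close>

text \<open>A chart is a pair of its domain and its coordinate map; the coordinate map is a total
  function whose values off the domain are irrelevant. The Riemannian metric is given by its
  coordinate expression in every chart of the atlas.\<close>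

type_synonym ('p, 'e) chart = "'p set \<times> ('p \<Rightarrow> 'e)"

record ('p, 'e) mfd =
  mtop :: "'p topology"
  atlas :: "('p, 'e) chart set"
  metric :: "('p, 'e) chart \<Rightarrow> 'e \<Rightarrow> 'e \<Rightarrow> 'e \<Rightarrow> real"

definition chart_of :: "'p topology \<Rightarrow> ('p, 'e::euclidean_space) chart \<Rightarrow> bool" where
  "chart_of X = (\<lambda>(U, \<phi>). openin X U \<and> open (\<phi> ` U) \<and>
     homeomorphic_map (subtopology X U) (top_of_set (\<phi> ` U)) \<phi>)"

text \<open>The local representation of a map \<open>F\<close> in the charts \<open>a\<close>, \<open>b\<close>, and the set of coordinates
  on which it is meaningful.\<close>

definition local_rep :: "('p, 'e) chart \<Rightarrow> ('q, 'f) chart \<Rightarrow> ('p \<Rightarrow> 'q) \<Rightarrow> 'e \<Rightarrow> 'f" where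
  "local_rep a b F = snd b \<circ> F \<circ> inv_into (fst a) (snd a)"

definition local_dom :: "('p, 'e) chart \<Rightarrow> ('q, 'f) chart \<Rightarrow> ('p \<Rightarrow> 'q) \<Rightarrow> 'e set" where
  "local_dom a b F = snd a ` (fst a \<inter> F -` fst b)"

definition smooth_manifold :: "('p, 'e::euclidean_space) mfd \<Rightarrow> bool" where
  "smooth_manifold M \<longleftrightarrow>
     Hausdorff_space (mtop M) \<and> second_countable (mtop M) \<and>
     (\<forall>a\<in>atlas M. chart_of (mtop M) a) \<and> (\<Union>a\<in>atlas M. fst a) = topspace (mtop M) \<and>
     (\<forall>a\<in>atlas M. \<forall>b\<in>atlas M. smooth_on (local_dom a b id) (local_rep a b id))"

definition pulls_back_metric ::
  "('p, 'e::euclidean_space) mfd \<Rightarrow> ('q, 'f::euclidean_space) mfd \<Rightarrow> ('p \<Rightarrow> 'q) \<Rightarrow> bool" where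
  "pulls_back_metric M N F \<longleftrightarrow>
     (\<forall>a\<in>atlas M. \<forall>b\<in>atlas N. \<forall>x\<in>local_dom a b F. \<forall>v w.
        metric N b (local_rep a b F x)
          (frechet_derivative (local_rep a b F) (at x) v)
          (frechet_derivative (local_rep a b F) (at x) w) = metric M a x v w)"

text \<open>The last condition, applied to the identity, is the transformation law of the coordinate
  expressions of the metric under changes of charts.\<close>

definition riemannian_manifold :: "('p, 'e::euclidean_space) mfd \<Rightarrow> bool" where
  "riemannian_manifold M \<longleftrightarrow>
     smooth_manifold M \<and> (\<forall>a\<in>atlas M. riemannian_metric_on (snd a ` fst a) (metric M a)) \<and>
     pulls_back_metric M M id"

definition constant_sectional_curvature :: "('p, 'e::euclidean_space) mfd \<Rightarrow> real \<Rightarrow> bool" where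
  "constant_sectional_curvature M c \<longleftrightarrow>
     (\<forall>a\<in>atlas M. \<forall>x \<in> snd a ` fst a. \<forall>v w. v \<noteq> w \<and> independent {v, w} \<longrightarrow>
        sectional_curvature (metric M a) x v w = c)"

definition smooth_map ::
  "('p, 'e::euclidean_space) mfd \<Rightarrow> ('q, 'f::euclidean_space) mfd \<Rightarrow> ('p \<Rightarrow> 'q) \<Rightarrow> bool" where
  "smooth_map M N F \<longleftrightarrow> continuous_map (mtop M) (mtop N) F \<and>
     (\<forall>a\<in>atlas M. \<forall>b\<in>atlas N. smooth_on (local_dom a b F) (local_rep a b F))"

definition immersion ::
  "('p, 'e::euclidean_space) mfd \<Rightarrow> ('q, 'f::euclidean_space) mfd \<Rightarrow> ('p \<Rightarrow> 'q) \<Rightarrow> bool" where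
  "immersion M N F \<longleftrightarrow> smooth_map M N F \<and>
     (\<forall>a\<in>atlas M. \<forall>b\<in>atlas N. \<forall>x\<in>local_dom a b F.
        inj (frechet_derivative (local_rep a b F) (at x)))"

definition isometric_immersion ::
  "('p, 'e::euclidean_space) mfd \<Rightarrow> ('q, 'f::euclidean_space) mfd \<Rightarrow> ('p \<Rightarrow> 'q) \<Rightarrow> bool" where
  "isometric_immersion M N F \<longleftrightarrow> immersion M N F \<and> pulls_back_metric M N F"

definition H_tensional ::
  "('p, 'e::euclidean_space) mfd \<Rightarrow> ('q, 'f::euclidean_space) mfd \<Rightarrow> ('p \<Rightarrow> 'q) \<Rightarrow> bool" where
  "H_tensional M N F \<longleftrightarrow>
     (\<forall>a\<in>atlas M. \<forall>b\<in>atlas N. \<forall>S e.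
        open S \<and> S \<subseteq> local_dom a b F \<and> orthonormal_frame_on S (metric M a) e \<longrightarrow>
        (\<forall>x\<in>S. rough_laplacian (metric M a) (metric N b) (local_rep a b F) e
                 (tension_field (metric M a) (metric N b) (local_rep a b F)) x = 0))"

definition minimal_immersion ::
  "('p, 'e::euclidean_space) mfd \<Rightarrow> ('q, 'f::euclidean_space) mfd \<Rightarrow> ('p \<Rightarrow> 'q) \<Rightarrow> bool" where
  "minimal_immersion M N F \<longleftrightarrow>
     (\<forall>a\<in>atlas M. \<forall>b\<in>atlas N. \<forall>x\<in>local_dom a b F.
        mean_curvature_field (metric M a) (metric N b) (local_rep a b F) x = 0)"

end

theory Submission
  imports Defs "HOL-Computational_Algebra.Polynomial"
begin

text \<open>Everything is local. Along the hypersurface the tension field is \<open>f \<eta>\<close> with \<open>\<eta>\<close> a unit normal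
  and \<open>f = tr A\<close>. By the Codazzi equation the tangential part of \<open>\<Delta>(f \<eta>) = 0\<close> is
  \<open>2 A(\<nabla>f) + f \<nabla>f = 0\<close>, and the normal part is \<open>tr Hess f = f \<bar>A\<bar>\<^sup>2\<close>. If \<open>\<nabla>f = 0\<close> everywhere, the latter
  gives \<open>f = 0\<close>. If \<open>\<nabla>f \<noteq> 0\<close> at some point, then on a smaller open set there is an orthonormal frame of
  principal directions whose first vector is parallel to \<open>\<nabla>f\<close>; the principal curvatures are
  \<open>L = - f / 2\<close>, \<open>M\<close> and \<open>K\<close> with \<open>M + K = - 3 L\<close>. When \<open>M \<noteq> K\<close>, differentiating the relations in the
  two other directions shows that \<open>M\<close> and \<open>K\<close> vary only along \<open>\<nabla>f\<close>, so that the Gauss and Codazzi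
  equations become a system of ordinary differential equations with one algebraic constraint.
  Successive derivatives of the constraint and elimination show that \<open>L\<close> is constant, a
  contradiction. The case \<open>M = K\<close> is similar and easier.\<close>

section \<open>Smooth maps\<close>

lemma has_derivative_imp_differentiable_on:
  assumes "\<And>x. x \<in> S \<Longrightarrow> (f has_derivative D x) (at x)"
  shows "f differentiable_on S"
  unfolding differentiable_on_def differentiable_def
  using assms has_derivative_at_withinI by blast

lemma differentiable_on_has_derivative:
  assumes "f differentiable_on S" "open S" "x \<in> S"
  shows "(f has_derivative frechet_derivative f (at x)) (at x)"
proof -
  have "f differentiable (at x within S)"
    using assms(1,3) unfolding differentiable_on_def by blast
  then have "f differentiable (at x)"
    using at_within_open[OF assms(3,2)] by simp
  then show ?thesis by (simp add: frechet_derivative_works)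
qed

lemma Ck_on_cong:
  assumes "open S" "\<And>x. x \<in> S \<Longrightarrow> f x = g x" "Ck_on k S f"
  shows "Ck_on k S g"
  using assms(2,3)
proof (induction k arbitrary: f g)
  case 0
  then show ?case by (simp cong: continuous_on_cong)
next
  case (Suc k)
  have fd: "frechet_derivative g (at x) = frechet_derivative f (at x)" if "x \<in> S" for x
  proof -
    have "(f has_derivative D) (at x) \<longleftrightarrow> (g has_derivative D) (at x)" for D
      using has_derivative_transform_within_open[OF _ \<open>open S\<close> that, of f D UNIV g]
        has_derivative_transform_within_open[OF _ \<open>open S\<close> that, of g D UNIV f] Suc.prems(1) by auto
    then show ?thesis by (simp add: frechet_derivative_def)
  qed
  have "g differentiable_on S"
    using Suc.prems by (auto simp: differentiable_on_def intro: differentiable_transform_within[OF _ zero_less_one])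
  moreover have "Ck_on k S (\<lambda>x. frechet_derivative g (at x) v)" for v
    by (rule Suc.IH[of "\<lambda>x. frechet_derivative f (at x) v"]) (use Suc.prems fd in auto)
  ultimately show ?case by simp
qed

lemma frechet_derivative_cong_open:
  assumes "open S" "x \<in> S" "\<And>y. y \<in> S \<Longrightarrow> f y = g y"
  shows "frechet_derivative f (at x) = frechet_derivative g (at x)"
proof -
  have "(f has_derivative D) (at x) \<longleftrightarrow> (g has_derivative D) (at x)" for D
    using has_derivative_transform_within_open[OF _ \<open>open S\<close> assms(2), of f D UNIV g]
        has_derivative_transform_within_open[OF _ \<open>open S\<close> assms(2), of g D UNIV f] assms(3) by auto
  then show ?thesis by (simp add: frechet_derivative_def)
qed

lemma Ck_on_Suc_imp: "Ck_on (Suc k) S f \<Longrightarrow> Ck_on k S f"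
proof (induction k arbitrary: f)
  case 0
  then show ?case by (simp add: differentiable_imp_continuous_on)
next
  case (Suc k)
  have "f differentiable_on S" "\<And>v. Ck_on (Suc k) S (\<lambda>x. frechet_derivative f (at x) v)"
    using Suc.prems Ck_on.simps(2) by blast+
  then show ?case using Suc.IH by (simp only: Ck_on.simps(2)) blast
qed

lemma Ck_on_subset: "Ck_on k S f \<Longrightarrow> T \<subseteq> S \<Longrightarrow> Ck_on k T f"
proof (induction k arbitrary: f)
  case 0
  then show ?case by (auto intro: continuous_on_subset)
next
  case (Suc k)
  have "f differentiable_on S" "\<And>v. Ck_on k S (\<lambda>x. frechet_derivative f (at x) v)"
    using Suc.prems Ck_on.simps(2) by blast+
  then show ?case
    using Suc.IH Suc.prems(2) differentiable_on_subset by (simp only: Ck_on.simps(2)) blast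
qed

lemma Ck_on_local:
  assumes "\<And>x. x \<in> S \<Longrightarrow> \<exists>U. open U \<and> x \<in> U \<and> Ck_on k U f"
  shows "Ck_on k S f"
  using assms
proof (induction k arbitrary: f)
  case 0
  have "continuous (at x within S) f" if "x \<in> S" for x
    using 0[OF that]
    by (metis Ck_on.simps(1) continuous_at_imp_continuous_at_within continuous_on_eq_continuous_at)
  then show ?case by (simp add: continuous_on_eq_continuous_within)
next
  case (Suc k)
  have "f differentiable (at x within S)" if x: "x \<in> S" for x
  proof -
    obtain U where U: "open U" "x \<in> U" "Ck_on (Suc k) U f" using Suc.prems[OF x] by blast
    then have "f differentiable (at x)"
      unfolding Ck_on.simps(2) differentiable_def using differentiable_on_has_derivative by blast
    then show ?thesis by (rule differentiable_at_withinI)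
  qed
  moreover have "Ck_on k S (\<lambda>x. frechet_derivative f (at x) v)" for v
  proof (rule Suc.IH)
    fix x assume "x \<in> S"
    then show "\<exists>U. open U \<and> x \<in> U \<and> Ck_on k U (\<lambda>x. frechet_derivative f (at x) v)"
      using Suc.prems[of x] Ck_on.simps(2) by blast
  qed
  ultimately show ?case by (simp add: differentiable_on_def)
qed

lemma smooth_on_subset: "smooth_on S f \<Longrightarrow> T \<subseteq> S \<Longrightarrow> smooth_on T f"
  by (auto simp: smooth_on_def intro: Ck_on_subset)

lemma smooth_on_cong:
  assumes "open S" "\<And>x. x \<in> S \<Longrightarrow> f x = g x" "smooth_on S f"
  shows "smooth_on S g"
  unfolding smooth_on_def
proof
  fix k
  show "Ck_on k S g"
    by (rule Ck_on_cong[OF assms(1,2)]) (use assms(3) in \<open>auto simp: smooth_on_def\<close>)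
qed

lemma smooth_on_local:
  assumes "\<And>x. x \<in> S \<Longrightarrow> \<exists>U. open U \<and> x \<in> U \<and> smooth_on U f"
  shows "smooth_on S f"
  unfolding smooth_on_def
proof
  fix k
  show "Ck_on k S f"
    by (rule Ck_on_local) (use assms in \<open>auto simp: smooth_on_def\<close>)
qed

lemma smooth_on_imp_differentiable:
  assumes "open S" "smooth_on S f" "x \<in> S"
  shows "f differentiable (at x)"
proof -
  have "Ck_on (Suc 0) S f" using assms(2) unfolding smooth_on_def by blast
  then show ?thesis
    using assms differentiable_on_has_derivative unfolding Ck_on.simps(2) differentiable_def by blast
qed

lemma smooth_on_has_derivative:
  assumes "open S" "smooth_on S f" "x \<in> S"
  shows "(f has_derivative frechet_derivative f (at x)) (at x)"
  using smooth_on_imp_differentiable[OF assms] frechet_derivative_works by blast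

lemma smooth_on_imp_continuous_on: "smooth_on S f \<Longrightarrow> continuous_on S f"
  unfolding smooth_on_def by (metis Ck_on.simps(1))

lemma smooth_on_frechet:
  "smooth_on S f \<Longrightarrow> smooth_on S (\<lambda>x. frechet_derivative f (at x) v)"
  unfolding smooth_on_def by (metis Ck_on.simps(2))

lemma Ck_on_const: "Ck_on k S (\<lambda>_. c)"
  by (induction k arbitrary: c) auto

lemma smooth_on_const [intro, simp]: "smooth_on S (\<lambda>_. c)"
  by (simp add: smooth_on_def Ck_on_const)

lemma Ck_on_bounded_linear:
  assumes "bounded_linear F" "open S" "Ck_on k S f"
  shows "Ck_on k S (\<lambda>x. F (f x))"
  using assms(3)
proof (induction k arbitrary: f)
  case 0
  then show ?case
    by (simp add: assms(1) bounded_linear.continuous_on)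
next
  case (Suc k)
  have d: "((\<lambda>x. F (f x)) has_derivative (\<lambda>v. F (frechet_derivative f (at x) v))) (at x)" if "x \<in> S" for x
    using Suc.prems that assms
    by (intro bounded_linear.has_derivative[OF assms(1)])
      (auto intro: differentiable_on_has_derivative[where S=S])
  have "(\<lambda>x. F (f x)) differentiable_on S"
    by (rule has_derivative_imp_differentiable_on[OF d])
  moreover have "Ck_on k S (\<lambda>x. frechet_derivative (\<lambda>x. F (f x)) (at x) v)" for v
    by (rule Ck_on_cong[OF assms(2) _ Suc.IH[of "\<lambda>x. frechet_derivative f (at x) v"]])
      (use frechet_derivative_at[OF d] Suc.prems in \<open>auto simp: fun_eq_iff\<close>)
  ultimately show ?case by simp
qed

lemma Ck_on_add:
  assumes "open S" "Ck_on k S f" "Ck_on k S g"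
  shows "Ck_on k S (\<lambda>x. f x + g x)"
  using assms(2,3)
proof (induction k arbitrary: f g)
  case 0
  then show ?case by (simp add: continuous_on_add)
next
  case (Suc k)
  have d: "((\<lambda>x. f x + g x) has_derivative
      (\<lambda>v. frechet_derivative f (at x) v + frechet_derivative g (at x) v)) (at x)" if "x \<in> S" for x
    using Suc.prems that assms
    by (intro has_derivative_add)
      (auto intro: differentiable_on_has_derivative[where S=S])
  have "(\<lambda>x. f x + g x) differentiable_on S"
    by (rule has_derivative_imp_differentiable_on[OF d])
  moreover have "Ck_on k S (\<lambda>x. frechet_derivative (\<lambda>x. f x + g x) (at x) v)" for v
    by (rule Ck_on_cong[OF assms(1) _ Suc.IH[of "\<lambda>x. frechet_derivative f (at x) v"
            "\<lambda>x. frechet_derivative g (at x) v"]])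
      (use frechet_derivative_at[OF d] Suc.prems in \<open>auto simp: fun_eq_iff\<close>)
  ultimately show ?case by simp
qed

lemma Ck_on_bounded_bilinear:
  assumes "bounded_bilinear B" "open S" "Ck_on k S f" "Ck_on k S g"
  shows "Ck_on k S (\<lambda>x. B (f x) (g x))"
  using assms(3,4)
proof (induction k arbitrary: f g)
  case 0
  then show ?case by (simp add: bounded_bilinear.continuous_on[OF assms(1)])
next
  case (Suc k)
  have d: "((\<lambda>x. B (f x) (g x)) has_derivative
      (\<lambda>v. B (f x) (frechet_derivative g (at x) v) + B (frechet_derivative f (at x) v) (g x))) (at x)" if "x \<in> S" for x
    using Suc.prems that assms
    by (intro bounded_bilinear.FDERIV[OF assms(1)])
      (auto intro: differentiable_on_has_derivative[where S=S])
  have "(\<lambda>x. B (f x) (g x)) differentiable_on S"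
    by (rule has_derivative_imp_differentiable_on[OF d])
  moreover have "Ck_on k S (\<lambda>x. B (f x) (frechet_derivative g (at x) v) + B (frechet_derivative f (at x) v) (g x))" for v
    using Suc.prems Ck_on_Suc_imp[OF Suc.prems(1)] Ck_on_Suc_imp[OF Suc.prems(2)]
    by (intro Ck_on_add Suc.IH assms(2)) auto
  then have "Ck_on k S (\<lambda>x. frechet_derivative (\<lambda>x. B (f x) (g x)) (at x) v)" for v
    by (rule Ck_on_cong[OF assms(2), rotated]) (use frechet_derivative_at[OF d] in \<open>auto simp: fun_eq_iff\<close>)
  ultimately show ?case by simp
qed

lemma Ck_on_sum:
  assumes "open S" "\<And>i. i \<in> I \<Longrightarrow> Ck_on k S (f i)"
  shows "Ck_on k S (\<lambda>x. \<Sum>i\<in>I. f i x)"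
  using assms(2)
  by (induction I rule: infinite_finite_induct) (auto intro: Ck_on_const Ck_on_add assms(1))

lemma linear_sum_Basis:
  fixes F :: "'a::euclidean_space \<Rightarrow> 'b::real_vector"
  assumes "linear F"
  shows "F v = (\<Sum>i\<in>Basis. (v \<bullet> i) *\<^sub>R F i)"
proof -
  have "F v = F (\<Sum>i\<in>Basis. (v \<bullet> i) *\<^sub>R i)" by (simp add: euclidean_representation)
  also have "\<dots> = (\<Sum>i\<in>Basis. (v \<bullet> i) *\<^sub>R F i)"
    by (simp add: linear_sum[OF assms] linear_cmul[OF assms])
  finally show ?thesis .
qed

lemma Ck_on_compose:
  fixes f :: "'a::euclidean_space \<Rightarrow> 'b::euclidean_space"
  assumes "open S" "open T" "f ` S \<subseteq> T" "Ck_on k T g" "Ck_on k S f"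
  shows "Ck_on k S (\<lambda>x. g (f x))"
  using assms(4,5)
proof (induction k arbitrary: g)
  case 0
  then show ?case using assms(3) by (auto intro: continuous_on_compose2)
next
  case (Suc k)
  have gd: "(g has_derivative frechet_derivative g (at y)) (at y)" if "y \<in> T" for y
    using Suc.prems that assms
    by (auto intro: differentiable_on_has_derivative[where S=T])
  have d: "((\<lambda>x. g (f x)) has_derivative
      (\<lambda>v. frechet_derivative g (at (f x)) (frechet_derivative f (at x) v))) (at x)" if "x \<in> S" for x
    using Suc.prems that assms
    by (intro has_derivative_compose[OF _ gd])
      (auto intro: differentiable_on_has_derivative[where S=S])
  have "(\<lambda>x. g (f x)) differentiable_on S"
    by (rule has_derivative_imp_differentiable_on[OF d])
  moreover have "Ck_on k S (\<lambda>x. \<Sum>i\<in>Basis. (frechet_derivative f (at x) v \<bullet> i) *\<^sub>R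
      frechet_derivative g (at (f x)) i)" for v
    using Suc.prems Ck_on_Suc_imp[OF Suc.prems(2)]
    by (intro Ck_on_sum assms(1) Ck_on_bounded_bilinear[OF bounded_bilinear_scaleR]
        Ck_on_bounded_linear[OF bounded_linear_inner_left] Suc.IH) auto
  then have "Ck_on k S (\<lambda>x. frechet_derivative (\<lambda>x. g (f x)) (at x) v)" for v
  proof (rule Ck_on_cong[OF assms(1), rotated])
    fix x assume x: "x \<in> S"
    then have "linear (frechet_derivative g (at (f x)))"
      using gd assms(3) has_derivative_linear by blast
    from linear_sum_Basis[OF this] show "(\<Sum>i\<in>Basis. (frechet_derivative f (at x) v \<bullet> i) *\<^sub>R
      frechet_derivative g (at (f x)) i) = frechet_derivative (\<lambda>x. g (f x)) (at x) v"
      using frechet_derivative_at[OF d[OF x]] by metis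
  qed
  ultimately show ?case by simp
qed

lemma smooth_on_add: "open S \<Longrightarrow> smooth_on S f \<Longrightarrow> smooth_on S g \<Longrightarrow> smooth_on S (\<lambda>x. f x + g x)"
  by (simp add: smooth_on_def Ck_on_add)

lemma smooth_on_bounded_linear:
  "bounded_linear F \<Longrightarrow> open S \<Longrightarrow> smooth_on S f \<Longrightarrow> smooth_on S (\<lambda>x. F (f x))"
  by (simp add: smooth_on_def Ck_on_bounded_linear)

lemma smooth_on_bounded_bilinear:
  "bounded_bilinear B \<Longrightarrow> open S \<Longrightarrow> smooth_on S f \<Longrightarrow> smooth_on S g \<Longrightarrow> smooth_on S (\<lambda>x. B (f x) (g x))"
  by (simp add: smooth_on_def Ck_on_bounded_bilinear)

lemmas smooth_on_minus = smooth_on_bounded_linear[OF bounded_linear_minus[OF bounded_linear_ident]]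
lemmas smooth_on_inner_left = smooth_on_bounded_linear[OF bounded_linear_inner_left]
lemmas smooth_on_scaleR = smooth_on_bounded_bilinear[OF bounded_bilinear_scaleR]

lemma smooth_on_mult:
  fixes f g :: "'a::euclidean_space \<Rightarrow> real"
  shows "open S \<Longrightarrow> smooth_on S f \<Longrightarrow> smooth_on S g \<Longrightarrow> smooth_on S (\<lambda>x. f x * g x)"
  by (rule smooth_on_bounded_bilinear[OF bounded_bilinear_mult])

lemma smooth_on_diff: "open S \<Longrightarrow> smooth_on S f \<Longrightarrow> smooth_on S g \<Longrightarrow> smooth_on S (\<lambda>x. f x - g x)"
  using smooth_on_add[of S f "\<lambda>x. - g x"] smooth_on_minus[of S g] by simp

lemma smooth_on_sum:
  "open S \<Longrightarrow> (\<And>i. i \<in> I \<Longrightarrow> smooth_on S (f i)) \<Longrightarrow> smooth_on S (\<lambda>x. \<Sum>i\<in>I. f i x)"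
  by (simp add: smooth_on_def Ck_on_sum)

lemma smooth_on_power:
  fixes f :: "'a::euclidean_space \<Rightarrow> real"
  shows "open S \<Longrightarrow> smooth_on S f \<Longrightarrow> smooth_on S (\<lambda>x. f x ^ n)"
  by (induction n) (auto intro: smooth_on_mult)

lemma smooth_on_compose:
  fixes f :: "'a::euclidean_space \<Rightarrow> 'b::euclidean_space"
  shows "open S \<Longrightarrow> open T \<Longrightarrow> f ` S \<subseteq> T \<Longrightarrow> smooth_on T g \<Longrightarrow> smooth_on S f \<Longrightarrow> smooth_on S (\<lambda>x. g (f x))"
  by (simp add: smooth_on_def Ck_on_compose)

lemma frechet_derivative_real:
  assumes "(f has_real_derivative d) (at x)"
  shows "frechet_derivative f (at x) v = d * v"
  using frechet_derivative_at[of f "(*) d" x] assms by (metis has_field_derivative_def)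

lemma smooth_on_ident: "smooth_on S (\<lambda>x. x)"
proof -
  have "Ck_on k UNIV (\<lambda>x::'a. x)" for k
    by (cases k) (simp_all add: continuous_on_id Ck_on_const frechet_derivative_ident)
  then show ?thesis
    unfolding smooth_on_def by (metis Ck_on_subset subset_UNIV)
qed

lemma smooth_on_inverse:
  fixes f :: "'a::euclidean_space \<Rightarrow> real"
  assumes "open S" "smooth_on S f" "\<And>x. x \<in> S \<Longrightarrow> f x \<noteq> 0"
  shows "smooth_on S (\<lambda>x. inverse (f x))"
proof -
  have o: "open (- {0::real})" by auto
  have "Ck_on k (- {0}) (inverse :: real \<Rightarrow> real)" for k
  proof (induction k)
    case 0
    then show ?case by (auto intro: continuous_intros)
  next
    case (Suc k)
    have d: "(inverse has_real_derivative - (inverse x * inverse x)) (at x)" if "x \<in> - {0}" for x :: real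
      using that by (auto intro!: derivative_eq_intros)
    have "(inverse :: real \<Rightarrow> real) differentiable_on - {0}"
      by (rule has_derivative_imp_differentiable_on) (use d in \<open>auto simp: has_field_derivative_def\<close>)
    moreover have "Ck_on k (-{0}) (\<lambda>x. (- v) * (inverse x * inverse x))" for v :: real
      using Suc by (intro Ck_on_bounded_bilinear[OF bounded_bilinear_mult] Ck_on_const o)
    then have "Ck_on k (-{0}) (\<lambda>x. frechet_derivative inverse (at x) v)" for v :: real
      by (rule Ck_on_cong[OF o, rotated]) (simp add: frechet_derivative_real[OF d])
    ultimately show ?case by simp
  qed
  then show ?thesis
    using assms(3) by (intro smooth_on_compose[OF assms(1) o _ _ assms(2)]) (auto simp: smooth_on_def)
qed

lemma smooth_on_divide:
  fixes f g :: "'a::euclidean_space \<Rightarrow> real"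
  assumes "open S" "smooth_on S f" "smooth_on S g" "\<And>x. x \<in> S \<Longrightarrow> g x \<noteq> 0"
  shows "smooth_on S (\<lambda>x. f x / g x)"
  using smooth_on_mult[OF assms(1,2) smooth_on_inverse[OF assms(1,3,4)]] by (simp add: divide_inverse)

lemma smooth_on_sqrt:
  fixes f :: "'a::euclidean_space \<Rightarrow> real"
  assumes "open S" "smooth_on S f" "\<And>x. x \<in> S \<Longrightarrow> f x > 0"
  shows "smooth_on S (\<lambda>x. sqrt (f x))"
proof -
  have o: "open {0::real<..}" by auto
  have "Ck_on k {0<..} sqrt" for k
  proof (induction k)
    case 0
    then show ?case by (auto intro: continuous_intros)
  next
    case (Suc k)
    have d: "(sqrt has_real_derivative inverse 2 * (sqrt x * inverse x)) (at x)" if "x \<in> {0<..}" for x :: real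
      using that by (auto intro!: derivative_eq_intros simp: field_simps)
    have i: "Ck_on k {0<..} (inverse :: real \<Rightarrow> real)"
      using smooth_on_inverse[OF o smooth_on_ident] unfolding smooth_on_def by auto
    have "sqrt differentiable_on {0<..}"
      by (rule has_derivative_imp_differentiable_on) (use d in \<open>auto simp: has_field_derivative_def\<close>)
    moreover have "Ck_on k {0<..} (\<lambda>x. (v * inverse 2) * (sqrt x * inverse x))" for v :: real
      using Suc i by (intro Ck_on_bounded_bilinear[OF bounded_bilinear_mult] Ck_on_const o)
    then have "Ck_on k {0<..} (\<lambda>x. frechet_derivative sqrt (at x) v)" for v :: real
      by (rule Ck_on_cong[OF o, rotated]) (simp add: frechet_derivative_real[OF d])
    ultimately show ?case by simp
  qed
  then show ?thesis
    using assms(3) by (intro smooth_on_compose[OF assms(1) o _ _ assms(2)]) (auto simp: smooth_on_def)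
qed


abbreviation FD :: "('a::real_normed_vector \<Rightarrow> 'b::real_normed_vector) \<Rightarrow> 'a \<Rightarrow> 'a \<Rightarrow> 'b" where
  "FD f x \<equiv> frechet_derivative f (at x)"

lemma FD_eqI: "(f has_derivative D) (at x) \<Longrightarrow> FD f x v = D v"
  using frechet_derivative_at by metis

lemma linear_FD: "open S \<Longrightarrow> smooth_on S f \<Longrightarrow> x \<in> S \<Longrightarrow> linear (FD f x)"
  using smooth_on_has_derivative has_derivative_linear by blast

lemma FD_add:
  assumes "open S" "x \<in> S" "smooth_on S f" "smooth_on S g"
  shows "FD (\<lambda>y. f y + g y) x v = FD f x v + FD g x v"
  by (rule FD_eqI) (intro has_derivative_add smooth_on_has_derivative[OF assms(1) _ assms(2)] assms)

lemma FD_sum: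
  assumes "open S" "x \<in> S" "\<And>i. i \<in> I \<Longrightarrow> smooth_on S (f i)"
  shows "FD (\<lambda>y. \<Sum>i\<in>I. f i y) x v = (\<Sum>i\<in>I. FD (f i) x v)"
  by (rule FD_eqI) (intro has_derivative_sum smooth_on_has_derivative[OF assms(1) _ assms(2)] assms)

lemma FD_bounded_linear:
  assumes "open S" "x \<in> S" "smooth_on S f" "bounded_linear F"
  shows "FD (\<lambda>y. F (f y)) x v = F (FD f x v)"
  by (rule FD_eqI)
    (intro bounded_linear.has_derivative[OF assms(4)] smooth_on_has_derivative[OF assms(1) _ assms(2)] assms)

lemma FD_bounded_bilinear:
  assumes "open S" "x \<in> S" "smooth_on S f" "smooth_on S g" "bounded_bilinear B"
  shows "FD (\<lambda>y. B (f y) (g y)) x v = B (FD f x v) (g x) + B (f x) (FD g x v)"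
  by (subst FD_eqI[OF bounded_bilinear.FDERIV[OF assms(5)]])
    (auto intro: smooth_on_has_derivative[OF assms(1) _ assms(2)] assms simp: add.commute)

lemmas FD_scaleR = FD_bounded_bilinear[OF _ _ _ _ bounded_bilinear_scaleR]

lemma FD_mult:
  fixes f g :: "'a::euclidean_space \<Rightarrow> real"
  assumes "open S" "x \<in> S" "smooth_on S f" "smooth_on S g"
  shows "FD (\<lambda>y. f y * g y) x v = FD f x v * g x + f x * FD g x v"
  by (rule FD_bounded_bilinear[OF assms bounded_bilinear_mult])

lemma FD_const [simp]: "FD (\<lambda>_. c) x v = 0"
  by (rule FD_eqI) (rule has_derivative_const)

lemma FD_cong:
  "open S \<Longrightarrow> x \<in> S \<Longrightarrow> (\<And>y. y \<in> S \<Longrightarrow> f y = g y) \<Longrightarrow> FD f x v = FD g x v"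
  using frechet_derivative_cong_open by metis

lemma FD_compose:
  assumes "open S" "open T" "x \<in> S" "f ` S \<subseteq> T" "smooth_on T g" "smooth_on S f"
  shows "FD (\<lambda>y. g (f y)) x v = FD g (f x) (FD f x v)"
proof (rule FD_eqI)
  have "f x \<in> T" using assms by blast
  then show "((\<lambda>y. g (f y)) has_derivative (\<lambda>v. FD g (f x) (FD f x v))) (at x)"
    using has_derivative_compose[OF smooth_on_has_derivative[OF assms(1,6,3)]
        smooth_on_has_derivative[OF assms(2,5)]] by blast
qed

lemma smooth_on_FD:
  assumes "open S" "smooth_on S f" "smooth_on S X"
  shows "smooth_on S (\<lambda>x. FD f x (X x))"
proof (rule smooth_on_cong[OF assms(1)])
  show "smooth_on S (\<lambda>x. \<Sum>i\<in>Basis. (X x \<bullet> i) *\<^sub>R FD f x i)"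
    by (intro smooth_on_sum smooth_on_scaleR smooth_on_inner_left smooth_on_frechet assms)
  show "(\<Sum>i\<in>Basis. (X x \<bullet> i) *\<^sub>R FD f x i) = FD f x (X x)" if "x \<in> S" for x
    using linear_sum_Basis[OF linear_FD[OF assms(1,2) that]] by metis
qed

lemma bilinear_sum_Basis:
  fixes B :: "'a::euclidean_space \<Rightarrow> 'b::euclidean_space \<Rightarrow> 'c::real_vector"
  assumes "bilinear B"
  shows "B v w = (\<Sum>i\<in>Basis. \<Sum>j\<in>Basis. ((v \<bullet> i) * (w \<bullet> j)) *\<^sub>R B i j)"
proof -
  have l: "linear (\<lambda>v. B v w)" "linear (B v)" for v w
    using assms by (auto simp: bilinear_def)
  have "B v w = (\<Sum>i\<in>Basis. (v \<bullet> i) *\<^sub>R B i w)" by (rule linear_sum_Basis[OF l(1)])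
  also have "\<dots> = (\<Sum>i\<in>Basis. (v \<bullet> i) *\<^sub>R (\<Sum>j\<in>Basis. (w \<bullet> j) *\<^sub>R B i j))"
    using linear_sum_Basis[OF l(2)] by metis
  finally show ?thesis by (simp add: scaleR_sum_right)
qed

lemma smooth_on_bilinear_field:
  fixes B :: "'x::euclidean_space \<Rightarrow> 'a::euclidean_space \<Rightarrow> 'b::euclidean_space \<Rightarrow> 'c::real_normed_vector"
  assumes "open S" "\<And>x. x \<in> S \<Longrightarrow> bilinear (B x)" "\<And>v w. smooth_on S (\<lambda>x. B x v w)"
    "smooth_on S V" "smooth_on S W"
  shows "smooth_on S (\<lambda>x. B x (V x) (W x))"
proof (rule smooth_on_cong[OF assms(1)])
  show "smooth_on S (\<lambda>x. \<Sum>i\<in>Basis. \<Sum>j\<in>Basis. ((V x \<bullet> i) * (W x \<bullet> j)) *\<^sub>R B x i j)"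
    by (intro smooth_on_sum smooth_on_scaleR smooth_on_mult smooth_on_inner_left assms)
  show "(\<Sum>i\<in>Basis. \<Sum>j\<in>Basis. ((V x \<bullet> i) * (W x \<bullet> j)) *\<^sub>R B x i j) = B x (V x) (W x)" if "x \<in> S" for x
    using bilinear_sum_Basis[OF assms(2)[OF that]] by metis
qed

lemma FD_bilinear_field:
  fixes B :: "'x::euclidean_space \<Rightarrow> 'a::euclidean_space \<Rightarrow> 'b::euclidean_space \<Rightarrow> 'c::real_normed_vector"
  assumes S: "open S" and x: "x \<in> S" and B: "\<And>x. x \<in> S \<Longrightarrow> bilinear (B x)"
    and sB: "\<And>v w. smooth_on S (\<lambda>x. B x v w)" and V: "smooth_on S V" and W: "smooth_on S W"
  shows "FD (\<lambda>y. B y (V y) (W y)) x u =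
    FD (\<lambda>y. B y (V x) (W x)) x u + B x (FD V x u) (W x) + B x (V x) (FD W x u)"
proof -
  have r: "FD (\<lambda>y. B y (V y) (W y)) x u = (\<Sum>i\<in>Basis. \<Sum>j\<in>Basis.
      ((V x \<bullet> i) * (W x \<bullet> j)) *\<^sub>R FD (\<lambda>y. B y i j) x u
      + ((FD V x u \<bullet> i) * (W x \<bullet> j)) *\<^sub>R B x i j + ((V x \<bullet> i) * (FD W x u \<bullet> j)) *\<^sub>R B x i j)"
    if V: "smooth_on S V" and W: "smooth_on S W" for V W
  proof -
    have "FD (\<lambda>y. B y (V y) (W y)) x u =
        FD (\<lambda>y. \<Sum>i\<in>Basis. \<Sum>j\<in>Basis. ((V y \<bullet> i) * (W y \<bullet> j)) *\<^sub>R B y i j) x u"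
      by (intro FD_cong[OF S x] bilinear_sum_Basis B)
    also have "\<dots> = (\<Sum>i\<in>Basis. \<Sum>j\<in>Basis. FD (\<lambda>y. ((V y \<bullet> i) * (W y \<bullet> j)) *\<^sub>R B y i j) x u)"
    proof -
      have sm: "smooth_on S (\<lambda>y. ((V y \<bullet> i) * (W y \<bullet> j)) *\<^sub>R B y i j)" for i j
        by (intro smooth_on_scaleR smooth_on_mult smooth_on_inner_left S V W sB)
      show ?thesis
        by (simp only: FD_sum[OF S x smooth_on_sum[OF S sm]] FD_sum[OF S x sm])
    qed
    also have "\<dots> = (\<Sum>i\<in>Basis. \<Sum>j\<in>Basis.
      ((V x \<bullet> i) * (W x \<bullet> j)) *\<^sub>R FD (\<lambda>y. B y i j) x u
      + ((FD V x u \<bullet> i) * (W x \<bullet> j)) *\<^sub>R B x i j + ((V x \<bullet> i) * (FD W x u \<bullet> j)) *\<^sub>R B x i j)"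
    proof (intro sum.cong refl)
      fix i :: 'a and j :: 'b
      show "FD (\<lambda>y. ((V y \<bullet> i) * (W y \<bullet> j)) *\<^sub>R B y i j) x u =
        ((V x \<bullet> i) * (W x \<bullet> j)) *\<^sub>R FD (\<lambda>y. B y i j) x u
      + ((FD V x u \<bullet> i) * (W x \<bullet> j)) *\<^sub>R B x i j + ((V x \<bullet> i) * (FD W x u \<bullet> j)) *\<^sub>R B x i j"
        using FD_scaleR[OF S x smooth_on_mult[OF S smooth_on_inner_left[OF S V] smooth_on_inner_left[OF S W]] sB, of i j i j u]
          FD_mult[OF S x smooth_on_inner_left[OF S V] smooth_on_inner_left[OF S W], of i j u]
          FD_bounded_linear[OF S x V bounded_linear_inner_left, of i u]
          FD_bounded_linear[OF S x W bounded_linear_inner_left, of j u]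
        by (simp add: scaleR_add_left)
    qed
    finally show ?thesis .
  qed
  have c: "FD (\<lambda>y. B y (V x) (W x)) x u = (\<Sum>i\<in>Basis. \<Sum>j\<in>Basis.
      ((V x \<bullet> i) * (W x \<bullet> j)) *\<^sub>R FD (\<lambda>y. B y i j) x u)"
    using r[of "\<lambda>_. V x" "\<lambda>_. W x"] by simp
  show ?thesis
    unfolding r[OF V W] c bilinear_sum_Basis[OF B[OF x], of "FD V x u"]
      bilinear_sum_Basis[OF B[OF x], of "V x"]
    by (simp only: sum.distrib add.assoc)
qed

lemma FD_linear_field:
  fixes A :: "'x::euclidean_space \<Rightarrow> 'a::euclidean_space \<Rightarrow> 'c::real_normed_vector"
  assumes S: "open S" and x: "x \<in> S" and A: "\<And>x. x \<in> S \<Longrightarrow> linear (A x)"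
    and sA: "\<And>v. smooth_on S (\<lambda>x. A x v)" and V: "smooth_on S V"
  shows "FD (\<lambda>y. A y (V y)) x u = FD (\<lambda>y. A y (V x)) x u + A x (FD V x u)"
proof -
  have "bilinear (\<lambda>(r::real) v. r *\<^sub>R A y v)" if "y \<in> S" for y
    using A[OF that] unfolding bilinear_def
    by (auto intro!: linearI simp: linear_add linear_cmul scaleR_add_left scaleR_add_right)
  then have "FD (\<lambda>y. (1::real) *\<^sub>R A y (V y)) x u = FD (\<lambda>y. (1::real) *\<^sub>R A y (V x)) x u
      + FD (\<lambda>_. 1::real) x u *\<^sub>R A x (V x) + (1::real) *\<^sub>R A x (FD V x u)"
    by (intro FD_bilinear_field[where B = "\<lambda>y (r::real) v. r *\<^sub>R A y v" and V = "\<lambda>_. 1", OF S x])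
      (auto intro: smooth_on_scaleR[OF S] sA V)
  then show ?thesis by simp
qed

lemma line_has_real_derivative:
  fixes F :: "'a::euclidean_space \<Rightarrow> real"
  assumes "open S" "smooth_on S F" "x + s *\<^sub>R v \<in> S"
  shows "((\<lambda>t. F (x + t *\<^sub>R v)) has_real_derivative FD F (x + s *\<^sub>R v) v) (at s)"
proof -
  have "((\<lambda>t. F (x + t *\<^sub>R v)) has_derivative (\<lambda>t. FD F (x + s *\<^sub>R v) (t *\<^sub>R v))) (at s)"
    by (rule has_derivative_compose[of "\<lambda>t. x + t *\<^sub>R v" _ _ _ F, OF _ smooth_on_has_derivative[OF assms]])
      (auto intro!: derivative_eq_intros)
  moreover have "FD F (x + s *\<^sub>R v) (t *\<^sub>R v) = FD F (x + s *\<^sub>R v) v * t" for t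
    using linear_cmul[OF linear_FD[OF assms]] by simp
  ultimately show ?thesis by (simp add: has_field_derivative_def)
qed

lemma line_derivative_unique:
  fixes F :: "'a::euclidean_space \<Rightarrow> real"
  assumes S: "open S" "x \<in> S" and F: "\<And>y. y \<in> S \<Longrightarrow> F y = 0"
    and d: "((\<lambda>t. F (x + t *\<^sub>R v)) has_real_derivative d) (at 0)"
  shows "d = 0"
proof -
  have "continuous (at 0) (\<lambda>t::real. x + t *\<^sub>R v)" by (intro continuous_intros)
  then have "\<forall>\<^sub>F t in nhds 0. x + t *\<^sub>R v \<in> S"
    using S unfolding continuous_at_open eventually_nhds by (metis add.right_neutral scaleR_zero_left)
  then have "\<forall>\<^sub>F t in nhds 0. F (x + t *\<^sub>R v) = 0"
    by eventually_elim (rule F)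
  then have "((\<lambda>_. 0) has_real_derivative d) (at 0)"
    using d DERIV_cong_ev[of 0 0 "\<lambda>t. F (x + t *\<^sub>R v)" "\<lambda>_. 0" d d] by simp
  then show ?thesis using DERIV_unique DERIV_const by blast
qed

lemma FD_FD_mvt:
  fixes f :: "'a::euclidean_space \<Rightarrow> real"
  assumes S: "open S" "smooth_on S f"
    and box: "\<And>a b. 0 \<le> a \<Longrightarrow> a \<le> t \<Longrightarrow> 0 \<le> b \<Longrightarrow> b \<le> t \<Longrightarrow> x + a *\<^sub>R u + b *\<^sub>R v \<in> S" and t: "t > 0"
  shows "\<exists>a b. 0 \<le> a \<and> a \<le> t \<and> 0 \<le> b \<and> b \<le> t \<and>
     f (x + t *\<^sub>R u + t *\<^sub>R v) - f (x + t *\<^sub>R u) - f (x + t *\<^sub>R v) + f x =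
     t * t * FD (\<lambda>y. FD f y u) (x + a *\<^sub>R u + b *\<^sub>R v) v"
proof -
  have d: "((\<lambda>s. f (x + s *\<^sub>R u + b *\<^sub>R v)) has_real_derivative FD f (x + a *\<^sub>R u + b *\<^sub>R v) u) (at a)"
    if "0 \<le> a" "a \<le> t" "0 \<le> b" "b \<le> t" for a b
    using line_has_real_derivative[OF S, of "x + b *\<^sub>R v" a u] box[OF that] by (simp add: algebra_simps)
  have "\<exists>z. 0 < z \<and> z < t \<and> (f (x + t *\<^sub>R u + t *\<^sub>R v) - f (x + t *\<^sub>R u + 0 *\<^sub>R v))
     - (f (x + 0 *\<^sub>R u + t *\<^sub>R v) - f (x + 0 *\<^sub>R u + 0 *\<^sub>R v)) =
     (t - 0) * (FD f (x + z *\<^sub>R u + t *\<^sub>R v) u - FD f (x + z *\<^sub>R u + 0 *\<^sub>R v) u)"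
    by (rule MVT2) (use t in \<open>auto intro!: DERIV_diff d d[of _ 0, simplified]\<close>)
  then obtain a where a: "0 < a" "a < t" and e1: "f (x + t *\<^sub>R u + t *\<^sub>R v) - f (x + t *\<^sub>R u)
     - f (x + t *\<^sub>R v) + f x = t * (FD f (x + a *\<^sub>R u + t *\<^sub>R v) u - FD f (x + a *\<^sub>R u) u)"
    by (auto simp: algebra_simps)
  have "\<exists>z. 0 < z \<and> z < t \<and> FD f (x + a *\<^sub>R u + t *\<^sub>R v) u - FD f (x + a *\<^sub>R u + 0 *\<^sub>R v) u =
     (t - 0) * FD (\<lambda>y. FD f y u) (x + a *\<^sub>R u + z *\<^sub>R v) v"
    by (rule MVT2) (use t a in \<open>auto intro!: line_has_real_derivative[OF S(1) smooth_on_frechet[OF S(2)]] box\<close>)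
  then obtain b where "0 < b" "b < t" "FD f (x + a *\<^sub>R u + t *\<^sub>R v) u - FD f (x + a *\<^sub>R u) u =
     t * FD (\<lambda>y. FD f y u) (x + a *\<^sub>R u + b *\<^sub>R v) v" by auto
  then show ?thesis using a e1 by (intro exI[of _ a] exI[of _ b]) auto
qed

lemma FD_FD_commute_real:
  fixes f :: "'a::euclidean_space \<Rightarrow> real"
  assumes S: "open S" "smooth_on S f" "x \<in> S"
  shows "FD (\<lambda>y. FD f y u) x v = FD (\<lambda>y. FD f y v) x u"
proof (rule ccontr)
  let ?P = "\<lambda>y. FD (\<lambda>y. FD f y u) y v" and ?Q = "\<lambda>y. FD (\<lambda>y. FD f y v) y u"
  assume ne: "?P x \<noteq> ?Q x"
  define e where "e = \<bar>?P x - ?Q x\<bar> / 2"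
  have e: "e > 0" using ne by (simp add: e_def)
  have c: "continuous (at x) ?P" "continuous (at x) ?Q"
    using smooth_on_imp_continuous_on[OF smooth_on_frechet[OF smooth_on_frechet[OF S(2)]]] S
      continuous_on_eq_continuous_at by blast+
  obtain d1 where d1: "d1 > 0" "\<And>y. dist y x < d1 \<Longrightarrow> dist (?P y) (?P x) < e"
    using c(1) e unfolding continuous_at_eps_delta by blast
  obtain d2 where d2: "d2 > 0" "\<And>y. dist y x < d2 \<Longrightarrow> dist (?Q y) (?Q x) < e"
    using c(2) e unfolding continuous_at_eps_delta by blast
  obtain d3 where d3: "d3 > 0" "ball x d3 \<subseteq> S" using S open_contains_ball by blast
  define d where "d = min d1 (min d2 d3)"
  define t where "t = d / (2 * (norm u + norm v + 1))"
  have d: "d > 0" using d1 d2 d3 by (simp add: d_def)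
  have n: "norm u + norm v + 1 > 0" by (smt (verit) norm_ge_zero)
  have t: "t > 0" using d n by (simp add: t_def)
  have near: "dist (x + a *\<^sub>R u + b *\<^sub>R v) x < d" if "0 \<le> a" "a \<le> t" "0 \<le> b" "b \<le> t" for a b
  proof -
    have "dist (x + a *\<^sub>R u + b *\<^sub>R v) x = norm (a *\<^sub>R u + b *\<^sub>R v)"
      by (simp add: dist_norm)
    also have "\<dots> \<le> a * norm u + b * norm v"
      using norm_triangle_ineq[of "a *\<^sub>R u" "b *\<^sub>R v"] that by simp
    also have "\<dots> \<le> t * norm u + t * norm v"
      using that by (intro add_mono mult_right_mono) auto
    also have "\<dots> \<le> t * (norm u + norm v + 1)" using t by (simp add: algebra_simps)
    also have "\<dots> = d / 2" using n by (simp add: t_def divide_simps)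
    finally show ?thesis using d by simp
  qed
  then have "x + a *\<^sub>R u + b *\<^sub>R v \<in> S" if "0 \<le> a" "a \<le> t" "0 \<le> b" "b \<le> t" for a b
    using that d3 by (auto simp: d_def dist_commute subset_eq)
  then obtain a b where ab: "0 \<le> a" "a \<le> t" "0 \<le> b" "b \<le> t"
     "f (x + t *\<^sub>R u + t *\<^sub>R v) - f (x + t *\<^sub>R u) - f (x + t *\<^sub>R v) + f x = t * t * ?P (x + a *\<^sub>R u + b *\<^sub>R v)"
    using FD_FD_mvt[OF S(1,2) _ t, of x u v] by auto
  have "x + a *\<^sub>R v + b *\<^sub>R u \<in> S" if "0 \<le> a" "a \<le> t" "0 \<le> b" "b \<le> t" for a b
    using near[OF that(3,4,1,2)] d3 by (auto simp: d_def dist_commute subset_eq algebra_simps)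
  then obtain a' b' where ab': "0 \<le> a'" "a' \<le> t" "0 \<le> b'" "b' \<le> t"
     "f (x + t *\<^sub>R v + t *\<^sub>R u) - f (x + t *\<^sub>R v) - f (x + t *\<^sub>R u) + f x = t * t * ?Q (x + a' *\<^sub>R v + b' *\<^sub>R u)"
    using FD_FD_mvt[OF S(1,2) _ t, of x v u] by auto
  have "t * t * ?P (x + a *\<^sub>R u + b *\<^sub>R v) = t * t * ?Q (x + b' *\<^sub>R u + a' *\<^sub>R v)"
    using ab(5) ab'(5) by (simp add: algebra_simps)
  then have eq: "?P (x + a *\<^sub>R u + b *\<^sub>R v) = ?Q (x + b' *\<^sub>R u + a' *\<^sub>R v)" using t by simp
  have "dist (?P (x + a *\<^sub>R u + b *\<^sub>R v)) (?P x) < e"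
    using near[OF ab(1-4)] by (intro d1) (simp add: d_def)
  moreover have "dist (?Q (x + b' *\<^sub>R u + a' *\<^sub>R v)) (?Q x) < e"
    using near[OF ab'(3,4,1,2)] by (intro d2) (simp add: d_def)
  moreover have False if "\<bar>r - p\<bar> < e" "\<bar>r - q\<bar> < e" "e = \<bar>p - q\<bar> / 2" for p q r :: real
    using that abs_triangle_ineq4[of "r - q" "r - p"] by simp
  ultimately show False unfolding eq dist_real_def using e_def by blast
qed

lemma FD_FD_commute:
  fixes f :: "'a::euclidean_space \<Rightarrow> 'b::euclidean_space"
  assumes S: "open S" "smooth_on S f" "x \<in> S"
  shows "FD (\<lambda>y. FD f y u) x v = FD (\<lambda>y. FD f y v) x u"
proof (rule euclidean_eqI)
  fix i :: 'b assume "i \<in> Basis"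
  have "FD (\<lambda>y. FD f y u) x v \<bullet> i = FD (\<lambda>y. FD (\<lambda>z. f z \<bullet> i) y u) x v" for u v
  proof -
    have "FD (\<lambda>y. FD (\<lambda>z. f z \<bullet> i) y u) x v = FD (\<lambda>y. FD f y u \<bullet> i) x v"
      by (intro FD_cong[OF S(1,3)] FD_bounded_linear[OF S(1) _ S(2) bounded_linear_inner_left])
    then show ?thesis
      using FD_bounded_linear[OF S(1,3) smooth_on_frechet[OF S(2)] bounded_linear_inner_left] by metis
  qed
  then show "FD (\<lambda>y. FD f y u) x v \<bullet> i = FD (\<lambda>y. FD f y v) x u \<bullet> i"
    using FD_FD_commute_real[OF S(1) smooth_on_inner_left[OF S(1,2)] S(3)] by metis
qed

section \<open>Metrics, frames, and the curvature of a space form\<close>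

locale inner_form =
  fixes G :: "'f::euclidean_space \<Rightarrow> 'f \<Rightarrow> real"
  assumes bil: "bilinear G" and sym: "G v w = G w v" and pos: "v \<noteq> 0 \<Longrightarrow> G v v > 0"
begin

lemma add_left: "G (u + v) w = G u w + G v w" using bilinear_ladd[OF bil] .
lemma add_right: "G w (u + v) = G w u + G w v" using bilinear_radd[OF bil] .
lemma scale_left: "G (r *\<^sub>R v) w = r * G v w" using bilinear_lmul[OF bil] by simp
lemma scale_right: "G v (r *\<^sub>R w) = r * G v w" using bilinear_rmul[OF bil] by simp
lemma zero_left: "G 0 w = 0" using bilinear_lzero[OF bil] .
lemma zero_right: "G w 0 = 0" using bilinear_rzero[OF bil] .
lemma minus_left: "G (- v) w = - G v w" using bilinear_lneg[OF bil] .
lemma minus_right: "G w (- v) = - G w v" using bilinear_rneg[OF bil] .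
lemma diff_left: "G (u - v) w = G u w - G v w" using bilinear_lsub[OF bil] .
lemma diff_right: "G w (u - v) = G w u - G w v" using bilinear_rsub[OF bil] .
lemma sum_left: "G (\<Sum>i\<in>I. f i) w = (\<Sum>i\<in>I. G (f i) w)"
  by (induction I rule: infinite_finite_induct) (auto simp: zero_left add_left)
lemma sum_right: "G w (\<Sum>i\<in>I. f i) = (\<Sum>i\<in>I. G w (f i))"
  by (induction I rule: infinite_finite_induct) (auto simp: zero_right add_right)

lemmas form_simps = add_left add_right scale_left scale_right zero_left zero_right
  minus_left minus_right diff_left diff_right sum_left sum_right

lemma eqI:
  assumes "\<And>w. G u w = G v w"
  shows "u = v"
proof -
  have "G (u - v) (u - v) = 0" using assms[of "u - v"] by (simp add: diff_left)
  then show ?thesis using pos[of "u - v"] by force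
qed

end

definition orthonormal_family :: "nat \<Rightarrow> ('f \<Rightarrow> 'f \<Rightarrow> real) \<Rightarrow> (nat \<Rightarrow> 'f) \<Rightarrow> bool" where
  "orthonormal_family n G e \<longleftrightarrow> (\<forall>i<n. \<forall>j<n. G (e i) (e j) = (if i = j then 1 else 0))"

context inner_form
begin

lemma orthonormal_coeff:
  assumes "orthonormal_family n G e" "j < n"
  shows "G (\<Sum>i<n. a i *\<^sub>R e i) (e j) = a j"
proof -
  have "G (\<Sum>i<n. a i *\<^sub>R e i) (e j) = (\<Sum>i<n. if i = j then a i else 0)"
    unfolding sum_left scale_left
    using assms by (intro sum.cong refl) (auto simp: orthonormal_family_def)
  also have "\<dots> = a j" using assms(2) by (simp add: sum.delta)
  finally show ?thesis .
qed

lemma orthonormal_expand: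
  assumes on: "orthonormal_family DIM('f) G e"
  shows "v = (\<Sum>i<DIM('f). G v (e i) *\<^sub>R e i)"
proof -
  let ?n = "DIM('f)"
  have inj: "inj_on e {..<?n}"
    using on unfolding orthonormal_family_def inj_on_def by (metis lessThan_iff zero_neq_one)
  have "independent (e ` {..<?n})"
  proof (rule independent_if_scalars_zero)
    fix f x assume f: "(\<Sum>x\<in>e ` {..<?n}. f x *\<^sub>R x) = 0" and "x \<in> e ` {..<?n}"
    then obtain j where j: "j < ?n" "x = e j" by auto
    have "(\<Sum>i<?n. f (e i) *\<^sub>R e i) = 0" using f by (simp add: sum.reindex[OF inj])
    then show "f x = 0" using orthonormal_coeff[OF on j(1), of "f \<circ> e"] j by (simp add: zero_left)
  qed simp
  then have "UNIV \<subseteq> span (e ` {..<?n})"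
    by (intro card_ge_dim_independent) (auto simp: card_image[OF inj])
  then have "v \<in> span (e ` {..<?n})" by blast
  then obtain u where u: "v = (\<Sum>x\<in>e ` {..<?n}. u x *\<^sub>R x)"
    by (auto simp: span_finite)
  then have v: "v = (\<Sum>i<?n. (u \<circ> e) i *\<^sub>R e i)" by (simp add: sum.reindex[OF inj])
  have "G v (e i) = (u \<circ> e) i" if "i < ?n" for i
    using orthonormal_coeff[OF on that, of "u \<circ> e"] v by simp
  then show ?thesis using v by simp
qed

lemma orthonormal_eqI:
  assumes "orthonormal_family DIM('f) G e" "\<And>i. i < DIM('f) \<Longrightarrow> G u (e i) = G v (e i)"
  shows "u = v"
  using orthonormal_expand[OF assms(1), of u] orthonormal_expand[OF assms(1), of v] assms(2)
  by simp

lemma orthonormal_Parseval: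
  assumes "orthonormal_family DIM('f) G e"
  shows "G v w = (\<Sum>i<DIM('f). G v (e i) * G w (e i))"
proof -
  have "G v w = G (\<Sum>i<DIM('f). G v (e i) *\<^sub>R e i) w"
    using orthonormal_expand[OF assms] by metis
  then show ?thesis by (simp add: form_simps sym[of w])
qed

lemma trace_orthonormal_unique:
  fixes B :: "'f \<Rightarrow> 'f \<Rightarrow> 'c::real_vector"
  assumes B: "bilinear B" and e: "orthonormal_family DIM('f) G e" and f: "orthonormal_family DIM('f) G f"
  shows "(\<Sum>i<DIM('f). B (e i) (e i)) = (\<Sum>i<DIM('f). B (f i) (f i))"
proof -
  let ?n = "DIM('f)"
  have ex: "B v w = (\<Sum>j<?n. \<Sum>k<?n. (G v (f j) * G w (f k)) *\<^sub>R B (f j) (f k))" for v w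
  proof -
    have "B v w = B (\<Sum>j<?n. G v (f j) *\<^sub>R f j) (\<Sum>k<?n. G w (f k) *\<^sub>R f k)"
      using orthonormal_expand[OF f] by metis
    also have "\<dots> = (\<Sum>(j,k)\<in>{..<?n} \<times> {..<?n}. B (G v (f j) *\<^sub>R f j) (G w (f k) *\<^sub>R f k))"
      by (rule bilinear_sum[OF B])
    also have "\<dots> = (\<Sum>j<?n. \<Sum>k<?n. (G v (f j) * G w (f k)) *\<^sub>R B (f j) (f k))"
      by (simp add: sum.cartesian_product bilinear_lmul[OF B] bilinear_rmul[OF B] mult.commute)
    finally show ?thesis .
  qed
  have "(\<Sum>i<?n. B (e i) (e i)) =
      (\<Sum>i<?n. \<Sum>j<?n. \<Sum>k<?n. (G (e i) (f j) * G (e i) (f k)) *\<^sub>R B (f j) (f k))"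
    by (intro sum.cong refl ex)
  also have "\<dots> = (\<Sum>j<?n. \<Sum>k<?n. \<Sum>i<?n. (G (e i) (f j) * G (e i) (f k)) *\<^sub>R B (f j) (f k))"
    by (rule trans[OF sum.swap], rule sum.cong[OF refl], rule sum.swap)
  also have "\<dots> = (\<Sum>j<?n. \<Sum>k<?n. G (f j) (f k) *\<^sub>R B (f j) (f k))"
  proof -
    have "(\<Sum>i<?n. G (e i) (f j) * G (e i) (f k)) = G (f j) (f k)" for j k
      using orthonormal_Parseval[OF e, of "f j" "f k"] by (simp add: sym)
    then show ?thesis by (simp add: scaleR_sum_left[symmetric])
  qed
  also have "\<dots> = (\<Sum>j<?n. \<Sum>k<?n. if j = k then B (f j) (f k) else 0)"
    using f by (intro sum.cong refl) (auto simp: orthonormal_family_def)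
  also have "\<dots> = (\<Sum>j<?n. B (f j) (f j))" by (simp add: sum.delta)
  finally show ?thesis .
qed

end

lemma smooth_on_linear_field:
  fixes A :: "'x::euclidean_space \<Rightarrow> 'a::euclidean_space \<Rightarrow> 'c::real_normed_vector"
  assumes S: "open S" and A: "\<And>x. x \<in> S \<Longrightarrow> linear (A x)"
    and sA: "\<And>v. smooth_on S (\<lambda>x. A x v)" and V: "smooth_on S V"
  shows "smooth_on S (\<lambda>x. A x (V x))"
proof (rule smooth_on_cong[OF S])
  show "smooth_on S (\<lambda>x. \<Sum>i\<in>Basis. (V x \<bullet> i) *\<^sub>R A x i)"
    by (intro smooth_on_sum smooth_on_scaleR smooth_on_inner_left S sA V)
  show "(\<Sum>i\<in>Basis. (V x \<bullet> i) *\<^sub>R A x i) = A x (V x)" if "x \<in> S" for x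
    using linear_sum_Basis[OF A[OF that]] by metis
qed

lemma open_smooth_pos:
  fixes q :: "'a::euclidean_space \<Rightarrow> real"
  assumes "open S" "smooth_on S q"
  shows "open {x \<in> S. q x > 0}"
  using continuous_open_preimage[OF smooth_on_imp_continuous_on[OF assms(2)] assms(1), of "{0<..}"]
  by (simp add: vimage_def Int_def conj_commute)

lemma orthonormal_frame_extend:
  fixes G :: "'x::euclidean_space \<Rightarrow> 'f::euclidean_space \<Rightarrow> 'f \<Rightarrow> real"
  assumes S: "open S" "x0 \<in> S" and G: "\<And>x. x \<in> S \<Longrightarrow> inner_form (G x)"
    and sG: "\<And>v w. smooth_on S (\<lambda>x. G x v w)"
    and e: "\<And>i. i < k \<Longrightarrow> smooth_on S (e i)"
    and on: "\<And>x. x \<in> S \<Longrightarrow> orthonormal_family k (G x) (\<lambda>i. e i x)"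
    and kn: "k \<le> n" "n \<le> DIM('f)"
  shows "\<exists>U e'. open U \<and> x0 \<in> U \<and> U \<subseteq> S \<and> (\<forall>i<k. e' i = e i) \<and> (\<forall>i<n. smooth_on U (e' i)) \<and>
    (\<forall>x\<in>U. orthonormal_family n (G x) (\<lambda>i. e' i x))"
  using kn
proof (induction n rule: dec_induct)
  case base
  then show ?case using S e on by blast
next
  case (step n)
  then obtain U f where U: "open U" "x0 \<in> U" "U \<subseteq> S" and f: "\<forall>i<k. f i = e i"
    "\<And>i. i < n \<Longrightarrow> smooth_on U (f i)" "\<And>x. x \<in> U \<Longrightarrow> orthonormal_family n (G x) (\<lambda>i. f i x)"
    by auto
  have sGU: "smooth_on U (\<lambda>x. G x v w)" for v w using smooth_on_subset[OF sG U(3)] .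
  have GU: "inner_form (G x)" if "x \<in> U" for x using G U that by blast
  have bU: "bilinear (G x)" if "x \<in> U" for x using GU[OF that] by (simp add: inner_form_def)
  have "span ((\<lambda>i. f i x0) ` {..<n}) \<noteq> UNIV"
  proof
    assume s: "span ((\<lambda>i. f i x0) ` {..<n}) = UNIV"
    have "DIM('f) = dim (span ((\<lambda>i. f i x0) ` {..<n}))" using s by simp
    also have "\<dots> \<le> card ((\<lambda>i. f i x0) ` {..<n})" using dim_le_card' by (simp add: dim_le_card')
    also have "\<dots> \<le> n" using card_image_le[of "{..<n}" "\<lambda>i. f i x0"] by simp
    finally show False using step.prems by simp
  qed
  then obtain v where v: "v \<notin> span ((\<lambda>i. f i x0) ` {..<n})" by blast
  define p where "p x = v - (\<Sum>i<n. G x v (f i x) *\<^sub>R f i x)" for x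
  define q where "q x = G x (p x) (p x)" for x
  have sp: "smooth_on U p"
    unfolding p_def
    by (intro smooth_on_diff[OF U(1)] smooth_on_const smooth_on_sum[OF U(1)] smooth_on_scaleR[OF U(1)]
        smooth_on_bilinear_field[OF U(1) bU sGU]) (auto intro: f(2))
  have sq: "smooth_on U q"
    unfolding q_def by (rule smooth_on_bilinear_field[OF U(1) bU sGU sp sp])
  have "p x0 \<noteq> 0"
  proof
    assume "p x0 = 0"
    then have "v = (\<Sum>i<n. G x0 v (f i x0) *\<^sub>R f i x0)" by (simp add: p_def)
    moreover have "(\<Sum>i<n. G x0 v (f i x0) *\<^sub>R f i x0) \<in> span ((\<lambda>i. f i x0) ` {..<n})"
      by (intro span_sum span_scale span_base) auto
    ultimately show False using v by simp
  qed
  then have q0: "q x0 > 0" unfolding q_def using inner_form.pos[OF GU[OF U(2)]] by blast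
  define U' where "U' = {x \<in> U. q x > 0}"
  have U': "open U'" "x0 \<in> U'" "U' \<subseteq> U" "U' \<subseteq> S"
    using open_smooth_pos[OF U(1) sq] q0 U by (auto simp: U'_def)
  define f' where "f' i = (if i = n then (\<lambda>x. (1 / sqrt (q x)) *\<^sub>R p x) else f i)" for i
  have "smooth_on U' (\<lambda>x. (1 / sqrt (q x)) *\<^sub>R p x)"
  proof (intro smooth_on_scaleR smooth_on_divide smooth_on_const smooth_on_sqrt U'(1)
      smooth_on_subset[OF sp U'(3)] smooth_on_subset[OF sq U'(3)])
    fix x assume "x \<in> U'"
    then show "q x > 0" "sqrt (q x) \<noteq> 0" by (auto simp: U'_def)
  qed
  then have "smooth_on U' (f' i)" if "i < Suc n" for i
    using that f(2)[of i] smooth_on_subset[OF _ U'(3)] by (auto simp: f'_def)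
  moreover have "orthonormal_family (Suc n) (G x) (\<lambda>i. f' i x)" if "x \<in> U'" for x
  proof -
    have x: "x \<in> U" "q x > 0" using that by (auto simp: U'_def)
    interpret inner_form "G x" using GU[OF x(1)] .
    have pf: "G x (p x) (f j x) = 0" if "j < n" for j
      using orthonormal_coeff[OF f(3)[OF x(1)] that, of "\<lambda>i. G x v (f i x)"]
      by (simp add: p_def diff_left)
    have fp: "G x (f j x) (p x) = 0" if "j < n" for j using pf[OF that] sym by metis
    have "G x (p x) (p x) = sqrt (q x) * sqrt (q x)" using x by (simp add: q_def)
    then show ?thesis
      using f(3)[OF x(1)] x pf fp
      by (auto simp: orthonormal_family_def f'_def scale_left scale_right less_Suc_eq)
  qed
  moreover have "\<forall>i<k. f' i = e i" using f(1) step.hyps by (auto simp: f'_def)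
  ultimately show ?case using U' by blast
qed

lemma metric_trace_orthonormal:
  fixes B :: "'e::euclidean_space \<Rightarrow> 'e \<Rightarrow> 'f::real_vector"
  assumes g: "inner_form (g x)" and B: "bilinear B"
    and e: "orthonormal_family DIM('e) (g x) e"
  shows "metric_trace g x B = (\<Sum>i<DIM('e). B (e i) (e i))"
proof -
  obtain \<beta> where \<beta>: "bij_betw \<beta> {..<DIM('e)} (Basis :: 'e set)"
    using ex_bij_betw_nat_finite[OF finite_Basis] by (metis atLeast0LessThan)
  let ?inv = "the_inv_into {..<DIM('e)} \<beta>"
  have inj: "inj_on \<beta> {..<DIM('e)}" and im: "\<beta> ` {..<DIM('e)} = Basis"
    using \<beta> by (auto simp: bij_betw_def)
  have "orthonormal_basis_at g x (\<lambda>b. e (?inv b))"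
    unfolding orthonormal_basis_at_def
  proof (intro ballI)
    have *: "\<exists>a<DIM('e). i = \<beta> a" if "i \<in> Basis" for i
    proof -
      have "i \<in> \<beta> ` {..<DIM('e)}" using that by (subst im)
      then show ?thesis by auto
    qed
    fix i j :: 'e assume "i \<in> Basis" "j \<in> Basis"
    then obtain a b where "a < DIM('e)" "b < DIM('e)" "i = \<beta> a" "j = \<beta> b"
      using * by meson
    then show "g x (e (?inv i)) (e (?inv j)) = (if i = j then 1 else 0)"
      using e inj by (auto simp: orthonormal_family_def the_inv_into_f_f inj_on_eq_iff)
  qed
  then have "orthonormal_basis_at g x (SOME b. orthonormal_basis_at g x b)"
    by (rule someI[where P = "orthonormal_basis_at g x"])
  then obtain b where b: "orthonormal_basis_at g x b" and t: "metric_trace g x B = (\<Sum>i\<in>Basis. B (b i) (b i))"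
    by (auto simp: metric_trace_def Let_def)
  have "orthonormal_family DIM('e) (g x) (b \<circ> \<beta>)"
    unfolding orthonormal_family_def
  proof (intro allI impI)
    fix i j assume ij: "i < DIM('e)" "j < DIM('e)"
    then have "\<beta> i \<in> Basis" "\<beta> j \<in> Basis" using \<beta> bij_betwE by blast+
    then show "g x ((b \<circ> \<beta>) i) ((b \<circ> \<beta>) j) = (if i = j then 1 else 0)"
      using b ij inj_on_eq_iff[OF inj] by (simp add: orthonormal_basis_at_def)
  qed
  then have "(\<Sum>i<DIM('e). B (e i) (e i)) = (\<Sum>i<DIM('e). B (b (\<beta> i)) (b (\<beta> i)))"
    using inner_form.trace_orthonormal_unique[OF g B e, of "b \<circ> \<beta>"] by simp
  also have "\<dots> = (\<Sum>i\<in>Basis. B (b i) (b i))"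
    using sum.reindex_bij_betw[OF \<beta>, of "\<lambda>i. B (b i) (b i)"] .
  finally show ?thesis using t by simp
qed

locale riemannian_domain =
  fixes T :: "'f::euclidean_space set" and h :: "'f \<Rightarrow> 'f \<Rightarrow> 'f \<Rightarrow> real"
  assumes open_T: "open T" and metric: "riemannian_metric_on T h"
begin

lemma form: "y \<in> T \<Longrightarrow> inner_form (h y)"
  using metric unfolding riemannian_metric_on_def inner_form_def by blast

lemma bilinear_h: "y \<in> T \<Longrightarrow> bilinear (h y)"
  using form by (simp add: inner_form_def)

lemma sym_h: "y \<in> T \<Longrightarrow> h y v w = h y w v"
  using form inner_form.sym by blast

lemma smooth_h: "smooth_on T (\<lambda>y. h y v w)"
  using metric unfolding riemannian_metric_on_def by blast

definition dh :: "'f \<Rightarrow> 'f \<Rightarrow> 'f \<Rightarrow> 'f \<Rightarrow> real" where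
  "dh y u v w = FD (\<lambda>y. h y v w) y u"

lemma linear_dh: "y \<in> T \<Longrightarrow> linear (\<lambda>u. dh y u v w)"
  unfolding dh_def using linear_FD[OF open_T smooth_h] by blast

lemma dh_sym: "y \<in> T \<Longrightarrow> dh y u v w = dh y u w v"
  unfolding dh_def using sym_h by (intro FD_cong[OF open_T]) auto

lemma bilinear_dh:
  assumes y: "y \<in> T"
  shows "bilinear (dh y u)"
proof -
  have a: "dh y u (v + v') w = dh y u v w + dh y u v' w" for v v' w
  proof -
    have "dh y u (v + v') w = FD (\<lambda>y. h y v w + h y v' w) y u"
      unfolding dh_def by (intro FD_cong[OF open_T y]) (simp add: inner_form.add_left[OF form])
    then show ?thesis by (simp add: FD_add[OF open_T y smooth_h smooth_h] dh_def)
  qed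
  have s: "dh y u (r *\<^sub>R v) w = r * dh y u v w" for r v w
  proof -
    have "dh y u (r *\<^sub>R v) w = FD (\<lambda>y. r * h y v w) y u"
      unfolding dh_def by (intro FD_cong[OF open_T y]) (simp add: inner_form.scale_left[OF form])
    then show ?thesis
      using FD_bounded_linear[OF open_T y smooth_h bounded_linear_mult_right] by (simp add: dh_def)
  qed
  show ?thesis
    unfolding bilinear_def using a s dh_sym[OF y] by (auto intro!: linearI)
qed

lemma smooth_dh: "smooth_on T (\<lambda>y. dh y u v w)"
  unfolding dh_def by (rule smooth_on_frechet[OF smooth_h])

definition koszul :: "'f \<Rightarrow> 'f \<Rightarrow> 'f \<Rightarrow> 'f \<Rightarrow> real" where
  "koszul y v w z = (dh y v w z + dh y w v z - dh y z v w) / 2"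

lemma linear_koszul:
  assumes y: "y \<in> T"
  shows "linear (koszul y v w)" "linear (\<lambda>v. koszul y v w z)" "linear (\<lambda>w. koszul y v w z)"
proof -
  note simps = koszul_def linear_add[OF linear_dh[OF y]] linear_cmul[OF linear_dh[OF y]]
    bilinear_ladd[OF bilinear_dh[OF y]] bilinear_radd[OF bilinear_dh[OF y]]
    bilinear_lmul[OF bilinear_dh[OF y]] bilinear_rmul[OF bilinear_dh[OF y]] field_simps
  show "linear (koszul y v w)" "linear (\<lambda>v. koszul y v w z)" "linear (\<lambda>w. koszul y v w z)"
    by (rule linearI; simp add: simps)+
qed

lemma smooth_koszul: "smooth_on T (\<lambda>y. koszul y v w z)"
  unfolding koszul_def
  by (intro smooth_on_divide smooth_on_diff smooth_on_add smooth_dh smooth_on_const open_T) auto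

definition is_christoffel :: "'f \<Rightarrow> ('f \<Rightarrow> 'f \<Rightarrow> 'f) \<Rightarrow> bool" where
  "is_christoffel y \<Gamma> \<longleftrightarrow> bilinear \<Gamma> \<and> (\<forall>v w. \<Gamma> v w = \<Gamma> w v) \<and>
     (\<forall>u v w. dh y u v w = h y (\<Gamma> u v) w + h y v (\<Gamma> u w))"

lemma is_christoffel_unique:
  assumes y: "y \<in> T" and 1: "is_christoffel y \<Gamma>" and 2: "is_christoffel y \<Gamma>'"
  shows "\<Gamma> = \<Gamma>'"
proof (intro ext)
  interpret inner_form "h y" by (rule form[OF y])
  define B where "B u v w = h y (\<Gamma> u v - \<Gamma>' u v) w" for u v w
  have s: "B u v w = B v u w" for u v w
    using 1 2 unfolding B_def is_christoffel_def by metis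
  have a: "B u v w = - B u w v" for u v w
  proof -
    have "h y (\<Gamma> u v) w + h y v (\<Gamma> u w) = h y (\<Gamma>' u v) w + h y v (\<Gamma>' u w)"
      using 1 2 unfolding is_christoffel_def by metis
    then show ?thesis by (simp add: B_def diff_left sym[of v])
  qed
  have "B u v w = 0" for u v w
    using s a by (smt (verit))
  then show "\<Gamma> u v = \<Gamma>' u v" for u v
    by (intro eqI) (simp add: B_def diff_left)
qed

lemma christoffel_eqI: "y \<in> T \<Longrightarrow> is_christoffel y \<Gamma> \<Longrightarrow> christoffel h y = \<Gamma>"
  unfolding christoffel_def dh_def[symmetric] is_christoffel_def[symmetric]
  using is_christoffel_unique by (intro the_equality) blast+

lemma christoffel_local:
  assumes "y0 \<in> T"
  shows "\<exists>U. open U \<and> y0 \<in> U \<and> U \<subseteq> T \<and> (\<forall>y\<in>U. is_christoffel y (christoffel h y)) \<and>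
    (\<forall>v w. smooth_on U (\<lambda>y. christoffel h y v w))"
proof -
  obtain U F where U: "open U" "y0 \<in> U" "U \<subseteq> T" and sF: "\<And>i. i < DIM('f) \<Longrightarrow> smooth_on U (F i)"
    and F: "\<And>y. y \<in> U \<Longrightarrow> orthonormal_family DIM('f) (h y) (\<lambda>i. F i y)"
  proof -
    have "\<exists>U F. open U \<and> y0 \<in> U \<and> U \<subseteq> T \<and> (\<forall>i<0. F i = (\<lambda>_. 0)) \<and> (\<forall>i<DIM('f). smooth_on U (F i)) \<and>
      (\<forall>y\<in>U. orthonormal_family DIM('f) (h y) (\<lambda>i. F i y))"
      by (rule orthonormal_frame_extend[OF open_T assms form smooth_h, of 0 "\<lambda>_ _. 0"])
        (auto simp: orthonormal_family_def)
    then show ?thesis using that by blast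
  qed
  define \<Gamma> where "\<Gamma> y v w = (\<Sum>i<DIM('f). koszul y v w (F i y) *\<^sub>R F i y)" for y v w
  have G: "is_christoffel y (\<Gamma> y)" if "y \<in> U" for y
  proof -
    have y: "y \<in> T" using that U by blast
    interpret inner_form "h y" by (rule form[OF y])
    note lk = linear_koszul[OF y]
    have b: "bilinear (\<Gamma> y)"
      unfolding bilinear_def \<Gamma>_def
      by (auto intro!: linearI simp: linear_add[OF lk(2)] linear_add[OF lk(3)] linear_cmul[OF lk(2)]
          linear_cmul[OF lk(3)] scaleR_add_left sum.distrib scaleR_sum_right)
    have k: "h y (\<Gamma> y v w) z = koszul y v w z" for v w z
    proof -
      have "koszul y v w z = koszul y v w (\<Sum>i<DIM('f). h y z (F i y) *\<^sub>R F i y)"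
        using orthonormal_expand[OF F[OF that]] by metis
      also have "\<dots> = (\<Sum>i<DIM('f). h y z (F i y) * koszul y v w (F i y))"
        by (simp add: linear_sum[OF lk(1)] linear_cmul[OF lk(1)])
      also have "\<dots> = h y (\<Gamma> y v w) z"
        by (simp add: \<Gamma>_def sum_left scale_left sym[of z] mult.commute)
      finally show ?thesis ..
    qed
    have "\<Gamma> y v w = \<Gamma> y w v" for v w
      by (simp add: \<Gamma>_def koszul_def dh_sym[OF y, of _ v w] add.commute)
    moreover have "dh y u v w = h y (\<Gamma> y u v) w + h y v (\<Gamma> y u w)" for u v w
      unfolding sym[of v "\<Gamma> y u w"] k koszul_def dh_sym[OF y, of u w v] by (simp add: field_simps)
    ultimately show ?thesis using b by (simp add: is_christoffel_def)
  qed
  have eq: "christoffel h y = \<Gamma> y" if "y \<in> U" for y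
    using christoffel_eqI G that U by blast
  have sm: "smooth_on U (\<lambda>y. \<Gamma> y v w)" for v w
    unfolding \<Gamma>_def
  proof (rule smooth_on_sum[OF U(1)])
    fix i assume "i \<in> {..<DIM('f)}"
    then have i: "smooth_on U (F i)" using sF by simp
    have "linear (koszul y v w)" if "y \<in> U" for y using linear_koszul(1) that U(3) by blast
    then show "smooth_on U (\<lambda>y. koszul y v w (F i y) *\<^sub>R F i y)"
      by (rule smooth_on_scaleR[OF U(1) smooth_on_linear_field[OF U(1) _ smooth_on_subset[OF smooth_koszul U(3)] i] i])
  qed
  have "smooth_on U (\<lambda>y. christoffel h y v w)" for v w
    by (rule smooth_on_cong[OF U(1) _ sm]) (simp add: eq)
  then show ?thesis using U G eq by (intro exI[of _ U]) auto
qed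

lemma christoffel: "y \<in> T \<Longrightarrow> is_christoffel y (christoffel h y)"
  using christoffel_local by blast

lemma bilinear_christoffel: "y \<in> T \<Longrightarrow> bilinear (christoffel h y)"
  and christoffel_sym: "y \<in> T \<Longrightarrow> christoffel h y v w = christoffel h y w v"
  and christoffel_compat: "y \<in> T \<Longrightarrow>
    FD (\<lambda>y. h y v w) y u = h y (christoffel h y u v) w + h y v (christoffel h y u w)"
  using christoffel unfolding is_christoffel_def dh_def by blast+

lemma smooth_christoffel: "smooth_on T (\<lambda>y. christoffel h y v w)"
proof (rule smooth_on_local)
  fix y assume "y \<in> T"
  from christoffel_local[OF this] obtain U where "open U" "y \<in> U"
    and s: "\<forall>v w. smooth_on U (\<lambda>y. christoffel h y v w)" by (elim exE conjE)
  then show "\<exists>U. open U \<and> y \<in> U \<and> smooth_on U (\<lambda>y. christoffel h y v w)"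
    using s[rule_format, of v w] by (intro exI[of _ U] conjI)
qed

definition Rm :: "'f \<Rightarrow> 'f \<Rightarrow> 'f \<Rightarrow> 'f \<Rightarrow> 'f" where
  "Rm y u v w = FD (\<lambda>z. christoffel h z v w) y u - FD (\<lambda>z. christoffel h z u w) y v
     + christoffel h y u (christoffel h y v w) - christoffel h y v (christoffel h y u w)"

lemma curvature_const:
  assumes "y \<in> T"
  shows "curvature h (\<lambda>_. u) (\<lambda>_. v) (\<lambda>_. w) y = Rm y u v w"
  using bilinear_lzero[OF bilinear_christoffel[OF assms]]
  by (simp add: curvature_def levi_civita_def[abs_def] lie_bracket_def Rm_def)

lemma bilinear_FD_christoffel:
  assumes y: "y \<in> T"
  shows "bilinear (\<lambda>v w. FD (\<lambda>z. christoffel h z v w) y u)"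
proof -
  note bc = bilinear_christoffel
  have "FD (\<lambda>z. christoffel h z (v + v') w) y u = FD (\<lambda>z. christoffel h z v w) y u + FD (\<lambda>z. christoffel h z v' w) y u"
    "FD (\<lambda>z. christoffel h z w (v + v')) y u = FD (\<lambda>z. christoffel h z w v) y u + FD (\<lambda>z. christoffel h z w v') y u"
    for v v' w
    unfolding FD_add[OF open_T y smooth_christoffel smooth_christoffel, symmetric]
    by (intro FD_cong[OF open_T y] bilinear_ladd[OF bc] bilinear_radd[OF bc]; assumption)+
  moreover have "FD (\<lambda>z. christoffel h z (r *\<^sub>R v) w) y u = r *\<^sub>R FD (\<lambda>z. christoffel h z v w) y u"
    "FD (\<lambda>z. christoffel h z w (r *\<^sub>R v)) y u = r *\<^sub>R FD (\<lambda>z. christoffel h z w v) y u" for r v w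
    unfolding FD_bounded_linear[OF open_T y smooth_christoffel bounded_linear_scaleR_right, symmetric]
    by (intro FD_cong[OF open_T y] bilinear_lmul[OF bc] bilinear_rmul[OF bc]; assumption)+
  ultimately show ?thesis unfolding bilinear_def by (auto intro!: linearI)
qed

lemma Rm_linear:
  assumes y: "y \<in> T"
  shows "Rm y (u + u') v w = Rm y u v w + Rm y u' v w"
    "Rm y u (v + v') w = Rm y u v w + Rm y u v' w"
    "Rm y u v (w + w') = Rm y u v w + Rm y u v w'"
  using linear_add[OF linear_FD[OF open_T smooth_christoffel y]]
    bilinear_ladd[OF bilinear_FD_christoffel[OF y]] bilinear_radd[OF bilinear_FD_christoffel[OF y]]
    bilinear_ladd[OF bilinear_christoffel[OF y]] bilinear_radd[OF bilinear_christoffel[OF y]]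
  by (simp_all add: Rm_def)

lemma Rm_skew: "Rm y u v w = - Rm y v u w"
  by (simp add: Rm_def)

lemma Rm_bianchi:
  assumes "y \<in> T"
  shows "Rm y u v w + Rm y v w u + Rm y w u v = 0"
proof -
  have "FD (\<lambda>z. christoffel h z v w) y u = FD (\<lambda>z. christoffel h z w v) y u" for u v w
    by (intro FD_cong[OF open_T assms] christoffel_sym)
  then show ?thesis
    using christoffel_sym[OF assms] by (simp add: Rm_def algebra_simps)
qed

lemma FD_h_fields:
  assumes y: "y \<in> T" and U: "open U" "U \<subseteq> T" "y \<in> U" and A: "smooth_on U A" and B: "smooth_on U B"
  shows "FD (\<lambda>y. h y (A y) (B y)) y u =
    h y (FD A y u + christoffel h y u (A y)) (B y) + h y (A y) (FD B y u + christoffel h y u (B y))"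
proof -
  have "FD (\<lambda>y. h y (A y) (B y)) y u =
    FD (\<lambda>z. h z (A y) (B y)) y u + h y (FD A y u) (B y) + h y (A y) (FD B y u)"
    using smooth_on_subset[OF smooth_h U(2)] bilinear_h U
    by (intro FD_bilinear_field[OF U(1,3)] A B) auto
  then show ?thesis
    by (simp add: christoffel_compat[OF y] inner_form.form_simps[OF form[OF y]])
qed

lemma Rm_skew_metric:
  assumes y: "y \<in> T"
  shows "h y (Rm y u v w) w = 0"
proof -
  interpret inner_form "h y" by (rule form[OF y])
  note sc = smooth_christoffel
  have "FD (\<lambda>z. FD (\<lambda>z. h z w w) z v) y u = FD (\<lambda>z. h z (2 *\<^sub>R christoffel h z v w) w) y u" for u v
    by (intro FD_cong[OF open_T y])
      (simp add: christoffel_compat sym_h[of _ w] inner_form.scale_left[OF form])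
  moreover have "FD (\<lambda>z. h z (2 *\<^sub>R christoffel h z v w) w) y u =
     2 * (h y (FD (\<lambda>z. christoffel h z v w) y u + christoffel h y u (christoffel h y v w)) w
       + h y (christoffel h y v w) (christoffel h y u w))" for u v
    using FD_h_fields[OF y open_T order_refl y smooth_on_bounded_linear[OF bounded_linear_scaleR_right[of 2] open_T sc]
        smooth_on_const, of v w w u]
    by (simp add: FD_bounded_linear[OF open_T y sc bounded_linear_scaleR_right]
      bilinear_rmul[OF bilinear_christoffel[OF y]] scale_left add_left)
  ultimately show ?thesis
    using FD_FD_commute[OF open_T smooth_h y, of w w u v] sym[of "christoffel h y v w"]
    by (simp add: Rm_def diff_left add_left)
qed

end

lemma curvature_like_zero:
  fixes T :: "'a::ab_group_add \<Rightarrow> 'a \<Rightarrow> 'a \<Rightarrow> 'a \<Rightarrow> real"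
  assumes add: "\<And>u u' v w z. T (u + u') v w z = T u v w z + T u' v w z"
    "\<And>u v v' w z. T u (v + v') w z = T u v w z + T u v' w z"
    "\<And>u v w w' z. T u v (w + w') z = T u v w z + T u v w' z"
    "\<And>u v w z z'. T u v w (z + z') = T u v w z + T u v w z'"
    and skew: "\<And>u v w z. T u v w z = - T v u w z" "\<And>u v w z. T u v w z = - T u v z w"
    and bianchi: "\<And>u v w z. T u v w z + T v w u z + T w u v z = 0"
    and sec: "\<And>v w. T v w w v = 0"
  shows "T u v w z = 0"
proof -
  have pair: "T u v w z = T w z u v" for u v w z
    using bianchi[of u v w z] bianchi[of v w z u] bianchi[of w z u v] bianchi[of z u v w]
      skew(1)[of v w] skew(1)[of w z] skew(1)[of u v] skew(1)[of u z] skew(1)[of u w] skew(1)[of v z]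
      skew(2)[of v w] skew(2)[of w z] skew(2)[of u v] skew(2)[of u z] skew(2)[of u w] skew(2)[of v z]
      skew(2)[of w u] skew(2)[of z v]
    by (smt (verit))
  have "T v w w z + T z w w v = 0" for v w z
    using sec[of "v + z" w] sec[of v w] sec[of z w] by (simp add: add)
  moreover have "T z w w v = T v w w z" for v w z
    using pair[of z w w v] skew(1)[of w v z w] skew(2)[of v w z w] by simp
  ultimately have 0: "T v w w z = 0" for v w z by (metis add_cancel_right_right double_zero_sym)
  have s: "T u v w z = - T u w v z" for u v w z
    using 0[of u "v + w" z] 0[of u v z] 0[of u w z] by (simp add: add)
  show ?thesis
    using bianchi[of u v w z] s[of v w u z] s[of u v w z] skew(1)[of v u w z] skew(1)[of w u v z] by linarith
qed

context riemannian_domain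
begin

lemma Rm_constant_curvature:
  assumes y: "y \<in> T"
    and c: "\<And>v w. v \<noteq> w \<Longrightarrow> independent {v, w} \<Longrightarrow> sectional_curvature h y v w = c"
  shows "h y (Rm y u v w) z = c * (h y v w * h y u z - h y u w * h y v z)"
proof -
  interpret inner_form "h y" by (rule form[OF y])
  define D where "D u v w z = h y (Rm y u v w) z - c * (h y v w * h y u z - h y u w * h y v z)" for u v w z
  note add = Rm_linear[OF y] add_left add_right
  have Rsk: "h y (Rm y u v w) z = - h y (Rm y u v z) w" for u v w z
    using Rm_skew_metric[OF y, of u v "w + z"] Rm_skew_metric[OF y, of u v w] Rm_skew_metric[OF y, of u v z]
    by (simp add: add)
  have R0: "Rm y v v w = 0" for v w by (simp add: Rm_def)
  have sec: "D v w w v = 0" for v w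
  proof (cases "v \<noteq> w \<and> independent {v, w}")
    case True
    let ?d = "h y v v * h y w w - (h y v w)\<^sup>2"
    have w0: "w \<noteq> 0" using True dependent_zero by auto
    then have ww: "h y w w > 0" by (rule pos)
    define p where "p = v - (h y v w / h y w w) *\<^sub>R w"
    have "p \<noteq> 0"
    proof
      assume "p = 0"
      then have "v \<in> span {w}" unfolding p_def by (simp add: span_breakdown_eq) (metis)
      then show False using True by (simp add: independent_insert)
    qed
    then have "0 < h y p p * h y w w" using pos ww by simp
    also have "\<dots> = ?d"
      using ww sym[of w v] by (simp add: p_def form_simps power2_eq_square field_simps)
    finally have d: "?d > 0" .
    have "h y (Rm y v w w) v = c * ?d"
      using c[of v w] True d by (simp add: sectional_curvature_def curvature_const[OF y] field_simps)
    then show ?thesis by (simp add: D_def power2_eq_square sym[of w v] algebra_simps)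
  next
    case False
    have rs: "Rm y v w (r *\<^sub>R z) = r *\<^sub>R Rm y v w z" "Rm y (r *\<^sub>R v) w z = r *\<^sub>R Rm y v w z" for r v w z
      by (simp_all add: Rm_def bilinear_rmul[OF bilinear_FD_christoffel[OF y]] bilinear_lmul[OF bilinear_FD_christoffel[OF y]]
          linear_cmul[OF linear_FD[OF open_T smooth_christoffel y]]
          bilinear_rmul[OF bilinear_christoffel[OF y]] bilinear_lmul[OF bilinear_christoffel[OF y]] algebra_simps)
    have rs': "Rm y v (r *\<^sub>R w) z = r *\<^sub>R Rm y v w z" for r v w z
      using rs(2)[of r w v z] Rm_skew[of y v "r *\<^sub>R w" z] Rm_skew[of y v w z] by simp
    have "w = 0 \<or> (\<exists>r. v = r *\<^sub>R w)"
    proof (rule ccontr)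
      assume n: "\<not> ?thesis"
      then have "v \<notin> span {w}" by (auto simp: span_breakdown_eq)
      moreover have "independent {w}" using n by simp
      moreover have "v \<noteq> w" using n by (metis scaleR_one)
      ultimately show False using False by (simp add: independent_insert)
    qed
    then show ?thesis
      using rs(1)[of v _ 0 0] by (auto simp: D_def rs rs' R0 form_simps)
  qed
  have "D u v w z = 0"
  proof (rule curvature_like_zero[of D])
    show "D u v w z = - D v u w z" for u v w z
      using Rm_skew[of y u v w] by (simp add: D_def minus_left algebra_simps)
    show "D u v w z = - D u v z w" for u v w z
      using Rsk[of u v w z] by (simp add: D_def algebra_simps)
    show "D u v w z + D v w u z + D w u v z = 0" for u v w z
      using arg_cong[OF Rm_bianchi[OF y, of u v w], of "\<lambda>p. h y p z"] sym[of v u] sym[of w u] sym[of w v]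
      by (simp add: D_def add_left zero_left algebra_simps)
    show "D v w w v = 0" for v w by (rule sec)
  qed (auto simp: D_def add algebra_simps)
  then show ?thesis by (simp add: D_def)
qed

end

section \<open>The moving frame of a hypersurface\<close>

lemma FD_lie_bracket:
  fixes f :: "'a::euclidean_space \<Rightarrow> 'b::euclidean_space"
  assumes S: "open S" and x: "x \<in> S" and f: "smooth_on S f" and X: "smooth_on S X" and Y: "smooth_on S Y"
  shows "FD (\<lambda>y. FD f y (Y y)) x (X x) - FD (\<lambda>y. FD f y (X y)) x (Y x) = FD f x (lie_bracket X Y x)"
proof -
  note l = linear_FD[OF S f]
  have "FD (\<lambda>y. FD f y (Y y)) x (X x) = FD (\<lambda>y. FD f y (Y x)) x (X x) + FD f x (FD Y x (X x))"
    by (rule FD_linear_field[OF S x l smooth_on_frechet[OF f] Y])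
  moreover have "FD (\<lambda>y. FD f y (X y)) x (Y x) = FD (\<lambda>y. FD f y (X x)) x (Y x) + FD f x (FD X x (Y x))"
    by (rule FD_linear_field[OF S x l smooth_on_frechet[OF f] X])
  ultimately show ?thesis
    using FD_FD_commute[OF S f x, of "Y x" "X x"]
    by (simp add: lie_bracket_def linear_diff[OF l[OF x]])
qed

locale isometric_chart = g: riemannian_domain S g + h: riemannian_domain T h
  for S :: "'e::euclidean_space set" and g and T :: "'f::euclidean_space set" and h +
  fixes \<phi> :: "'e \<Rightarrow> 'f"
  assumes smooth_phi: "smooth_on S \<phi>" and phi_into: "\<phi> ` S \<subseteq> T"
    and isometric: "x \<in> S \<Longrightarrow> h (\<phi> x) (FD \<phi> x v) (FD \<phi> x w) = g x v w"
begin

abbreviation C where "C x \<equiv> christoffel h (\<phi> x)"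
abbreviation cov where "cov \<equiv> pullback_connection h \<phi>"
abbreviation push where "push \<equiv> pushforward \<phi>"

lemmas open_S = g.open_T

lemma phi_T: "x \<in> S \<Longrightarrow> \<phi> x \<in> T" using phi_into by blast

lemma form_phi: "x \<in> S \<Longrightarrow> inner_form (h (\<phi> x))" using h.form phi_T by blast

lemma bilinear_phi: "x \<in> S \<Longrightarrow> bilinear (h (\<phi> x))" using h.bilinear_h phi_T by blast

lemma smooth_h_phi: "smooth_on S (\<lambda>x. h (\<phi> x) v w)"
  by (rule smooth_on_compose[OF open_S h.open_T phi_into h.smooth_h smooth_phi])

lemma smooth_C: "smooth_on S (\<lambda>x. C x v w)"
  by (rule smooth_on_compose[OF open_S h.open_T phi_into h.smooth_christoffel smooth_phi])

lemma bilinear_C: "x \<in> S \<Longrightarrow> bilinear (C x)" using h.bilinear_christoffel phi_T by blast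

lemma linear_dphi: "x \<in> S \<Longrightarrow> linear (FD \<phi> x)" by (rule linear_FD[OF open_S smooth_phi])

lemma smooth_dphi: "smooth_on S X \<Longrightarrow> smooth_on S (\<lambda>x. FD \<phi> x (X x))"
  by (rule smooth_on_FD[OF open_S smooth_phi])

lemma smooth_push: "smooth_on S X \<Longrightarrow> smooth_on S (push X)"
  unfolding pushforward_def[abs_def] by (rule smooth_dphi)

lemma smooth_metric_fields:
  "smooth_on S V \<Longrightarrow> smooth_on S W \<Longrightarrow> smooth_on S (\<lambda>x. h (\<phi> x) (V x) (W x))"
  by (rule smooth_on_bilinear_field[OF open_S bilinear_phi smooth_h_phi])

lemma cov_eq: "cov X V x = FD V x (X x) + C x (FD \<phi> x (X x)) (V x)"
  by (simp add: pullback_connection_def pushforward_def)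

lemma smooth_cov:
  assumes "smooth_on S X" "smooth_on S V"
  shows "smooth_on S (cov X V)"
  unfolding cov_eq[abs_def]
  by (rule smooth_on_add[OF open_S smooth_on_FD[OF open_S assms(2,1)]
    smooth_on_bilinear_field[OF open_S bilinear_C smooth_C smooth_dphi[OF assms(1)] assms(2)]])

lemma cov_cong:
  assumes "x \<in> S" "\<And>y. y \<in> S \<Longrightarrow> V y = W y"
  shows "cov X V x = cov X W x"
  using FD_cong[OF open_S assms] assms by (simp add: cov_eq)

lemma cov_linear_dir:
  assumes x: "x \<in> S" and V: "smooth_on S V" and Y: "Y x = (\<Sum>k\<in>I. a k *\<^sub>R X k x)"
  shows "cov Y V x = (\<Sum>k\<in>I. a k *\<^sub>R cov (X k) V x)"
proof -
  have b: "linear (\<lambda>u. C x u (V x))" using bilinear_C[OF x] by (simp add: bilinear_def)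
  note l = linear_FD[OF open_S V x] linear_dphi[OF x]
  show ?thesis
    by (simp add: cov_eq Y linear_sum[OF l(1)] linear_sum[OF l(2)] linear_sum[OF b]
        linear_cmul[OF l(1)] linear_cmul[OF l(2)] linear_cmul[OF b] sum.distrib scaleR_add_right)
qed

lemma cov_scale:
  assumes x: "x \<in> S" and F: "smooth_on S F" and V: "smooth_on S V"
  shows "cov X (\<lambda>y. F y *\<^sub>R V y) x = FD F x (X x) *\<^sub>R V x + F x *\<^sub>R cov X V x"
  by (simp add: cov_eq FD_scaleR[OF open_S x F V] bilinear_rmul[OF bilinear_C[OF x]] scaleR_add_right)

lemma FD_h_phi:
  assumes x: "x \<in> S"
  shows "FD (\<lambda>y. h (\<phi> y) v w) x u = h (\<phi> x) (C x (FD \<phi> x u) v) w + h (\<phi> x) v (C x (FD \<phi> x u) w)"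
  using FD_compose[OF open_S h.open_T x phi_into h.smooth_h smooth_phi]
    h.christoffel_compat[OF phi_T[OF x]] by simp

lemma cov_compat:
  assumes x: "x \<in> S" and V: "smooth_on S V" and W: "smooth_on S W"
  shows "FD (\<lambda>y. h (\<phi> y) (V y) (W y)) x (X x) = h (\<phi> x) (cov X V x) (W x) + h (\<phi> x) (V x) (cov X W x)"
  by (simp add: FD_bilinear_field[OF open_S x bilinear_phi smooth_h_phi V W] FD_h_phi[OF x] cov_eq
      inner_form.form_simps[OF form_phi[OF x]])

lemma cov_torsion:
  assumes x: "x \<in> S" and X: "smooth_on S X" and Y: "smooth_on S Y"
  shows "cov X (push Y) x - cov Y (push X) x = FD \<phi> x (lie_bracket X Y x)"
  using FD_lie_bracket[OF open_S x smooth_phi X Y]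
    h.christoffel_sym[OF phi_T[OF x], of "FD \<phi> x (X x)" "FD \<phi> x (Y x)"]
  by (simp add: cov_eq pushforward_def[abs_def])

lemma cov_cov:
  assumes x: "x \<in> S" and X: "smooth_on S X" and Y: "smooth_on S Y" and V: "smooth_on S V"
  shows "cov X (cov Y V) x = FD (\<lambda>y. FD V y (Y y)) x (X x)
    + FD (\<lambda>z. christoffel h z (push Y x) (V x)) (\<phi> x) (push X x)
    + C x (FD (push Y) x (X x)) (V x) + C x (push Y x) (FD V x (X x))
    + C x (push X x) (FD V x (Y x)) + C x (push X x) (C x (push Y x) (V x))"
proof -
  note b = smooth_on_bilinear_field[OF open_S bilinear_C smooth_C smooth_push[OF Y] V]
  have "FD (cov Y V) x (X x) = FD (\<lambda>y. FD V y (Y y) + C y (push Y y) (V y)) x (X x)"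
    by (simp add: cov_eq[abs_def] pushforward_def)
  also have "\<dots> = FD (\<lambda>y. FD V y (Y y)) x (X x) + FD (\<lambda>y. C y (push Y y) (V y)) x (X x)"
    by (rule FD_add[OF open_S x smooth_on_FD[OF open_S V Y] b])
  also have "FD (\<lambda>y. C y (push Y y) (V y)) x (X x) = FD (\<lambda>y. C y (push Y x) (V x)) x (X x)
      + C x (FD (push Y) x (X x)) (V x) + C x (push Y x) (FD V x (X x))"
    by (rule FD_bilinear_field[OF open_S x bilinear_C smooth_C smooth_push[OF Y] V])
  also have "FD (\<lambda>y. C y (push Y x) (V x)) x (X x) =
      FD (\<lambda>z. christoffel h z (push Y x) (V x)) (\<phi> x) (push X x)"
    using FD_compose[OF open_S h.open_T x phi_into h.smooth_christoffel smooth_phi]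
    by (simp add: pushforward_def)
  finally show ?thesis
    by (simp add: cov_eq[of X] cov_eq[of Y V x] pushforward_def[abs_def] bilinear_radd[OF bilinear_C[OF x]])
qed

lemma cov_curvature:
  assumes x: "x \<in> S" and X: "smooth_on S X" and Y: "smooth_on S Y" and V: "smooth_on S V"
  shows "cov X (cov Y V) x - cov Y (cov X V) x - cov (lie_bracket X Y) V x
    = h.Rm (\<phi> x) (push X x) (push Y x) (V x)"
proof -
  have "FD (push Y) x (X x) - FD (push X) x (Y x) = FD \<phi> x (lie_bracket X Y x)"
    using FD_lie_bracket[OF open_S x smooth_phi X Y] by (simp add: pushforward_def[abs_def])
  then have "C x (FD \<phi> x (lie_bracket X Y x)) (V x)
      = C x (FD (push Y) x (X x)) (V x) - C x (FD (push X) x (Y x)) (V x)"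
    using bilinear_lsub[OF bilinear_C[OF x]] by metis
  then show ?thesis
    using FD_lie_bracket[OF open_S x V X Y]
    by (simp add: cov_cov[OF x X Y V] cov_cov[OF x Y X V] h.Rm_def cov_eq[of "lie_bracket X Y"])
qed

definition hess where
  "hess x v w = FD (\<lambda>y. FD \<phi> y w) x v + C x (FD \<phi> x v) (FD \<phi> x w)"

lemma cov_push:
  assumes x: "x \<in> S" and Y: "smooth_on S Y"
  shows "cov X (push Y) x = hess x (X x) (Y x) + FD \<phi> x (FD Y x (X x))"
  using FD_linear_field[OF open_S x linear_dphi smooth_on_frechet[OF smooth_phi] Y]
  by (simp add: cov_eq pushforward_def[abs_def] hess_def)

lemma cov_push_const:
  assumes x: "x \<in> S"
  shows "cov (\<lambda>_. v) (push (\<lambda>_. w)) x = hess x v w"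
  using cov_push[OF x smooth_on_const] linear_0[OF linear_dphi[OF x]] by simp

lemma hess_sym:
  assumes x: "x \<in> S"
  shows "hess x v w = hess x w v"
  using FD_FD_commute[OF open_S smooth_phi x] h.christoffel_sym[OF phi_T[OF x]]
  by (simp add: hess_def)

lemma bilinear_hess:
  assumes x: "x \<in> S"
  shows "bilinear (hess x)"
proof -
  have "linear (\<lambda>v. hess x v w)" for w
    using linear_FD[OF open_S smooth_on_frechet[OF smooth_phi] x] linear_dphi[OF x]
    by (auto intro!: linearI simp: hess_def linear_add linear_cmul scaleR_add_right
        bilinear_ladd[OF bilinear_C[OF x]] bilinear_lmul[OF bilinear_C[OF x]])
  then show ?thesis
    using hess_sym[OF x] by (simp add: bilinear_def)
qed

lemma hess_tangential:
  assumes x: "x \<in> S"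
  shows "h (\<phi> x) (hess x v w) (FD \<phi> x z) = g x (christoffel g x v w) z"
proof -
  interpret H: inner_form "h (\<phi> x)" by (rule form_phi[OF x])
  interpret G: inner_form "g x" by (rule g.form[OF x])
  define B where "B u v w = h (\<phi> x) (hess x u v) (FD \<phi> x w) - g x (christoffel g x u v) w" for u v w
  have s: "B u v w = B v u w" for u v w
    by (simp add: B_def hess_sym[OF x, of u v] g.christoffel_sym[OF x, of u v])
  have a: "B u v w = - B u w v" for u v w
  proof -
    have "FD (\<lambda>y. g y v w) x u = FD (\<lambda>y. h (\<phi> y) (push (\<lambda>_. v) y) (push (\<lambda>_. w) y)) x u"
      by (intro FD_cong[OF open_S x]) (simp add: pushforward_def isometric)
    also have "\<dots> = h (\<phi> x) (hess x u v) (FD \<phi> x w) + h (\<phi> x) (FD \<phi> x v) (hess x u w)"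
      using cov_compat[OF x smooth_push[OF smooth_on_const] smooth_push[OF smooth_on_const], of v w "\<lambda>_. u"]
      by (simp add: cov_push_const[OF x]) (simp add: pushforward_def)
    finally show ?thesis
      using g.christoffel_compat[OF x, of v w u]
      by (simp add: B_def H.sym[of _ "hess x u w"] G.sym[of v])
  qed
  have "B u v w = 0" for u v w using s a by (smt (verit))
  then show ?thesis by (simp add: B_def)
qed

lemma levi_civita_push:
  assumes x: "x \<in> S" and Y: "smooth_on S Y"
  shows "h (\<phi> x) (cov X (push Y) x) (FD \<phi> x z) = g x (levi_civita g X Y x) z"
  by (simp add: cov_push[OF x Y] levi_civita_def inner_form.form_simps[OF form_phi[OF x]]
      inner_form.form_simps[OF g.form[OF x]] hess_tangential[OF x] isometric[OF x])

definition II where "II x v w = hess x v w - FD \<phi> x (christoffel g x v w)"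

lemma nabla_d_const: "x \<in> S \<Longrightarrow> nabla_d g h \<phi> (\<lambda>_. v) (\<lambda>_. w) x = II x v w"
  by (simp add: nabla_d_def II_def cov_push_const) (simp add: pushforward_def levi_civita_def)

lemma II_normal:
  assumes x: "x \<in> S"
  shows "h (\<phi> x) (II x v w) (FD \<phi> x z) = 0"
  using hess_tangential[OF x] isometric[OF x]
  by (simp add: II_def inner_form.form_simps[OF form_phi[OF x]])

lemma bilinear_II: "x \<in> S \<Longrightarrow> bilinear (II x)"
  unfolding bilinear_def II_def
  by (auto intro!: linearI simp: bilinear_ladd[OF bilinear_hess] bilinear_radd[OF bilinear_hess]
      bilinear_lmul[OF bilinear_hess] bilinear_rmul[OF bilinear_hess]
      bilinear_ladd[OF g.bilinear_christoffel] bilinear_radd[OF g.bilinear_christoffel]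
      bilinear_lmul[OF g.bilinear_christoffel] bilinear_rmul[OF g.bilinear_christoffel]
      linear_add[OF linear_dphi] linear_cmul[OF linear_dphi] scaleR_diff_right)

lemma second_fundamental_form_const:
  assumes x: "x \<in> S"
  shows "second_fundamental_form h \<phi> (\<lambda>_. v) (\<lambda>_. w) x = II x v w"
  unfolding second_fundamental_form_def normal_part_def cov_push_const[OF x]
proof (rule the_equality)
  interpret H: inner_form "h (\<phi> x)" by (rule form_phi[OF x])
  show "hess x v w - II x v w \<in> range (FD \<phi> x) \<and> (\<forall>t\<in>range (FD \<phi> x). h (\<phi> x) (II x v w) t = 0)"
    using II_normal[OF x] by (auto simp: II_def)
  fix n assume n: "hess x v w - n \<in> range (FD \<phi> x) \<and> (\<forall>t\<in>range (FD \<phi> x). h (\<phi> x) n t = 0)"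
  then obtain z where "hess x v w - n = FD \<phi> x z" by blast
  then have "II x v w - n = FD \<phi> x (z - christoffel g x v w)"
    by (simp add: II_def linear_diff[OF linear_dphi[OF x]] algebra_simps)
  then have "h (\<phi> x) (II x v w - n) (II x v w - n) = 0"
    using II_normal[OF x] n by (metis H.diff_left diff_self rangeI)
  then show "n = II x v w" using H.pos[of "II x v w - n"] by force
qed

lemma mean_curvature_eq_tension:
  "x \<in> S \<Longrightarrow> mean_curvature_field g h \<phi> x = (1 / real DIM('e)) *\<^sub>R tension_field g h \<phi> x"
  by (simp add: mean_curvature_field_def tension_field_def second_fundamental_form_const nabla_d_const)

lemma minimal_iff_tension_zero:
  "x \<in> S \<Longrightarrow> mean_curvature_field g h \<phi> x = 0 \<longleftrightarrow> tension_field g h \<phi> x = 0"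
  by (simp add: mean_curvature_eq_tension)

lemma rough_laplacian_zero_section:
  assumes x: "x \<in> S" and V: "\<And>y. y \<in> S \<Longrightarrow> V y = 0"
  shows "rough_laplacian g h \<phi> e V x = 0"
proof -
  have c: "cov X V y = 0" if "y \<in> S" for X y
    using cov_cong[of y V "\<lambda>_. 0" X] that V bilinear_rzero[OF bilinear_C[OF that]]
    by (simp add: cov_eq)
  have "cov X (cov Y V) x = 0" for X Y
    using cov_cong[of x "cov Y V" "\<lambda>_. 0" X] x c bilinear_rzero[OF bilinear_C[OF x]]
    by (simp add: cov_eq)
  then show ?thesis by (simp add: rough_laplacian_def c[OF x])
qed

lemma restrict:
  assumes "open U" "U \<subseteq> S"
  shows "isometric_chart U g T h \<phi>"
proof
  show "riemannian_metric_on U g"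
    using g.metric assms smooth_on_subset[OF _ assms(2)] unfolding riemannian_metric_on_def by blast
qed (use assms smooth_on_subset[OF smooth_phi assms(2)] phi_into isometric h.open_T h.metric in auto)

end

locale adapted_frame = isometric_chart S g T h \<phi>
  for S :: "'e::euclidean_space set" and g and T :: "'f::euclidean_space set" and h \<phi> +
  fixes e :: "nat \<Rightarrow> 'e \<Rightarrow> 'e" and E :: "nat \<Rightarrow> 'e \<Rightarrow> 'f" and c :: real
    and m :: nat
  assumes dim: "m = DIM('e)"
    and codim: "DIM('f) = Suc m"
    and smooth_e: "i < m \<Longrightarrow> smooth_on S (e i)"
    and E_push: "i < m \<Longrightarrow> E i = push (e i)"
    and smooth_normal: "smooth_on S (E m)"
    and ortho: "x \<in> S \<Longrightarrow> orthonormal_family (Suc m) (h (\<phi> x)) (\<lambda>a. E a x)"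
    and const_curv: "y \<in> T \<Longrightarrow> h y (h.Rm y u v w) z = c * (h y v w * h y u z - h y u w * h y v z)"
begin

text \<open>The index \<open>m\<close> stands for the unit normal: \<open>W i j m\<close> are the components of the second
  fundamental form, while \<open>W i j k\<close> with \<open>j, k < m\<close> are the Levi-Civita connection forms.\<close>

definition D where "D i F x = FD F x (e i x)"

definition W where "W i a b x = h (\<phi> x) (cov (e i) (E a) x) (E b x)"

lemma E_apply: "i < m \<Longrightarrow> E i x = FD \<phi> x (e i x)"
  by (simp add: E_push pushforward_def)

lemma ortho_E: "x \<in> S \<Longrightarrow> a \<le> m \<Longrightarrow> b \<le> m \<Longrightarrow> h (\<phi> x) (E a x) (E b x) = (if a = b then 1 else 0)"
  using ortho unfolding orthonormal_family_def by (simp add: less_Suc_eq_le)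

lemma ortho_e: "x \<in> S \<Longrightarrow> orthonormal_family m (g x) (\<lambda>i. e i x)"
  unfolding orthonormal_family_def
proof (intro allI impI)
  fix i j assume x: "x \<in> S" and ij: "i < m" "j < m"
  then show "g x (e i x) (e j x) = (if i = j then 1 else 0)"
    using ortho_E[OF x, of i j] isometric[OF x, of "e i x" "e j x"] by (simp add: E_apply)
qed

lemma smooth_E: "a \<le> m \<Longrightarrow> smooth_on S (E a)"
  by (cases "a = m") (simp_all add: smooth_normal E_push smooth_push smooth_e)

lemma smooth_D: "i < m \<Longrightarrow> smooth_on S F \<Longrightarrow> smooth_on S (D i F)"
  unfolding D_def[abs_def] by (rule smooth_on_FD[OF open_S _ smooth_e])

lemma smooth_W:
  assumes "i < m" "a \<le> m" "b \<le> m"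
  shows "smooth_on S (W i a b)"
  unfolding W_def[abs_def]
  by (rule smooth_metric_fields[OF smooth_cov[OF smooth_e[OF assms(1)] smooth_E[OF assms(2)]] smooth_E[OF assms(3)]])

lemma ortho_DIM: "x \<in> S \<Longrightarrow> orthonormal_family DIM('f) (h (\<phi> x)) (\<lambda>a. E a x)"
  using ortho codim by simp

lemma D_metric:
  assumes "x \<in> S" "smooth_on S V" "smooth_on S V'"
  shows "D i (\<lambda>y. h (\<phi> y) (V y) (V' y)) x = h (\<phi> x) (cov (e i) V x) (V' x) + h (\<phi> x) (V x) (cov (e i) V' x)"
  unfolding D_def by (rule cov_compat[OF assms])

lemma parseval:
  assumes "x \<in> S"
  shows "h (\<phi> x) v w = (\<Sum>a\<le>m. h (\<phi> x) v (E a x) * h (\<phi> x) w (E a x))"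
  unfolding lessThan_Suc_atMost[symmetric] codim[symmetric]
  by (rule inner_form.orthonormal_Parseval[OF form_phi[OF assms] ortho_DIM[OF assms]])

lemma W_skew:
  assumes "x \<in> S" "i < m" "a \<le> m" "b \<le> m"
  shows "W i a b x = - W i b a x"
proof -
  have "D i (\<lambda>y. h (\<phi> y) (E a y) (E b y)) x = D i (\<lambda>y. if a = b then 1 else 0) x"
    unfolding D_def by (intro FD_cong[OF open_S assms(1)] ortho_E assms)
  then show ?thesis
    using D_metric[OF assms(1) smooth_E[OF assms(3)] smooth_E[OF assms(4)], of i]
      inner_form.sym[OF form_phi[OF assms(1)], of "E a x"]
    by (simp add: W_def D_def)
qed

lemma bracket:
  assumes x: "x \<in> S" and i: "i < m" and j: "j < m"
  shows "lie_bracket (e i) (e j) x = (\<Sum>k<m. (W i j k x - W j i k x) *\<^sub>R e k x)"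
    and W_normal_sym: "W i j m x = W j i m x"
proof -
  interpret H: inner_form "h (\<phi> x)" by (rule form_phi[OF x])
  have t: "FD \<phi> x (lie_bracket (e i) (e j) x) = cov (e i) (E j) x - cov (e j) (E i) x"
    using cov_torsion[OF x smooth_e[OF i] smooth_e[OF j]] by (simp add: E_push i j)
  have "g x (lie_bracket (e i) (e j) x) (e k x) = W i j k x - W j i k x" if "k < m" for k
    using isometric[OF x, of "lie_bracket (e i) (e j) x" "e k x"] t
    by (simp add: W_def E_apply[OF that] H.diff_left)
  then show "lie_bracket (e i) (e j) x = (\<Sum>k<m. (W i j k x - W j i k x) *\<^sub>R e k x)"
    using inner_form.orthonormal_expand[OF g.form[OF x] ortho_e[OF x, unfolded dim], of "lie_bracket (e i) (e j) x"]
    by (simp add: dim)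
  then have "FD \<phi> x (lie_bracket (e i) (e j) x) = (\<Sum>k<m. (W i j k x - W j i k x) *\<^sub>R E k x)"
    by (simp add: linear_sum[OF linear_dphi[OF x]] linear_cmul[OF linear_dphi[OF x]] E_apply)
  then have "h (\<phi> x) (FD \<phi> x (lie_bracket (e i) (e j) x)) (E m x) = 0"
    using x by (simp add: H.form_simps ortho_E)
  then show "W i j m x = W j i m x" by (simp add: t W_def H.diff_left)
qed

lemma D_commute:
  fixes F :: "'e \<Rightarrow> real"
  assumes x: "x \<in> S" and i: "i < m" and j: "j < m" and F: "smooth_on S F"
  shows "D i (D j F) x - D j (D i F) x = (\<Sum>k<m. (W i j k x - W j i k x) * D k F x)"
  using FD_lie_bracket[OF open_S x F smooth_e[OF i] smooth_e[OF j]] linear_FD[OF open_S F x]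
  by (simp add: D_def[abs_def] bracket(1)[OF x i j] linear_sum linear_cmul)

lemma D_W:
  assumes x: "x \<in> S" and i: "i < m" and j: "j < m" and a: "a \<le> m" and b: "b \<le> m"
  shows "D i (W j a b) x = h (\<phi> x) (cov (e i) (cov (e j) (E a)) x) (E b x)
    + (\<Sum>d\<le>m. W j a d x * W i b d x)"
  using D_metric[OF x smooth_cov[OF smooth_e[OF j] smooth_E[OF a]] smooth_E[OF b], of i]
    parseval[OF x, of "cov (e j) (E a) x" "cov (e i) (E b) x"]
  by (simp add: W_def[abs_def])

lemma structure_equation:
  assumes x: "x \<in> S" and i: "i < m" and j: "j < m" and a: "a \<le> m" and b: "b \<le> m"
  shows "D i (W j a b) x - D j (W i a b) x =
    (\<Sum>d\<le>m. W j a d x * W i b d x) - (\<Sum>d\<le>m. W i a d x * W j b d x)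
    + (\<Sum>k<m. (W i j k x - W j i k x) * W k a b x)
    + c * ((if j = a then 1 else 0) * (if i = b then 1 else 0) - (if i = a then 1 else 0) * (if j = b then 1 else 0))"
proof -
  interpret H: inner_form "h (\<phi> x)" by (rule form_phi[OF x])
  have l: "cov (lie_bracket (e i) (e j)) (E a) x = (\<Sum>k<m. (W i j k x - W j i k x) *\<^sub>R cov (e k) (E a) x)"
    by (rule cov_linear_dir[where X = e and Y = "lie_bracket (e i) (e j)", OF x smooth_E[OF a] bracket(1)[OF x i j]])
  have "h (\<phi> x) (cov (e i) (cov (e j) (E a)) x - cov (e j) (cov (e i) (E a)) x
      - cov (lie_bracket (e i) (e j)) (E a) x) (E b x)
    = c * (h (\<phi> x) (E j x) (E a x) * h (\<phi> x) (E i x) (E b x) - h (\<phi> x) (E i x) (E a x) * h (\<phi> x) (E j x) (E b x))"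
    unfolding cov_curvature[OF x smooth_e[OF i] smooth_e[OF j] smooth_E[OF a]] E_push[OF i] E_push[OF j]
    by (rule const_curv[OF phi_T[OF x]])
  then show ?thesis
    unfolding D_W[OF assms] D_W[OF x j i a b] l
    using x i j a b by (simp add: ortho_E H.form_simps W_def)
qed

definition mean where "mean x = (\<Sum>i<m. W i i m x)"

lemma smooth_mean: "smooth_on S mean"
  unfolding mean_def[abs_def] by (rule smooth_on_sum[OF open_S]) (simp add: smooth_W)

lemma push_normal:
  assumes x: "x \<in> S"
  shows "h (\<phi> x) (FD \<phi> x z) (E m x) = 0"
proof -
  have "FD \<phi> x z = FD \<phi> x (\<Sum>i<m. g x z (e i x) *\<^sub>R e i x)"
    using inner_form.orthonormal_expand[OF g.form[OF x] ortho_e[OF x, unfolded dim], of z] by (simp add: dim)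
  then have "FD \<phi> x z = (\<Sum>i<m. g x z (e i x) *\<^sub>R E i x)"
    by (simp add: linear_sum[OF linear_dphi[OF x]] linear_cmul[OF linear_dphi[OF x]] E_apply)
  then show ?thesis using x by (simp add: inner_form.form_simps[OF form_phi[OF x]] ortho_E)
qed

lemma W_normal_hess:
  assumes x: "x \<in> S" and j: "j < m"
  shows "W i j m x = h (\<phi> x) (hess x (e i x) (e j x)) (E m x)"
  using push_normal[OF x]
  by (simp add: W_def E_push[OF j] cov_push[OF x smooth_e[OF j]] inner_form.add_left[OF form_phi[OF x]])

lemma tension_eq:
  assumes x: "x \<in> S"
  shows "tension_field g h \<phi> x = mean x *\<^sub>R E m x"
proof -
  interpret H: inner_form "h (\<phi> x)" by (rule form_phi[OF x])
  note n = push_normal[OF x]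
  have "II x (e i x) (e i x) = W i i m x *\<^sub>R E m x" if i: "i < m" for i
  proof (rule H.orthonormal_eqI[OF ortho_DIM[OF x]])
    fix a assume "a < DIM('f)"
    then consider "a < m" | "a = m" using codim by linarith
    then show "h (\<phi> x) (II x (e i x) (e i x)) (E a x) = h (\<phi> x) (W i i m x *\<^sub>R E m x) (E a x)"
    proof cases
      case 1
      then show ?thesis using x by (simp add: E_apply II_normal H.scale_left H.sym[of "E m x"] n)
    next
      case 2
      then show ?thesis
        using x by (simp add: W_normal_hess[OF x i] II_def H.form_simps n ortho_E)
    qed
  qed
  then have "(\<Sum>i<m. II x (e i x) (e i x)) = mean x *\<^sub>R E m x"
    by (simp add: mean_def scaleR_sum_left)
  then show ?thesis
    using metric_trace_orthonormal[where g = g and x = x, OF g.form[OF x] bilinear_II[OF x] ortho_e[OF x, unfolded dim]]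
    by (simp add: dim tension_field_def nabla_d_const[OF x])
qed

lemma levi_civita_frame:
  assumes x: "x \<in> S" and i: "i < m" and j: "j < m"
  shows "levi_civita g (e i) (e j) x = (\<Sum>k<m. W i j k x *\<^sub>R e k x)"
proof -
  have "g x (levi_civita g (e i) (e j) x) (e k x) = W i j k x" if "k < m" for k
    using levi_civita_push[OF x smooth_e[OF j], of "e i" "e k x"]
    by (simp add: W_def E_push[OF j] E_apply[OF that])
  then show ?thesis
    using inner_form.orthonormal_expand[OF g.form[OF x] ortho_e[OF x, unfolded dim], of "levi_civita g (e i) (e j) x"]
    by (simp add: dim)
qed

definition lap where
  "lap x = (\<Sum>i<m. cov (e i) (cov (e i) (tension_field g h \<phi>)) x
     - cov (levi_civita g (e i) (e i)) (tension_field g h \<phi>) x)"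

lemma lap_component:
  assumes x: "x \<in> S" and b: "b \<le> m"
  shows "h (\<phi> x) (lap x) (E b x) = (\<Sum>i<m.
     D i (\<lambda>y. (if b = m then D i mean y else 0) + mean y * W i m b y) x
     - (\<Sum>d\<le>m. ((if d = m then D i mean x else 0) + mean x * W i m d x) * W i b d x)
     - (\<Sum>k<m. W i i k x * ((if b = m then D k mean x else 0) + mean x * W k m b x)))"
proof -
  interpret H: inner_form "h (\<phi> x)" by (rule form_phi[OF x])
  define \<tau> where "\<tau> y = mean y *\<^sub>R E m y" for y
  have s\<tau>: "smooth_on S \<tau>"
    unfolding \<tau>_def[abs_def] by (rule smooth_on_scaleR[OF open_S smooth_mean smooth_normal])
  have ct: "cov X (tension_field g h \<phi>) y = cov X \<tau> y" if "y \<in> S" for X y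
    by (rule cov_cong[OF that]) (simp add: tension_eq \<tau>_def)
  have cct: "cov X (cov Y (tension_field g h \<phi>)) x = cov X (cov Y \<tau>) x" for X Y
    by (rule cov_cong[OF x]) (rule ct)
  have comp: "h (\<phi> y) (cov (e i) \<tau> y) (E d y) = (if d = m then D i mean y else 0) + mean y * W i m d y"
    if y: "y \<in> S" and i: "i < m" and d: "d \<le> m" for i d y
    unfolding \<tau>_def[abs_def] cov_scale[OF y smooth_mean smooth_normal]
    using y d by (simp add: inner_form.form_simps[OF form_phi[OF y]] ortho_E D_def W_def)
  have 1: "h (\<phi> x) (cov (e i) (cov (e i) \<tau>) x) (E b x) =
      D i (\<lambda>y. (if b = m then D i mean y else 0) + mean y * W i m b y) x
     - (\<Sum>d\<le>m. ((if d = m then D i mean x else 0) + mean x * W i m d x) * W i b d x)" if i: "i < m" for i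
  proof -
    have "D i (\<lambda>y. h (\<phi> y) (cov (e i) \<tau> y) (E b y)) x =
        D i (\<lambda>y. (if b = m then D i mean y else 0) + mean y * W i m b y) x"
      unfolding D_def[of i _ x] by (rule FD_cong[OF open_S x]) (rule comp[OF _ i b])
    moreover have "h (\<phi> x) (cov (e i) \<tau> x) (cov (e i) (E b) x) =
        (\<Sum>d\<le>m. ((if d = m then D i mean x else 0) + mean x * W i m d x) * W i b d x)"
      by (subst parseval[OF x], intro sum.cong refl) (simp add: comp[OF x i] W_def)
    ultimately show ?thesis
      using D_metric[OF x smooth_cov[OF smooth_e[OF i] s\<tau>] smooth_E[OF b], of i] by simp
  qed
  have 2: "h (\<phi> x) (cov (levi_civita g (e i) (e i)) \<tau> x) (E b x) =
      (\<Sum>k<m. W i i k x * ((if b = m then D k mean x else 0) + mean x * W k m b x))" if i: "i < m" for i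
    unfolding cov_linear_dir[where Y = "levi_civita g (e i) (e i)" and X = e, OF x s\<tau> levi_civita_frame[OF x i i]]
      H.sum_left H.scale_left
    by (intro sum.cong refl) (simp add: comp[OF x _ b])
  show ?thesis
    unfolding lap_def cct ct[OF x] H.sum_left H.diff_left
    by (intro sum.cong refl) (simp only: 1 2 lessThan_iff)
qed

lemma lap_eq_zero:
  assumes x: "x \<in> S"
    and HT: "\<And>e'. orthonormal_frame_on S g e' \<Longrightarrow> rough_laplacian g h \<phi> e' (tension_field g h \<phi>) x = 0"
  shows "lap x = 0"
proof -
  obtain \<beta> where \<beta>: "bij_betw \<beta> {..<m} (Basis :: 'e set)"
    using ex_bij_betw_nat_finite[of "Basis :: 'e set"] by (auto simp: dim atLeast0LessThan)
  define \<iota> where "\<iota> = the_inv_into {..<m} \<beta>"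
  have \<iota>: "\<iota> (\<beta> i) = i" if "i < m" for i
    using that \<beta> by (simp add: \<iota>_def the_inv_into_f_f bij_betw_def)
  have ib: "\<iota> b < m" "\<beta> (\<iota> b) = b" if b: "b \<in> Basis" for b
  proof -
    have "b \<in> \<beta> ` {..<m}" using b bij_betw_imp_surj_on[OF \<beta>] by simp
    then obtain i where "i < m" "b = \<beta> i" by auto
    then show "\<iota> b < m" "\<beta> (\<iota> b) = b" using \<iota> by auto
  qed
  have "orthonormal_frame_on S g (\<lambda>b. e (\<iota> b))"
    unfolding orthonormal_frame_on_def orthonormal_basis_at_def
  proof (intro conjI ballI)
    show "smooth_on S (e (\<iota> b))" if "b \<in> Basis" for b using smooth_e ib[OF that] by blast
    fix y and b b' :: 'e assume y: "y \<in> S" and b: "b \<in> Basis" "b' \<in> Basis"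
    then have "g y (e (\<iota> b) y) (e (\<iota> b') y) = (if \<iota> b = \<iota> b' then 1 else 0)"
      using ortho_e[OF y] ib(1) unfolding orthonormal_family_def by blast
    then show "g y (e (\<iota> b) y) (e (\<iota> b') y) = (if b = b' then 1 else 0)"
      using ib(2)[OF b(1)] ib(2)[OF b(2)] by metis
  qed
  note HT[OF this]
  moreover have "rough_laplacian g h \<phi> (\<lambda>b. e (\<iota> b)) (tension_field g h \<phi>) x = - lap x"
    unfolding rough_laplacian_def lap_def sum.reindex_bij_betw[OF \<beta>, symmetric]
    by (intro arg_cong[where f = uminus] sum.cong refl) (simp add: \<iota>)
  ultimately show ?thesis by simp
qed

lemma change_frame:
  assumes U: "open U" "U \<subseteq> S" and e': "\<And>i. i < m \<Longrightarrow> smooth_on U (e' i)"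
    and on: "\<And>x. x \<in> U \<Longrightarrow> orthonormal_family m (g x) (\<lambda>i. e' i x)"
  shows "adapted_frame U g T h \<phi> e' (\<lambda>a. if a < m then push (e' a) else E m) c m"
proof (intro adapted_frame.intro adapted_frame_axioms.intro restrict U)
  show "m = DIM('e)" "DIM('f) = Suc m" by (fact dim codim)+
  show "smooth_on U (e' i)" if "i < m" for i by (rule e'[OF that])
  show "smooth_on U (if m < m then push (e' m) else E m)"
    using smooth_on_subset[OF smooth_normal U(2)] by simp
  show "orthonormal_family (Suc m) (h (\<phi> x)) (\<lambda>a. (if a < m then push (e' a) else E m) x)" if x: "x \<in> U" for x
  proof -
    have xS: "x \<in> S" using x U by blast
    have 1: "h (\<phi> x) (push (e' a) x) (push (e' b) x) = (if a = b then 1 else 0)" if "a < m" "b < m" for a b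
      using on[OF x] that unfolding orthonormal_family_def pushforward_def isometric[OF xS] by blast
    have 2: "h (\<phi> x) (push (e' a) x) (E m x) = 0" for a
      unfolding pushforward_def by (rule push_normal[OF xS])
    have 3: "h (\<phi> x) (E m x) (push (e' a) x) = 0" for a
      using 2 inner_form.sym[OF form_phi[OF xS]] by metis
    have 4: "h (\<phi> x) (E m x) (E m x) = 1" using ortho_E[OF xS, of m m] by simp
    show ?thesis
      unfolding orthonormal_family_def
    proof (intro allI impI)
      fix a b assume "a < Suc m" "b < Suc m"
      then consider "a < m" "b < m" | "a < m" "b = m" | "a = m" "b < m" | "a = m" "b = m" by linarith
      then show "h (\<phi> x) ((if a < m then push (e' a) else E m) x) ((if b < m then push (e' b) else E m) x)
          = (if a = b then 1 else 0)"
        by cases (simp_all add: 1 2 3 4)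
    qed
  qed
qed (auto intro: const_curv)

lemma gradient:
  fixes F :: "'e \<Rightarrow> real"
  assumes x: "x \<in> S" and F: "smooth_on S F"
  shows "FD F x v = (\<Sum>k<m. D k F x * g x v (e k x))"
proof -
  note l = linear_FD[OF open_S F x]
  have "FD F x v = FD F x (\<Sum>k<m. g x v (e k x) *\<^sub>R e k x)"
    using inner_form.orthonormal_expand[OF g.form[OF x] ortho_e[OF x, unfolded dim], of v] by (simp add: dim)
  then show ?thesis by (simp add: linear_sum[OF l] linear_cmul[OF l] D_def mult.commute)
qed

end

lemma (in isometric_chart) adapted_frame_exists:
  assumes x0: "x0 \<in> S" and codim: "DIM('f) = Suc DIM('e)"
    and const_curv: "\<And>y u v w z. y \<in> T \<Longrightarrow> h y (h.Rm y u v w) z = c * (h y v w * h y u z - h y u w * h y v z)"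
  shows "\<exists>U e E. open U \<and> x0 \<in> U \<and> U \<subseteq> S \<and> adapted_frame U g T h \<phi> e E c DIM('e)"
proof -
  have "\<exists>U e. open U \<and> x0 \<in> U \<and> U \<subseteq> S \<and> (\<forall>i<0. e i = (\<lambda>_. 0)) \<and> (\<forall>i<DIM('e). smooth_on U (e i)) \<and>
      (\<forall>x\<in>U. orthonormal_family DIM('e) (g x) (\<lambda>i. e i x))"
    by (rule orthonormal_frame_extend[OF open_S x0 g.form g.smooth_h, of 0 "\<lambda>_ _. 0"])
      (auto simp: orthonormal_family_def)
  then obtain U e where U: "open U" "x0 \<in> U" "U \<subseteq> S" and e: "\<And>i. i < DIM('e) \<Longrightarrow> smooth_on U (e i)"
    and on: "\<And>x. x \<in> U \<Longrightarrow> orthonormal_family DIM('e) (g x) (\<lambda>i. e i x)" by blast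
  interpret U: isometric_chart U g T h \<phi> by (rule restrict[OF U(1,3)])
  have "\<exists>V E. open V \<and> x0 \<in> V \<and> V \<subseteq> U \<and> (\<forall>i<DIM('e). E i = push (e i)) \<and>
      (\<forall>i<Suc DIM('e). smooth_on V (E i)) \<and>
      (\<forall>x\<in>V. orthonormal_family (Suc DIM('e)) (h (\<phi> x)) (\<lambda>i. E i x))"
  proof (rule orthonormal_frame_extend[OF U(1,2) U.form_phi U.smooth_h_phi])
    show "orthonormal_family DIM('e) (h (\<phi> x)) (\<lambda>i. push (e i) x)" if "x \<in> U" for x
      using on[OF that] that by (simp add: orthonormal_family_def pushforward_def U.isometric)
  qed (use e codim in \<open>auto intro: U.smooth_push\<close>)
  then obtain V E where V: "open V" "x0 \<in> V" "V \<subseteq> U" and E: "\<And>i. i < DIM('e) \<Longrightarrow> E i = push (e i)"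
    and sE: "\<And>i. i < Suc DIM('e) \<Longrightarrow> smooth_on V (E i)"
    and onE: "\<And>x. x \<in> V \<Longrightarrow> orthonormal_family (Suc DIM('e)) (h (\<phi> x)) (\<lambda>i. E i x)" by blast
  have "adapted_frame V g T h \<phi> e E c DIM('e)"
  proof (intro adapted_frame.intro adapted_frame_axioms.intro U.restrict V)
    show "smooth_on V (e i)" if "i < DIM('e)" for i
      using smooth_on_subset[OF e[OF that] V(3)] .
  qed (use codim E sE onE const_curv in auto)
  then show ?thesis using V U by blast
qed

section \<open>The differential equations along the gradient of the mean curvature\<close>

lemma binary_quadratics_resultant:
  fixes l c :: real
  assumes "A2 * l^2 + A1 * (l * c) + A0 * c^2 = 0" "B2 * l^2 + B1 * (l * c) + B0 * c^2 = 0" "l \<noteq> 0"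
  shows "(A2 * B0 - A0 * B2)^2 - (A2 * B1 - A1 * B2) * (A1 * B0 - A0 * B1) = 0"
proof (cases "c = 0")
  case True
  then show ?thesis using assms by simp
next
  case False
  let ?P = "A2 * B1 - A1 * B2" and ?Q = "A2 * B0 - A0 * B2" and ?R = "A1 * B0 - A0 * B1"
  have "c * (?P * l + ?Q * c) = 0" "l * (?Q * l + ?R * c) = 0"
    using assms(1,2) by algebra+
  then have "?P * l + ?Q * c = 0" "?Q * l + ?R * c = 0" using False assms(3) by auto
  then have "l * (?Q^2 - ?P * ?R) = 0" by algebra
  then show ?thesis using assms(3) by simp
qed

text \<open>Coefficients, as polynomials in \<open>k\<close>, of the two quadratic forms in \<open>l\<close> and \<open>c\<close> that remain after
  the linear relation \<open>F2\<close> below has been used to eliminate \<open>Z\<close> from \<open>G\<close> and \<open>F3\<close>.\<close>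

definition eA2 :: "real poly" where "eA2 = [:0, -276588, -1227636, -1991412, -1405748, -365400:]"
definition eA1 :: "real poly" where "eA1 = [:0, 19656, 122922, 245526, 201308, 59040:]"
definition eA0 :: "real poly" where "eA0 = [:0, 0, -1240, -4796, -5805, -2250:]"
definition eB2 :: "real poly" where "eB2 = [:0, 546084, 2016492, 2759068, 1654044, 365400:]"
definition eB1 :: "real poly" where "eB1 = [:0, -38808, -174546, -291814, -215124, -59040:]"
definition eB0 :: "real poly" where "eB0 = [:0, 0, 2436, 7162, 6975, 2250:]"

definition elim_poly :: "real poly" where
  "elim_poly = (eA2 * eB0 - eA0 * eB2)^2 - (eA2 * eB1 - eA1 * eB2) * (eA1 * eB0 - eA0 * eB1)"

lemma elim_poly_nonzero: "elim_poly \<noteq> 0"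
proof
  assume "elim_poly = 0"
  then have "poly elim_poly 1 = 0" by simp
  then show False
    by (simp add: elim_poly_def eA2_def eA1_def eA0_def eB2_def eB1_def eB0_def)
qed

lemma elimination:
  fixes l Z k c :: real
  assumes F2: "1218*l*k + 1182*l - 52*Z*k^2 - 52*Z*k - 75*k*c - 84*c = 0"
    and G: "-126*l^2 - 1026*l*Z*k^2 - 2778*l*Z*k - 1458*l*Z + 1251*l*c - 36*Z^2*k^3 - 32*Z^2*k^2 + 135*Z*k^2*c + 96*Z*k*c + 90*c^2 = 0"
    and F3: "-58464*l^2*k - 18270*l^2 + 4872*l*Z*k^2 + 27078*l*Z*k + 22056*l*Z - 14670*l*k*c - 24453*l*c + 936*Z^2*k^3 + 1560*Z^2*k^2 + 676*Z^2*k - 300*Z*k^2*c + 1029*Z*k*c + 1092*Z*c + 1125*k*c^2 + 1575*c^2 = 0"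
  shows "poly eA2 k * l^2 + poly eA1 k * (l * c) + poly eA0 k * c^2 = 0"
    and "poly eB2 k * l^2 + poly eB1 k * (l * c) + poly eB0 k * c^2 = 0"
proof -
  define a b where "a = -1218*l*k - 1182*l + 75*k*c + 84*c" and "b = -52*k^2 - 52*k"
  have ab: "b * Z = a" using F2 by (simp add: a_def b_def algebra_simps)
  have *: "g2 * a^2 + g1 * a * b + g0 * b^2 = 0" if "g2 * Z^2 + g1 * Z + g0 = 0" for g2 g1 g0
  proof -
    have "g2 * a^2 + g1 * a * b + g0 * b^2 = b^2 * (g2 * Z^2 + g1 * Z + g0)"
      unfolding ab[symmetric] by (simp add: algebra_simps power2_eq_square)
    then show ?thesis using that by simp
  qed
  have "(-36*k^3 - 32*k^2) * Z^2 + (-1026*l*k^2 - 2778*l*k - 1458*l + 135*k^2*c + 96*k*c) * Z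
      + (-126*l^2 + 1251*l*c + 90*c^2) = 0"
    using G by (simp add: algebra_simps)
  from *[OF this] show "poly eA2 k * l^2 + poly eA1 k * (l * c) + poly eA0 k * c^2 = 0"
    by (simp add: a_def b_def eA2_def eA1_def eA0_def algebra_simps power2_eq_square power3_eq_cube)
  have "(936*k^3 + 1560*k^2 + 676*k) * Z^2 + (4872*l*k^2 + 27078*l*k + 22056*l - 300*k^2*c + 1029*k*c + 1092*c) * Z
      + (-58464*l^2*k - 18270*l^2 - 14670*l*k*c - 24453*l*c + 1125*k*c^2 + 1575*c^2) = 0"
    using F3 by (simp add: algebra_simps)
  from *[OF this] show "poly eB2 k * l^2 + poly eB1 k * (l * c) + poly eB0 k * c^2 = 0"
    by (simp add: a_def b_def eB2_def eB1_def eB0_def algebra_simps power2_eq_square power3_eq_cube)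
qed

lemma smooth_on_line_derivative:
  fixes F :: "'a::euclidean_space \<Rightarrow> real"
  assumes "open S" "smooth_on S F" "x \<in> S"
  shows "((\<lambda>t. F (x + t *\<^sub>R v)) has_real_derivative FD F x v) (at 0)"
  using line_has_real_derivative[OF assms(1,2), of x 0 v] assms(3) by simp

lemma locally_constant_of_roots:
  fixes F :: "'a::euclidean_space \<Rightarrow> real"
  assumes "open S" "x \<in> S" "continuous_on S F" "P \<noteq> 0" "\<And>y. y \<in> S \<Longrightarrow> poly P (F y) = 0"
  shows "\<exists>U. open U \<and> x \<in> U \<and> U \<subseteq> S \<and> (\<forall>y\<in>U. F y = F x)"
proof -
  obtain r where r: "r > 0" "ball x r \<subseteq> S" using assms(1,2) open_contains_ball by blast
  have "connected (F ` ball x r)"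
    using r assms(3) by (intro connected_continuous_image) (auto intro: continuous_on_subset)
  moreover have "finite (F ` ball x r)"
    by (rule finite_subset[OF _ poly_roots_finite[OF assms(4)]]) (use r assms(5) in auto)
  ultimately have sing: "F ` ball x r = {} \<or> (\<exists>a. F ` ball x r = {a})"
    using connected_finite_iff_sing by blast
  have const: "F y = F x" if y: "y \<in> ball x r" for y
  proof -
    have im: "F y \<in> F ` ball x r" "F x \<in> F ` ball x r" using y r(1) by auto
    from sing show ?thesis
    proof
      assume "F ` ball x r = {}"
      with im(1) show ?thesis by (simp only: empty_iff)
    next
      assume "\<exists>a. F ` ball x r = {a}"
      then obtain a where a: "F ` ball x r = {a}" ..
      from im show ?thesis unfolding a by (simp only: singleton_iff)
    qed
  qed
  show ?thesis
  proof (intro exI conjI ballI)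
    show "x \<in> ball x r" using r(1) by (simp only: centre_in_ball)
  qed (fact open_ball r(2) const)+
qed

text \<open>The homogeneity of the system suggests the variables \<open>l = L\<^sup>2\<close>, \<open>Z = (w / L)\<^sup>2\<close> and
  \<open>k = (p + q) L / w\<close>, in which the relations have low degree.\<close>

lemma distinct_curvatures_ode:
  fixes L M K p q w :: "'a::euclidean_space \<Rightarrow> real" and v :: "'a \<Rightarrow> 'a" and c :: real
  assumes S: "open S"
    and smooth: "smooth_on S L" "smooth_on S M" "smooth_on S K" "smooth_on S p" "smooth_on S q" "smooth_on S w"
    and dL: "\<And>x. x \<in> S \<Longrightarrow> FD L x (v x) = w x"
    and dM: "\<And>x. x \<in> S \<Longrightarrow> FD M x (v x) = (L x - M x) * p x"
    and dK: "\<And>x. x \<in> S \<Longrightarrow> FD K x (v x) = (L x - K x) * q x"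
    and dp: "\<And>x. x \<in> S \<Longrightarrow> FD p x (v x) = - ((p x)^2) - c - L x * M x"
    and dq: "\<And>x. x \<in> S \<Longrightarrow> FD q x (v x) = - ((q x)^2) - c - L x * K x"
    and dw: "\<And>x. x \<in> S \<Longrightarrow> FD w x (v x) = L x * ((L x)^2 + (M x)^2 + (K x)^2) - (p x + q x) * w x"
    and tr: "\<And>x. x \<in> S \<Longrightarrow> M x + K x = - 3 * L x"
    and pq: "\<And>x. x \<in> S \<Longrightarrow> p x * q x = - (c + M x * K x)"
    and L0: "\<And>x. x \<in> S \<Longrightarrow> L x \<noteq> 0" and w0: "\<And>x. x \<in> S \<Longrightarrow> w x \<noteq> 0"
  shows "S = {}"
proof (rule ccontr)
  assume "S \<noteq> {}"
  then obtain x0 where x0: "x0 \<in> S" by blast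
  note line = smooth_on_line_derivative[OF S]
  have w_eq: "3 * w x + (L x - M x) * p x + (L x - K x) * q x = 0" if x: "x \<in> S" for x
  proof -
    have "((\<lambda>t. M (x + t *\<^sub>R v x) + K (x + t *\<^sub>R v x) + 3 * L (x + t *\<^sub>R v x)) has_real_derivative
        (L x - M x) * p x + (L x - K x) * q x + 3 * w x) (at 0)"
      by (rule derivative_eq_intros refl line[OF smooth(1) x] line[OF smooth(2) x] line[OF smooth(3) x])+
        (simp add: dL dM dK x)
    from line_derivative_unique[OF S x _ this] show ?thesis using tr by simp
  qed
  have E1: "9 * (M x - K x)^2 * L x + 3 * (L x)^3 + 8 * (p x + q x) * w x - 30 * c * L x = 0" if x: "x \<in> S" for x
  proof -
    have "((\<lambda>t. 3 * w (x + t *\<^sub>R v x) + (L (x + t *\<^sub>R v x) - M (x + t *\<^sub>R v x)) * p (x + t *\<^sub>R v x)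
        + (L (x + t *\<^sub>R v x) - K (x + t *\<^sub>R v x)) * q (x + t *\<^sub>R v x)) has_real_derivative
        3 * (L x * ((L x)^2 + (M x)^2 + (K x)^2) - (p x + q x) * w x)
        + ((w x - (L x - M x) * p x) * p x + (- ((p x)^2) - c - L x * M x) * (L x - M x))
        + ((w x - (L x - K x) * q x) * q x + (- ((q x)^2) - c - L x * K x) * (L x - K x))) (at 0)"
      by (rule derivative_eq_intros refl line[OF smooth(1) x] line[OF smooth(2) x] line[OF smooth(3) x]
          line[OF smooth(4) x] line[OF smooth(5) x] line[OF smooth(6) x])+
        (simp add: dL dM dK dp dq dw x)
    from line_derivative_unique[OF S x _ this] w_eq
    have "3 * (L x * ((L x)^2 + (M x)^2 + (K x)^2) - (p x + q x) * w x)
        + ((w x - (L x - M x) * p x) * p x + (- ((p x)^2) - c - L x * M x) * (L x - M x))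
        + ((w x - (L x - K x) * q x) * q x + (- ((q x)^2) - c - L x * K x) * (L x - K x)) = 0"
      by blast
    then show ?thesis
      using tr[OF x] pq[OF x] w_eq[OF x] by algebra
  qed
  define z where "z x = w x / L x" for x
  define k where "k x = (p x + q x) / z x" for x
  have z0: "z x \<noteq> 0" and wz: "w x = L x * z x" and sk: "p x + q x = k x * z x" if "x \<in> S" for x
    using L0[OF that] w0[OF that] by (auto simp: z_def k_def)
  have sz: "smooth_on S z"
    unfolding z_def[abs_def] by (intro smooth_on_divide S smooth L0)
  have sk': "smooth_on S k"
    unfolding k_def[abs_def] by (intro smooth_on_divide smooth_on_add S smooth sz z0)
  have D: "9 * (M x - K x)^2 = 30*c - 3 * (L x)^2 - 8 * k x * (z x)^2" if x: "x \<in> S" for x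
  proof -
    have "L x * (9 * (M x - K x)^2 - (30*c - 3 * (L x)^2 - 8 * k x * (z x)^2)) = 0"
      using E1[OF x] wz[OF x] sk[OF x] by algebra
    then show ?thesis using L0[OF x] by simp
  qed
  have sq: "2 * ((M x)^2 + (K x)^2) = 9 * (L x)^2 + (M x - K x)^2" if x: "x \<in> S" for x
    using tr[OF x] by algebra
  have dz: "9 * FD z x (v x) = 48 * (L x)^2 - 13 * k x * (z x)^2 - 9 * (z x)^2 + 15 * c" if x: "x \<in> S" for x
  proof -
    have "((\<lambda>t. w (x + t *\<^sub>R v x) - L (x + t *\<^sub>R v x) * z (x + t *\<^sub>R v x)) has_real_derivative
       FD w x (v x) - (w x * z x + FD z x (v x) * L x)) (at 0)"
      by (rule derivative_eq_intros refl line[OF smooth(1) x] line[OF smooth(6) x] line[OF sz x])+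
        (simp add: dL x)
    from line_derivative_unique[OF S x _ this] wz
    have "FD w x (v x) = w x * z x + FD z x (v x) * L x" by simp
    then have "L x * (9 * FD z x (v x) - (48 * (L x)^2 - 13 * k x * (z x)^2 - 9 * (z x)^2 + 15 * c)) = 0"
      using dw[OF x] D[OF x] sq[OF x] wz[OF x] sk[OF x] by algebra
    then show ?thesis using L0[OF x] by simp
  qed
  have dk: "9 * FD k x (v x) * z x = -48*(L x)^2*k x - 15*(L x)^2 + 4*(z x)^2*(k x)^2 + 5*(z x)^2*k x - 15*k x*c - 21*c"
    if x: "x \<in> S" for x
  proof -
    have "((\<lambda>t. p (x + t *\<^sub>R v x) + q (x + t *\<^sub>R v x) - k (x + t *\<^sub>R v x) * z (x + t *\<^sub>R v x)) has_real_derivative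
       FD p x (v x) + FD q x (v x) - (FD k x (v x) * z x + FD z x (v x) * k x)) (at 0)"
      by (rule derivative_eq_intros refl line[OF smooth(4) x] line[OF smooth(5) x] line[OF sz x] line[OF sk' x])+
        simp
    from line_derivative_unique[OF S x _ this] sk
    have "FD p x (v x) + FD q x (v x) = FD k x (v x) * z x + FD z x (v x) * k x" by simp
    then show ?thesis
      using dp[OF x] dq[OF x] dz[OF x] D[OF x] sk[OF x] pq[OF x] tr[OF x] by algebra
  qed
  have F2: "1218*(L x)^2*k x + 1182*(L x)^2 - 52*(z x)^2*(k x)^2 - 52*(z x)^2*k x - 75*k x*c - 84*c = 0"
    if x: "x \<in> S" for x
  proof -
    have "((\<lambda>t. 9 * (M (x + t *\<^sub>R v x) - K (x + t *\<^sub>R v x))^2 + 3 * (L (x + t *\<^sub>R v x))^2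
        + 8 * k (x + t *\<^sub>R v x) * (z (x + t *\<^sub>R v x))^2 - 30*c) has_real_derivative
        18 * (M x - K x) * ((L x - M x) * p x - (L x - K x) * q x) + 6 * L x * w x
        + 8 * (FD k x (v x) * (z x)^2 + 2 * k x * z x * FD z x (v x))) (at 0)"
      by (rule derivative_eq_intros refl line[OF smooth(1) x] line[OF smooth(2) x] line[OF smooth(3) x]
          line[OF sz x] line[OF sk' x])+
        (simp add: dL dM dK x algebra_simps)
    from line_derivative_unique[OF S x _ this]
    have "18 * (M x - K x) * ((L x - M x) * p x - (L x - K x) * q x) + 6 * L x * w x
        + 8 * (FD k x (v x) * (z x)^2 + 2 * k x * z x * FD z x (v x)) = 0"
      using D by simp
    moreover have "2 * (M x - K x) * ((L x - M x) * p x - (L x - K x) * q x)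
        = z x * ((L x)^2 * (25 * k x + 30) - k x * (M x - K x)^2)"
      using tr[OF x] w_eq[OF x] sk[OF x] wz[OF x] by algebra
    ultimately have "z x * (1218*(L x)^2*k x + 1182*(L x)^2 - 52*(z x)^2*(k x)^2 - 52*(z x)^2*k x - 75*k x*c - 84*c) = 0"
      using D[OF x] dz[OF x] dk[OF x] wz[OF x] by algebra
    then show ?thesis using z0[OF x] by simp
  qed
  have G: "-126*((L x)^2)^2 - 1026*(L x)^2*(z x)^2*(k x)^2 - 2778*(L x)^2*(z x)^2*k x - 1458*(L x)^2*(z x)^2 + 1251*(L x)^2*c
     - 36*((z x)^2)^2*(k x)^3 - 32*((z x)^2)^2*(k x)^2 + 135*(z x)^2*(k x)^2*c + 96*(z x)^2*k x*c + 90*c^2 = 0"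
    if x: "x \<in> S" for x
  proof -
    have "(M x - K x) * (p x - q x) = 5 * L x * (k x * z x) + 6 * (L x * z x)"
      using tr[OF x] w_eq[OF x] sk[OF x] wz[OF x] by algebra
    moreover have "(p x - q x)^2 = (k x * z x)^2 + 4 * c + 9 * (L x)^2 - (M x - K x)^2"
      using tr[OF x] pq[OF x] sk[OF x] by algebra
    ultimately have "(M x - K x)^2 * ((k x * z x)^2 + 4 * c + 9 * (L x)^2 - (M x - K x)^2)
        = (5 * L x * (k x * z x) + 6 * (L x * z x))^2"
      by algebra
    then show ?thesis using D[OF x] by algebra
  qed
  have F3: "-58464*((L x)^2)^2*k x - 18270*((L x)^2)^2 + 4872*(L x)^2*(z x)^2*(k x)^2 + 27078*(L x)^2*(z x)^2*k x
     + 22056*(L x)^2*(z x)^2 - 14670*(L x)^2*k x*c - 24453*(L x)^2*c + 936*((z x)^2)^2*(k x)^3 + 1560*((z x)^2)^2*(k x)^2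
     + 676*((z x)^2)^2*k x - 300*(z x)^2*(k x)^2*c + 1029*(z x)^2*k x*c + 1092*(z x)^2*c + 1125*k x*c^2 + 1575*c^2 = 0"
    if x: "x \<in> S" for x
  proof -
    have "((\<lambda>t. 1218*(L (x + t *\<^sub>R v x))^2*k (x + t *\<^sub>R v x) + 1182*(L (x + t *\<^sub>R v x))^2
        - 52*(z (x + t *\<^sub>R v x))^2*(k (x + t *\<^sub>R v x))^2 - 52*(z (x + t *\<^sub>R v x))^2*k (x + t *\<^sub>R v x)
        - 75*k (x + t *\<^sub>R v x)*c - 84*c) has_real_derivative
        1218 * (2 * L x * w x * k x + (L x)^2 * FD k x (v x)) + 2364 * L x * w x
        - 52 * (2 * z x * FD z x (v x) * (k x)^2 + (z x)^2 * 2 * k x * FD k x (v x))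
        - 52 * (2 * z x * FD z x (v x) * k x + (z x)^2 * FD k x (v x)) - 75 * c * FD k x (v x)) (at 0)"
      by (rule derivative_eq_intros refl line[OF smooth(1) x] line[OF sz x] line[OF sk' x])+
        (simp add: dL x algebra_simps)
    from line_derivative_unique[OF S x _ this]
    have "1218 * (2 * L x * w x * k x + (L x)^2 * FD k x (v x)) + 2364 * L x * w x
        - 52 * (2 * z x * FD z x (v x) * (k x)^2 + (z x)^2 * 2 * k x * FD k x (v x))
        - 52 * (2 * z x * FD z x (v x) * k x + (z x)^2 * FD k x (v x)) - 75 * c * FD k x (v x) = 0"
      using F2 by simp
    then show ?thesis
      using dz[OF x] dk[OF x] wz[OF x] by algebra
  qed
  have "poly elim_poly (k x) = 0" if x: "x \<in> S" for x
    using binary_quadratics_resultant[OF elimination[OF F2[OF x] G[OF x] F3[OF x]]] L0[OF x]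
    by (simp add: elim_poly_def)
  then obtain U where U: "open U" "x0 \<in> U" "U \<subseteq> S" and kU: "\<And>y. y \<in> U \<Longrightarrow> k y = k x0"
    using locally_constant_of_roots[OF S x0 smooth_on_imp_continuous_on[OF sk'] elim_poly_nonzero] by blast
  have rigid: "\<alpha> = 0" if "\<And>y. y \<in> U \<Longrightarrow> \<alpha> * (L y)^2 + \<beta> = 0" for \<alpha> \<beta>
  proof -
    have "((\<lambda>t. \<alpha> * (L (x0 + t *\<^sub>R v x0))^2 + \<beta>) has_real_derivative \<alpha> * (2 * L x0 * w x0)) (at 0)"
      by (rule derivative_eq_intros refl line[OF smooth(1) x0])+ (simp add: dL x0)
    from line_derivative_unique[OF U(1,2) _ this] that have "\<alpha> * (2 * L x0 * w x0) = 0" by blast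
    then show ?thesis using L0 w0 x0 by simp
  qed
  have dk0: "FD k x (v x) = 0" if x: "x \<in> U" for x
    using FD_cong[OF U(1) x, of k "\<lambda>_. k x0"] kU by simp
  define k0 where "k0 = k x0"
  have F2U: "1218*(L x)^2*k0 + 1182*(L x)^2 - 52*(z x)^2*k0^2 - 52*(z x)^2*k0 - 75*k0*c - 84*c = 0"
    and NU: "-48*(L x)^2*k0 - 15*(L x)^2 + 4*(z x)^2*k0^2 + 5*(z x)^2*k0 - 15*k0*c - 21*c = 0" if x: "x \<in> U" for x
    using F2[of x] dk[of x] dk0[OF x] kU[OF x] x U(3) by (auto simp: k0_def)
  have k0: "k0 \<noteq> 0"
  proof
    assume "k0 = 0"
    then have "1182 * (L x)^2 + (- 84*c) = 0" if "x \<in> U" for x using F2U[OF that] by simp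
    from rigid[OF this] show False by simp
  qed
  have n: "(132*k0^2 + 419*k0 + 285) * (L x)^2 + - ((60*k0^2 + 287/2*k0 + 84) * c) = 0" if x: "x \<in> U" for x
  proof -
    have "k0 * ((132*k0^2 + 419*k0 + 285) * (L x)^2 - (60*k0^2 + 287/2*k0 + 84) * c) = 0"
      using F2U[OF x] NU[OF x] by algebra
    then show ?thesis using k0 by simp
  qed
  have n1: "132*k0^2 + 419*k0 + 285 = 0" using rigid n by blast
  then have "(60*k0^2 + 287/2*k0 + 84) * c = 0" using n[OF U(2)] by simp
  moreover have "60*k0^2 + 287/2*k0 + 84 \<noteq> 0"
  proof
    assume "60*k0^2 + 287/2*k0 + 84 = 0"
    with n1 show False by algebra
  qed
  ultimately have c: "c = 0" by simp
  have "poly eA2 k0 = 0"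
    using elimination(1)[OF F2[OF x0] G[OF x0] F3[OF x0]] c L0[OF x0] by (simp add: k0_def)
  then have "k0 * (276588 + 1227636*k0 + 1991412*k0^2 + 1405748*k0^3 + 365400*k0^4) = 0"
    by (simp add: eA2_def algebra_simps power2_eq_square power3_eq_cube power4_eq_xxxx)
  then have "276588 + 1227636*k0 + 1991412*k0^2 + 1405748*k0^3 + 365400*k0^4 = 0" using k0 by simp
  with n1 show False by algebra
qed

lemma umbilic_ode:
  fixes L p w :: "'a::euclidean_space \<Rightarrow> real" and v :: "'a \<Rightarrow> 'a" and c :: real
  assumes S: "open S"
    and smooth: "smooth_on S L" "smooth_on S p" "smooth_on S w"
    and dL: "\<And>x. x \<in> S \<Longrightarrow> FD L x (v x) = w x"
    and dp: "\<And>x. x \<in> S \<Longrightarrow> FD p x (v x) = - ((p x)^2) - c + 3/2 * (L x)^2"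
    and dw: "\<And>x. x \<in> S \<Longrightarrow> FD w x (v x) = 11/2 * (L x)^3 - 2 * p x * w x"
    and wp: "\<And>x. x \<in> S \<Longrightarrow> 3 * w x + 5 * L x * p x = 0"
    and L0: "\<And>x. x \<in> S \<Longrightarrow> L x \<noteq> 0" and w0: "\<And>x. x \<in> S \<Longrightarrow> w x \<noteq> 0"
  shows "S = {}"
proof (rule ccontr)
  assume "S \<noteq> {}"
  then obtain x0 where x0: "x0 \<in> S" by blast
  note line = smooth_on_line_derivative[OF S]
  have 1: "10 * (p x)^2 - 72 * (L x)^2 + 15 * c = 0" if x: "x \<in> S" for x
  proof -
    have "((\<lambda>t. 3 * w (x + t *\<^sub>R v x) + 5 * L (x + t *\<^sub>R v x) * p (x + t *\<^sub>R v x)) has_real_derivative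
        3 * (11/2 * (L x)^3 - 2 * p x * w x) + 5 * (w x * p x + L x * (- ((p x)^2) - c + 3/2 * (L x)^2))) (at 0)"
      by (rule derivative_eq_intros refl line[OF smooth(1) x] line[OF smooth(2) x] line[OF smooth(3) x])+
        (simp add: dL dp dw x algebra_simps)
    from line_derivative_unique[OF S x _ this]
    have "3 * (11/2 * (L x)^3 - 2 * p x * w x) + 5 * (w x * p x + L x * (- ((p x)^2) - c + 3/2 * (L x)^2)) = 0"
      using wp by simp
    then have "L x * (10 * (p x)^2 - 72 * (L x)^2 + 15 * c) = 0"
      using wp[OF x] by algebra
    then show ?thesis using L0[OF x] by simp
  qed
  have 2: "126 * (L x)^2 + 10 * c = 0" if x: "x \<in> S" for x
  proof -
    have "((\<lambda>t. 10 * (p (x + t *\<^sub>R v x))^2 - 72 * (L (x + t *\<^sub>R v x))^2 + 15 * c) has_real_derivative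
        20 * p x * (- ((p x)^2) - c + 3/2 * (L x)^2) - 144 * L x * w x) (at 0)"
      by (rule derivative_eq_intros refl line[OF smooth(1) x] line[OF smooth(2) x])+
        (simp add: dL dp x)
    from line_derivative_unique[OF S x _ this] 1
    have "20 * p x * (- ((p x)^2) - c + 3/2 * (L x)^2) - 144 * L x * w x = 0" by simp
    moreover have "p x \<noteq> 0" using wp[OF x] w0[OF x] by auto
    moreover have "p x * (126 * (L x)^2 + 10 * c) = 0"
      using calculation(1) wp[OF x] 1[OF x] by algebra
    ultimately show ?thesis by simp
  qed
  have "((\<lambda>t. 126 * (L (x0 + t *\<^sub>R v x0))^2 + 10 * c) has_real_derivative 252 * L x0 * w x0) (at 0)"
    by (rule derivative_eq_intros refl line[OF smooth(1) x0])+ (simp add: dL x0)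
  from line_derivative_unique[OF S x0 _ this] 2 have "252 * L x0 * w x0 = 0" by blast
  then show False using L0 w0 x0 by simp
qed

declare One_nat_def [simp del]

section \<open>Frames of principal directions\<close>

text \<open>Where \<open>b \<noteq> 0\<close>, differentiating \<open>E1\<close> and \<open>E2\<close> along \<open>u\<close> yields
  \<open>w (p - q) = L (M - K) (L - M)\<close>; differentiating this relation once more forces \<open>M = K\<close>.\<close>

lemma transverse_coefficient_zero:
  fixes L M K p q w w' b :: "'a::euclidean_space \<Rightarrow> real" and u :: "'a \<Rightarrow> 'a"
  assumes S: "open S" and x: "x \<in> S"
    and smooth: "smooth_on S L" "smooth_on S M" "smooth_on S K" "smooth_on S p" "smooth_on S q" "smooth_on S w"
      "smooth_on S w'" "smooth_on S b"
    and dL: "\<And>x. x \<in> S \<Longrightarrow> FD L x (u x) = 0"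
    and dw: "\<And>x. x \<in> S \<Longrightarrow> FD w x (u x) = 0"
    and dw': "\<And>x. x \<in> S \<Longrightarrow> FD w' x (u x) = 0"
    and dM: "\<And>x. x \<in> S \<Longrightarrow> FD M x (u x) = (M x - K x) * b x"
    and dK: "\<And>x. x \<in> S \<Longrightarrow> FD K x (u x) = - ((M x - K x) * b x)"
    and dq: "\<And>x. x \<in> S \<Longrightarrow> FD q x (u x) = (q x - p x) * b x"
    and tr: "\<And>x. x \<in> S \<Longrightarrow> M x + K x = - 3 * L x"
    and E1: "\<And>x. x \<in> S \<Longrightarrow> 3 * w x + (L x - M x) * p x + (L x - K x) * q x = 0"
    and E2: "\<And>x. x \<in> S \<Longrightarrow> w' x + (p x + q x) * w x - L x * ((L x)^2 + (M x)^2 + (K x)^2) = 0"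
    and L0: "\<And>x. x \<in> S \<Longrightarrow> L x \<noteq> 0" and LM: "\<And>x. x \<in> S \<Longrightarrow> L x \<noteq> M x" and MK: "\<And>x. x \<in> S \<Longrightarrow> M x \<noteq> K x"
  shows "b x = 0"
proof (rule ccontr)
  assume b0: "b x \<noteq> 0"
  note line = smooth_on_line_derivative[OF S]
  have D1: "(L y - M y) * FD p y (u y) = (L y + M y - 2 * K y) * (p y - q y) * b y" if y: "y \<in> S" for y
  proof -
    have "((\<lambda>t. 3 * w (y + t *\<^sub>R u y) + (L (y + t *\<^sub>R u y) - M (y + t *\<^sub>R u y)) * p (y + t *\<^sub>R u y)
        + (L (y + t *\<^sub>R u y) - K (y + t *\<^sub>R u y)) * q (y + t *\<^sub>R u y)) has_real_derivative
        (- ((M y - K y) * b y) * p y + FD p y (u y) * (L y - M y))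
        + ((M y - K y) * b y * q y + (q y - p y) * b y * (L y - K y))) (at 0)"
      by (rule derivative_eq_intros refl line[OF smooth(1) y] line[OF smooth(2) y] line[OF smooth(3) y]
          line[OF smooth(4) y] line[OF smooth(5) y] line[OF smooth(6) y])+
        (simp add: dL dM dK dq dw y)
    from line_derivative_unique[OF S y _ this] E1
    have "(- ((M y - K y) * b y) * p y + FD p y (u y) * (L y - M y))
        + ((M y - K y) * b y * q y + (q y - p y) * b y * (L y - K y)) = 0" by blast
    then show ?thesis by algebra
  qed
  have D2: "(FD p y (u y) + (q y - p y) * b y) * w y = 2 * L y * (M y - K y)^2 * b y" if y: "y \<in> S" for y
  proof -
    have "((\<lambda>t. w' (y + t *\<^sub>R u y) + (p (y + t *\<^sub>R u y) + q (y + t *\<^sub>R u y)) * w (y + t *\<^sub>R u y)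
        - L (y + t *\<^sub>R u y) * ((L (y + t *\<^sub>R u y))^2 + (M (y + t *\<^sub>R u y))^2 + (K (y + t *\<^sub>R u y))^2))
        has_real_derivative
        (FD p y (u y) + (q y - p y) * b y) * w y
        - L y * (2 * M y * ((M y - K y) * b y) - 2 * K y * ((M y - K y) * b y))) (at 0)"
      by (rule derivative_eq_intros refl line[OF smooth(1) y] line[OF smooth(2) y] line[OF smooth(3) y]
          line[OF smooth(4) y] line[OF smooth(5) y] line[OF smooth(6) y] line[OF smooth(7) y])+
        (simp add: dL dM dK dq dw dw' y)
    from line_derivative_unique[OF S y _ this] E2
    have "(FD p y (u y) + (q y - p y) * b y) * w y
        - L y * (2 * M y * ((M y - K y) * b y) - 2 * K y * ((M y - K y) * b y)) = 0" by blast
    then show ?thesis by algebra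
  qed
  define U where "U = {y \<in> S. (b y)^2 > 0}"
  have U: "open U" "x \<in> U" "U \<subseteq> S"
    using open_smooth_pos[OF S smooth_on_power[OF S smooth(8)], of 2] x b0 by (auto simp: U_def)
  have D3: "w y * (p y - q y) - L y * (M y - K y) * (L y - M y) = 0" if yU: "y \<in> U" for y
  proof -
    have y: "y \<in> S" and b: "b y \<noteq> 0" using yU by (auto simp: U_def)
    have "2 * b y * (M y - K y) * (w y * (p y - q y) - L y * (M y - K y) * (L y - M y)) = 0"
      using D1[OF y] D2[OF y] by algebra
    then show ?thesis using b MK[OF y] by simp
  qed
  have "((\<lambda>t. w (x + t *\<^sub>R u x) * (p (x + t *\<^sub>R u x) - q (x + t *\<^sub>R u x))
      - L (x + t *\<^sub>R u x) * (M (x + t *\<^sub>R u x) - K (x + t *\<^sub>R u x)) * (L (x + t *\<^sub>R u x) - M (x + t *\<^sub>R u x)))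
      has_real_derivative
      w x * (FD p x (u x) - (q x - p x) * b x)
      - L x * (2 * ((M x - K x) * b x) * (L x - M x) - (M x - K x) * ((M x - K x) * b x))) (at 0)"
    by (rule derivative_eq_intros refl line[OF smooth(1) x] line[OF smooth(2) x] line[OF smooth(3) x]
        line[OF smooth(4) x] line[OF smooth(5) x] line[OF smooth(6) x])+
      (simp add: dL dM dK dq dw x algebra_simps)
  from line_derivative_unique[OF U(1,2) _ this] D3
  have "w x * (FD p x (u x) - (q x - p x) * b x)
      - L x * (2 * ((M x - K x) * b x) * (L x - M x) - (M x - K x) * ((M x - K x) * b x)) = 0" by blast
  then have "3 * b x * L x * (L x - M x) * (M x - K x)^2 = 0"
    using D1[OF x] D3[OF U(2)] by algebra
  then show False using b0 L0[OF x] LM[OF x] MK[OF x] by simp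
qed

lemma smooth_dichotomy:
  fixes F :: "'a::euclidean_space \<Rightarrow> real"
  assumes "open S" "smooth_on S F"
  obtains "\<And>x. x \<in> S \<Longrightarrow> F x = 0"
  | U where "open U" "U \<noteq> {}" "U \<subseteq> S" "\<And>x. x \<in> U \<Longrightarrow> F x \<noteq> 0"
proof (cases "\<forall>x\<in>S. F x = 0")
  case True
  show thesis by (rule that(1)) (use True in blast)
next
  case False
  let ?U = "{x \<in> S. (F x)^2 > 0}"
  have "open ?U" by (rule open_smooth_pos[OF assms(1) smooth_on_power[OF assms]])
  moreover have "?U \<noteq> {}" using False by auto
  ultimately show thesis by (rule that(2)) auto
qed

lemma (in adapted_frame) restrict_frame:
  assumes "open U" "U \<subseteq> S"
  shows "adapted_frame U g T h \<phi> e E c m"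
proof (intro adapted_frame.intro adapted_frame_axioms.intro restrict assms)
  show "smooth_on U (e i)" if "i < m" for i by (rule smooth_on_subset[OF smooth_e[OF that] assms(2)])
  show "smooth_on U (E m)" by (rule smooth_on_subset[OF smooth_normal assms(2)])
  show "orthonormal_family (Suc m) (h (\<phi> x)) (\<lambda>a. E a x)" if "x \<in> U" for x
    using ortho that assms(2) by blast
qed (fact dim codim E_push const_curv)+

locale hypersurface3 = adapted_frame S g T h \<phi> e E c m
  for S :: "'e::euclidean_space set" and g and T :: "'f::euclidean_space set" and h \<phi> e E c m +
  assumes m3: "m = 3" and lap_zero: "x \<in> S \<Longrightarrow> lap x = 0"
begin

lemma sum3: "(\<Sum>k<m. F k) = F 0 + F 1 + (F 2 :: real)"
  by (simp add: m3 numeral_3_eq_3 numeral_2_eq_2 One_nat_def)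

lemma sum4: "(\<Sum>k\<le>m. F k) = F 0 + F 1 + F 2 + (F 3 :: real)"
  by (simp add: m3 numeral_3_eq_3 numeral_2_eq_2 One_nat_def)

lemma D_zero: "x \<in> S \<Longrightarrow> (\<And>y. y \<in> S \<Longrightarrow> F y = 0) \<Longrightarrow> D i F x = (0::real)"
  using FD_cong[OF open_S, of x F "\<lambda>_. 0"] by (simp add: D_def)

lemma D_cong: "x \<in> S \<Longrightarrow> (\<And>y. y \<in> S \<Longrightarrow> F y = G y) \<Longrightarrow> D i F x = D i G x"
  unfolding D_def by (rule FD_cong[OF open_S])

lemma D_mult:
  fixes F G :: "'e \<Rightarrow> real"
  shows "x \<in> S \<Longrightarrow> smooth_on S F \<Longrightarrow> smooth_on S G \<Longrightarrow> D i (\<lambda>y. F y * G y) x = D i F x * G x + F x * D i G x"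
  unfolding D_def by (rule FD_mult[OF open_S])

lemma W_diag:
  assumes "x \<in> S" "i < 3" "a \<le> 3"
  shows "W i a a x = 0"
proof -
  have "W i a a x = - W i a a x" by (rule W_skew) (use assms m3 in simp_all)
  then show ?thesis by linarith
qed

lemma W_flip:
  assumes "x \<in> S" "i < 3"
  shows "W i 1 0 x = - W i 0 1 x" "W i 2 0 x = - W i 0 2 x" "W i 2 1 x = - W i 1 2 x"
    "W i 3 0 x = - W i 0 3 x" "W i 3 1 x = - W i 1 3 x" "W i 3 2 x = - W i 2 3 x"
  by (rule W_skew[OF assms(1)]; use assms(2) m3 in simp)+

lemma W_sym:
  assumes "x \<in> S"
  shows "W 1 0 3 x = W 0 1 3 x" "W 2 0 3 x = W 0 2 3 x" "W 2 1 3 x = W 1 2 3 x"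
  using W_normal_sym[OF assms] m3 by simp_all

lemma D_W_skew:
  assumes "x \<in> S" "i < 3" "j < 3" "a \<le> 3" "b \<le> 3"
  shows "D i (W j a b) x = - D i (W j b a) x"
proof -
  have s: "smooth_on S (W j b a)" using assms m3 by (intro smooth_W) auto
  have "D i (W j a b) x = D i (\<lambda>y. - W j b a y) x"
    using W_skew[of _ j a b] assms m3 by (intro D_cong) auto
  then show ?thesis
    using FD_bounded_linear[OF open_S assms(1) s bounded_linear_minus[OF bounded_linear_ident]]
    by (simp add: D_def)
qed

lemma D_W_sym:
  assumes "x \<in> S"
  shows "D i (W 1 0 3) x = D i (W 0 1 3) x" "D i (W 2 0 3) x = D i (W 0 2 3) x" "D i (W 2 1 3) x = D i (W 1 2 3) x"
  using assms W_sym by (auto intro!: D_cong)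

lemma mean3: "x \<in> S \<Longrightarrow> mean x = W 0 0 3 x + W 1 1 3 x + W 2 2 3 x"
  by (simp add: mean_def sum3) (simp add: m3)

lemma D_mean:
  assumes x: "x \<in> S"
  shows "D i mean x = D i (W 0 0 3) x + D i (W 1 1 3) x + D i (W 2 2 3) x"
proof -
  have s: "smooth_on S (W j j 3)" if "j < 3" for j using smooth_W[of j j 3] that m3 by simp
  have "D i mean x = D i (\<lambda>y. W 0 0 3 y + W 1 1 3 y + W 2 2 3 y) x"
    by (intro D_cong x mean3)
  also have "\<dots> = D i (\<lambda>y. W 0 0 3 y + W 1 1 3 y) x + D i (W 2 2 3) x"
    unfolding D_def using s by (intro FD_add[OF open_S x] smooth_on_add[OF open_S]) auto
  also have "D i (\<lambda>y. W 0 0 3 y + W 1 1 3 y) x = D i (W 0 0 3) x + D i (W 1 1 3) x"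
    unfolding D_def using s by (intro FD_add[OF open_S x]) auto
  finally show ?thesis .
qed

lemma structure3:
  assumes "x \<in> S" "i < 3" "j < 3" "a \<le> 3" "b \<le> 3"
  shows "D i (W j a b) x - D j (W i a b) x =
    (W j a 0 x * W i b 0 x + W j a 1 x * W i b 1 x + W j a 2 x * W i b 2 x + W j a 3 x * W i b 3 x)
    - (W i a 0 x * W j b 0 x + W i a 1 x * W j b 1 x + W i a 2 x * W j b 2 x + W i a 3 x * W j b 3 x)
    + ((W i j 0 x - W j i 0 x) * W 0 a b x + (W i j 1 x - W j i 1 x) * W 1 a b x + (W i j 2 x - W j i 2 x) * W 2 a b x)
    + c * ((if j = a then 1 else 0) * (if i = b then 1 else 0) - (if i = a then 1 else 0) * (if j = b then 1 else 0))"
  using structure_equation[of x i j a b] assms m3 unfolding sum3 sum4 by simp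

lemma D_commute3:
  fixes F :: "'e \<Rightarrow> real"
  assumes "x \<in> S" "i < 3" "j < 3" "smooth_on S F"
  shows "D i (D j F) x - D j (D i F) x = (W i j 0 x - W j i 0 x) * D 0 F x
    + (W i j 1 x - W j i 1 x) * D 1 F x + (W i j 2 x - W j i 2 x) * D 2 F x"
  using D_commute[of x i j F] assms m3 unfolding sum3 by simp

lemma lap_tangential:
  assumes x: "x \<in> S" and j: "j < 3"
  shows "(\<Sum>i<m. D i mean x * W i 3 j x + mean x * D i (W i 3 j) x
     - (\<Sum>d\<le>m. ((if d = 3 then D i mean x else 0) + mean x * W i 3 d x) * W i j d x)
     - (\<Sum>k<m. W i i k x * (mean x * W k 3 j x))) = 0"
proof -
  have "D i (\<lambda>y. mean y * W i 3 j y) x = D i mean x * W i 3 j x + mean x * D i (W i 3 j) x" if "i < m" for i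
    using smooth_W[of i 3 j] that j m3 by (intro D_mult x smooth_mean) auto
  then show ?thesis
    using lap_component[OF x, of j] j m3 lap_zero[OF x] inner_form.zero_left[OF form_phi[OF x]]
    by simp
qed

lemma lap_normal:
  assumes x: "x \<in> S"
  shows "(\<Sum>i<m. D i (D i mean) x
     - (\<Sum>d\<le>m. ((if d = 3 then D i mean x else 0) + mean x * W i 3 d x) * W i 3 d x)
     - (\<Sum>k<m. W i i k x * D k mean x)) = 0"
proof -
  have "D i (\<lambda>y. D i mean y + mean y * W i 3 3 y) x = D i (D i mean) x" if "i < m" for i
    using that m3 W_diag by (intro D_cong x) auto
  then show ?thesis
    using lap_component[OF x, of m] m3 lap_zero[OF x] inner_form.zero_left[OF form_phi[OF x]] W_diag[OF x]
    by simp
qed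

lemma biconservative:
  assumes x: "x \<in> S"
  shows "2 * (W 0 0 3 x * D 0 mean x + W 0 1 3 x * D 1 mean x + W 0 2 3 x * D 2 mean x) + mean x * D 0 mean x = 0"
    "2 * (W 0 1 3 x * D 0 mean x + W 1 1 3 x * D 1 mean x + W 1 2 3 x * D 2 mean x) + mean x * D 1 mean x = 0"
    "2 * (W 0 2 3 x * D 0 mean x + W 1 2 3 x * D 1 mean x + W 2 2 3 x * D 2 mean x) + mean x * D 2 mean x = 0"
proof -
  note simps = W_flip[OF x] W_sym[OF x] W_diag[OF x] D_W_sym[OF x] D_W_skew[OF x, of _ _ 3 _]
  show "2 * (W 0 0 3 x * D 0 mean x + W 0 1 3 x * D 1 mean x + W 0 2 3 x * D 2 mean x) + mean x * D 0 mean x = 0"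
    using lap_tangential[OF x, of 0] structure3[OF x, of 1 0 1 3] structure3[OF x, of 2 0 2 3] D_mean[OF x, of 0]
    by (simp add: sum3 sum4 simps) algebra
  show "2 * (W 0 1 3 x * D 0 mean x + W 1 1 3 x * D 1 mean x + W 1 2 3 x * D 2 mean x) + mean x * D 1 mean x = 0"
    using lap_tangential[OF x, of 1] structure3[OF x, of 0 1 0 3] structure3[OF x, of 2 1 2 3] D_mean[OF x, of 1]
    by (simp add: sum3 sum4 simps) algebra
  show "2 * (W 0 2 3 x * D 0 mean x + W 1 2 3 x * D 1 mean x + W 2 2 3 x * D 2 mean x) + mean x * D 2 mean x = 0"
    using lap_tangential[OF x, of 2] structure3[OF x, of 0 2 0 3] structure3[OF x, of 1 2 1 3] D_mean[OF x, of 2]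
    by (simp add: sum3 sum4 simps) algebra
qed

lemma laplacian_mean:
  assumes x: "x \<in> S"
  shows "D 0 (D 0 mean) x + D 1 (D 1 mean) x + D 2 (D 2 mean) x
    - W 0 0 1 x * D 1 mean x - W 0 0 2 x * D 2 mean x
    + W 1 0 1 x * D 0 mean x - W 1 1 2 x * D 2 mean x + W 2 0 2 x * D 0 mean x + W 2 1 2 x * D 1 mean x
    = mean x * ((W 0 0 3 x)^2 + (W 1 1 3 x)^2 + (W 2 2 3 x)^2 + 2 * ((W 0 1 3 x)^2 + (W 0 2 3 x)^2 + (W 1 2 3 x)^2))"
  using lap_normal[OF x]
  by (simp add: sum3 sum4 W_flip[OF x] W_sym[OF x] W_diag[OF x]) algebra

lemma mean_zero_if_locally_constant:
  assumes x: "x \<in> S" and D: "\<And>y i. y \<in> S \<Longrightarrow> i < 3 \<Longrightarrow> D i mean y = 0"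
  shows "mean x = 0"
proof (rule ccontr)
  assume n: "mean x \<noteq> 0"
  have "D i (D i mean) x = 0" if "i < 3" for i by (rule D_zero[OF x D[OF _ that]])
  then have "(W 0 0 3 x)^2 + (W 1 1 3 x)^2 + (W 2 2 3 x)^2 + 2 * ((W 0 1 3 x)^2 + (W 0 2 3 x)^2 + (W 1 2 3 x)^2) = 0"
    using laplacian_mean[OF x] D[OF x] n by simp
  then have "W 0 0 3 x = 0" "W 1 1 3 x = 0" "W 2 2 3 x = 0"
    by (smt (verit) zero_le_power2 power2_eq_iff zero_eq_power2)+
  then show False using n mean3[OF x] by simp
qed

lemma restrict_hypersurface:
  assumes "open U" "U \<subseteq> S"
  shows "hypersurface3 U g T h \<phi> e E c m"
proof (intro hypersurface3.intro hypersurface3_axioms.intro restrict_frame assms m3)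
  show "lap x = 0" if "x \<in> U" for x using that assms(2) lap_zero by blast
qed

end

text \<open>The frame index 0 is the direction of the gradient of the mean curvature; the other two
  frame vectors are the remaining principal directions.\<close>

locale principal_frame = hypersurface3 S g T h \<phi> e E c m
  for S :: "'e::euclidean_space set" and g and T :: "'f::euclidean_space set" and h \<phi> e E c m +
  assumes D0_mean: "x \<in> S \<Longrightarrow> D 0 mean x \<noteq> 0"
    and D1_mean: "x \<in> S \<Longrightarrow> D 1 mean x = 0"
    and D2_mean: "x \<in> S \<Longrightarrow> D 2 mean x = 0"
    and W123: "x \<in> S \<Longrightarrow> W 1 2 3 x = 0"
begin

lemma restrict_principal:
  assumes "open U" "U \<subseteq> S"
  shows "principal_frame U g T h \<phi> e E c m"
  using D0_mean D1_mean D2_mean W123 assms(2)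
  by (intro principal_frame.intro principal_frame_axioms.intro restrict_hypersurface assms) blast+

abbreviation L where "L \<equiv> W 0 0 3"
abbreviation M where "M \<equiv> W 1 1 3"
abbreviation K where "K \<equiv> W 2 2 3"
abbreviation p where "p \<equiv> W 1 0 1"
abbreviation q where "q \<equiv> W 2 0 2"

lemma mean_eq:
  assumes x: "x \<in> S"
  shows "mean x = - 2 * L x"
proof -
  have "(2 * L x + mean x) * D 0 mean x = 0"
    using biconservative(1)[OF x] D1_mean[OF x] D2_mean[OF x] by (simp add: algebra_simps)
  then show ?thesis using D0_mean[OF x] by simp
qed

lemma W013: "x \<in> S \<Longrightarrow> W 0 1 3 x = 0" and W023: "x \<in> S \<Longrightarrow> W 0 2 3 x = 0"
  using biconservative(2,3)[of x] D1_mean[of x] D2_mean[of x] D0_mean[of x] by simp_all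

lemma smooth3: "i < 3 \<Longrightarrow> a \<le> 3 \<Longrightarrow> b \<le> 3 \<Longrightarrow> smooth_on S (W i a b)"
  using m3 by (intro smooth_W) auto

lemma smooth_L: "smooth_on S L" and smooth_M: "smooth_on S M" and smooth_K: "smooth_on S K"
  and smooth_p: "smooth_on S p" and smooth_q: "smooth_on S q" and smooth_w: "smooth_on S (D 0 L)"
  by (simp_all add: smooth3 smooth_D m3)

lemma trace_relation: "x \<in> S \<Longrightarrow> M x + K x = - 3 * L x"
  using mean3 mean_eq by fastforce

lemma D_mean_L:
  assumes x: "x \<in> S"
  shows "D i mean x = - 2 * D i L x"
proof -
  have "D i mean x = D i (\<lambda>y. - 2 * L y) x" by (rule D_cong[OF x mean_eq])
  then show ?thesis using D_mult[OF x smooth_on_const smooth_L, of i "- 2"] by (simp add: D_def)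
qed

lemma D0_L: "x \<in> S \<Longrightarrow> D 0 L x \<noteq> 0" and D1_L: "x \<in> S \<Longrightarrow> D 1 L x = 0" and D2_L: "x \<in> S \<Longrightarrow> D 2 L x = 0"
  using D_mean_L D0_mean D1_mean D2_mean by fastforce+

lemma D_K: "x \<in> S \<Longrightarrow> D i K x = - 3 * D i L x - D i M x"
  using D_mean[of x i] D_mean_L[of x i] by simp

lemma D_off_diagonal: "x \<in> S \<Longrightarrow> D i (W 0 1 3) x = 0" "x \<in> S \<Longrightarrow> D i (W 0 2 3) x = 0" "x \<in> S \<Longrightarrow> D i (W 1 2 3) x = 0"
  by (intro D_zero W013 W023 W123; assumption)+

lemmas normalize = W_flip W_sym W_diag D_W_sym D_W_skew[of _ _ _ 3 _] W013 W023 W123 D_off_diagonal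

lemma codazzi:
  assumes x: "x \<in> S"
  shows "(L x - M x) * W 0 0 1 x = 0" "(L x - K x) * W 0 0 2 x = 0"
    "D 0 M x = (L x - M x) * p x" "D 0 K x = (L x - K x) * q x"
    "(L x - K x) * W 1 0 2 x = (M x - K x) * W 0 1 2 x"
    "(M x - K x) * W 1 0 2 x = 0"
    "D 2 M x = (M x - K x) * W 1 1 2 x" "D 1 K x = (K x - M x) * W 2 2 1 x" "W 2 0 1 x = W 1 0 2 x"
proof -
  have "(W 1 2 0 x - W 2 1 0 x) * D 0 mean x = 0"
    using D_commute3[OF x, of 1 2 mean] smooth_mean D_zero[of x "D 1 mean" 2, OF x D1_mean] D_zero[of x "D 2 mean" 1, OF x D2_mean]
      D1_mean[OF x] D2_mean[OF x] by simp
  then show r: "W 2 0 1 x = W 1 0 2 x"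
    using D0_mean[OF x] W_flip[OF x, of 1] W_flip[OF x, of 2] by simp
  show "(L x - M x) * W 0 0 1 x = 0"
    using structure3[OF x, of 1 0 0 3] D1_L[OF x]
    by (auto simp: normalize x algebra_simps)
  show "(L x - K x) * W 0 0 2 x = 0"
    using structure3[OF x, of 2 0 0 3] D2_L[OF x]
    by (auto simp: normalize x algebra_simps)
  show "D 0 M x = (L x - M x) * p x"
    using structure3[OF x, of 0 1 1 3]
    by (auto simp: normalize x algebra_simps)
  show "D 0 K x = (L x - K x) * q x"
    using structure3[OF x, of 0 2 2 3]
    by (auto simp: normalize x algebra_simps)
  show "(L x - K x) * W 1 0 2 x = (M x - K x) * W 0 1 2 x"
    using structure3[OF x, of 0 1 2 3]
    by (auto simp: normalize x algebra_simps)
  show "(M x - K x) * W 1 0 2 x = 0"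
    using structure3[OF x, of 1 2 0 3] r
    by (auto simp: normalize x algebra_simps)
  show "D 2 M x = (M x - K x) * W 1 1 2 x"
    using structure3[OF x, of 2 1 1 3]
    by (auto simp: normalize x algebra_simps)
  show "D 1 K x = (K x - M x) * W 2 2 1 x"
    using structure3[OF x, of 1 2 2 3]
    by (auto simp: normalize x algebra_simps)
qed

lemma w_relation:
  assumes x: "x \<in> S"
  shows "3 * D 0 L x + (L x - M x) * p x + (L x - K x) * q x = 0"
  using D_K[OF x, of 0] codazzi(3,4)[OF x] by simp

lemma not_all_L_zero: "S \<noteq> {} \<Longrightarrow> \<not> (\<forall>x\<in>S. L x = 0)"
  using D0_L D_zero[of _ L 0] by blast

lemma not_all_LM: "S \<noteq> {} \<Longrightarrow> \<not> (\<forall>x\<in>S. L x - M x = 0)"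
  and not_all_LK: "S \<noteq> {} \<Longrightarrow> \<not> (\<forall>x\<in>S. L x - K x = 0)"
proof -
  assume "S \<noteq> {}"
  then obtain x where x: "x \<in> S" by blast
  show "\<not> (\<forall>x\<in>S. L x - M x = 0)"
  proof
    assume a: "\<forall>x\<in>S. L x - M x = 0"
    then have "D 0 L x = D 0 M x" by (intro D_cong x) auto
    then show False using codazzi(3)[OF x] a x D0_L[OF x] by simp
  qed
  show "\<not> (\<forall>x\<in>S. L x - K x = 0)"
  proof
    assume a: "\<forall>x\<in>S. L x - K x = 0"
    then have "D 0 L x = D 0 K x" by (intro D_cong x) auto
    then show False using codazzi(4)[OF x] a x D0_L[OF x] by simp
  qed
qed

end

locale generic_frame = principal_frame S g T h \<phi> e E c m
  for S :: "'e::euclidean_space set" and g and T :: "'f::euclidean_space set" and h \<phi> e E c m +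
  assumes L0: "x \<in> S \<Longrightarrow> L x \<noteq> 0" and LM: "x \<in> S \<Longrightarrow> L x \<noteq> M x" and LK: "x \<in> S \<Longrightarrow> L x \<noteq> K x"
begin

lemma W001: "x \<in> S \<Longrightarrow> W 0 0 1 x = 0" and W002: "x \<in> S \<Longrightarrow> W 0 0 2 x = 0"
  using codazzi(1,2) LM LK by fastforce+

lemma W102: "x \<in> S \<Longrightarrow> W 1 0 2 x = 0"
  using codazzi(5,6)[of x] LK[of x] by (cases "M x = K x") auto

lemma W201: "x \<in> S \<Longrightarrow> W 2 0 1 x = 0"
  using codazzi(9) W102 by simp

lemma D_vanishing:
  assumes "x \<in> S"
  shows "D i (W 0 0 1) x = 0" "D i (W 0 0 2) x = 0" "D i (W 1 0 2) x = 0" "D i (W 2 0 1) x = 0"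
  by (intro D_zero assms W001 W002 W102 W201; assumption)+

lemma gauss:
  assumes x: "x \<in> S"
  shows "D 0 p x = - ((p x)^2) - c - L x * M x" "D 0 q x = - ((q x)^2) - c - L x * K x"
    "D 1 q x = (q x - p x) * W 2 2 1 x" "D 2 p x = (p x - q x) * W 1 1 2 x"
proof -
  note n = normalize x W001 W002 W102 W201 D_vanishing
  show "D 0 p x = - ((p x)^2) - c - L x * M x"
    using structure3[OF x, of 0 1 0 1] by (simp add: n algebra_simps power2_eq_square)
  show "D 0 q x = - ((q x)^2) - c - L x * K x"
    using structure3[OF x, of 0 2 0 2] by (simp add: n algebra_simps power2_eq_square)
  show "D 1 q x = (q x - p x) * W 2 2 1 x"
    using structure3[OF x, of 1 2 0 2] by (simp add: n algebra_simps power2_eq_square)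
  show "D 2 p x = (p x - q x) * W 1 1 2 x"
    using structure3[OF x, of 2 1 0 1] by (simp add: n algebra_simps power2_eq_square)
qed

lemma D1_M: "x \<in> S \<Longrightarrow> D 1 M x = (M x - K x) * W 2 2 1 x"
  and D2_K: "x \<in> S \<Longrightarrow> D 2 K x = (K x - M x) * W 1 1 2 x"
  using D_K[of x 1] D_K[of x 2] D1_L[of x] D2_L[of x] codazzi(7,8)[of x] by (simp_all add: algebra_simps)

lemma D_D0:
  fixes F :: "'e \<Rightarrow> real"
  assumes x: "x \<in> S" and F: "smooth_on S F" and 1: "\<And>y. y \<in> S \<Longrightarrow> D 1 F y = 0" and 2: "\<And>y. y \<in> S \<Longrightarrow> D 2 F y = 0"
  shows "D 1 (D 0 F) x = 0" "D 2 (D 0 F) x = 0"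
  using D_commute3[OF x, of 1 0 F] D_commute3[OF x, of 2 0 F] F 1[OF x] 2[OF x]
    D_zero[of x "D 1 F" 0, OF x 1] D_zero[of x "D 2 F" 0, OF x 2]
  by (simp_all add: W_flip W_diag W001 W002 x)

lemma D12_w: "x \<in> S \<Longrightarrow> D 1 (D 0 L) x = 0" "x \<in> S \<Longrightarrow> D 2 (D 0 L) x = 0"
  and D12_w': "x \<in> S \<Longrightarrow> D 1 (D 0 (D 0 L)) x = 0" "x \<in> S \<Longrightarrow> D 2 (D 0 (D 0 L)) x = 0"
proof -
  have 1: "D 1 (D 0 L) x = 0" "D 2 (D 0 L) x = 0" if "x \<in> S" for x
    using D_D0[OF that smooth_L D1_L D2_L] by auto
  show "x \<in> S \<Longrightarrow> D 1 (D 0 L) x = 0" "x \<in> S \<Longrightarrow> D 2 (D 0 L) x = 0" by (fact 1)+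
  show "x \<in> S \<Longrightarrow> D 1 (D 0 (D 0 L)) x = 0" "x \<in> S \<Longrightarrow> D 2 (D 0 (D 0 L)) x = 0"
    using D_D0[OF _ smooth_w 1] by auto
qed

lemma laplace_relation:
  assumes x: "x \<in> S"
  shows "D 0 (D 0 L) x + (p x + q x) * D 0 L x - L x * ((L x)^2 + (M x)^2 + (K x)^2) = 0"
proof -
  have "D 0 (D 0 mean) x = D 0 (\<lambda>y. - 2 * D 0 L y) x" by (rule D_cong[OF x D_mean_L])
  also have "\<dots> = - 2 * D 0 (D 0 L) x"
    using D_mult[OF x smooth_on_const smooth_w, of 0 "- 2"] by (simp add: D_def)
  finally show ?thesis
    using laplacian_mean[OF x] D_zero[of x "D 1 mean" 1, OF x D1_mean] D_zero[of x "D 2 mean" 2, OF x D2_mean]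
      D1_L[OF x] D2_L[OF x]
    by (simp add: W013 W023 W123 x D_mean_L mean_eq algebra_simps)
qed

lemma transverse_zero:
  assumes x: "x \<in> S" and MK: "\<And>y. y \<in> S \<Longrightarrow> M y \<noteq> K y"
  shows "W 2 2 1 x = 0" "W 1 1 2 x = 0"
proof -
  have s: "smooth_on S (D 0 (D 0 L))" "smooth_on S (W 2 2 1)" "smooth_on S (W 1 1 2)"
    by (auto intro!: smooth_D smooth3 simp: m3)
  show "W 2 2 1 x = 0"
  proof (rule transverse_coefficient_zero[OF open_S x smooth_L smooth_M smooth_K smooth_p smooth_q smooth_w s(1,2),
          where u = "e 1"])
    fix y assume y: "y \<in> S"
    show "FD K y (e 1 y) = - ((M y - K y) * W 2 2 1 y)"
      using codazzi(8)[OF y] by (simp add: D_def algebra_simps)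
  qed (simp_all add: D_def[symmetric] D1_L D12_w D12_w' D1_M gauss laplace_relation w_relation trace_relation L0 LM MK)
  show "W 1 1 2 x = 0"
  proof (rule transverse_coefficient_zero[OF open_S x smooth_L smooth_K smooth_M smooth_q smooth_p smooth_w s(1,3),
          where u = "e 2"])
    fix y assume y: "y \<in> S"
    show "FD M y (e 2 y) = - ((K y - M y) * W 1 1 2 y)"
      using codazzi(7)[OF y] by (simp add: D_def algebra_simps)
    show "K y + M y = - 3 * L y" "K y \<noteq> M y" using trace_relation[OF y] MK[OF y] by simp_all
    show "3 * D 0 L y + (L y - K y) * q y + (L y - M y) * p y = 0" using w_relation[OF y] by simp
    show "D 0 (D 0 L) y + (q y + p y) * D 0 L y - L y * ((L y)\<^sup>2 + (K y)\<^sup>2 + (M y)\<^sup>2) = 0"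
      using laplace_relation[OF y] by (simp add: add.commute add.left_commute)
  qed (simp_all add: D_def[symmetric] D2_L D12_w D12_w' D2_K gauss L0 LK)
qed

lemma distinct_impossible:
  assumes MK: "\<And>y. y \<in> S \<Longrightarrow> M y \<noteq> K y"
  shows "S = {}"
proof (rule distinct_curvatures_ode[OF open_S smooth_L smooth_M smooth_K smooth_p smooth_q smooth_w, where v = "e 0" and c = c])
  fix x assume x: "x \<in> S"
  show "p x * q x = - (c + M x * K x)"
  proof -
    have "D i (W 2 2 1) x = 0" "D i (W 1 1 2) x = 0" for i
      by (intro D_zero x transverse_zero MK; assumption)+
    then show ?thesis
      using structure3[OF x, of 1 2 1 2] D_W_skew[OF x, of 1 2 1 2] transverse_zero[OF x MK]
      by (simp add: normalize x W001 W002 W102 W201 algebra_simps)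
  qed
  show "FD L x (e 0 x) = D 0 L x" "D 0 L x \<noteq> 0" "L x \<noteq> 0" "M x + K x = - 3 * L x"
    by (simp_all add: D_def[symmetric] D0_L L0 x trace_relation)
  show "FD M x (e 0 x) = (L x - M x) * p x" "FD K x (e 0 x) = (L x - K x) * q x"
    "FD p x (e 0 x) = - ((p x)^2) - c - L x * M x" "FD q x (e 0 x) = - ((q x)^2) - c - L x * K x"
    using codazzi(3,4)[OF x] gauss(1,2)[OF x] by (simp_all add: D_def)
  show "FD (D 0 L) x (e 0 x) = L x * ((L x)^2 + (M x)^2 + (K x)^2) - (p x + q x) * D 0 L x"
    using laplace_relation[OF x] by (simp add: D_def)
qed

lemma umbilic_impossible:
  assumes MK: "\<And>y. y \<in> S \<Longrightarrow> M y = K y"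
  shows "S = {}"
proof (rule umbilic_ode[OF open_S smooth_L smooth_p smooth_w, where v = "e 0" and c = c])
  fix x assume x: "x \<in> S"
  have M: "M x = - (3/2) * L x" using trace_relation[OF x] MK[OF x] by simp
  have "D 0 M x = D 0 K x" by (rule D_cong[OF x MK])
  then have pq: "p x = q x" using codazzi(3,4)[OF x] MK[OF x] LM[OF x] by simp
  show "FD L x (e 0 x) = D 0 L x" "D 0 L x \<noteq> 0" "L x \<noteq> 0"
    by (simp_all add: D_def[symmetric] D0_L L0 x)
  show "FD p x (e 0 x) = - ((p x)^2) - c + 3/2 * (L x)^2"
    using gauss(1)[OF x] M by (simp add: D_def power2_eq_square)
  show "3 * D 0 L x + 5 * L x * p x = 0"
    using w_relation[OF x] unfolding MK[OF x, symmetric] M pq[symmetric] by (simp add: algebra_simps)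
  show "FD (D 0 L) x (e 0 x) = 11/2 * (L x)^3 - 2 * p x * D 0 L x"
    using laplace_relation[OF x] unfolding MK[OF x, symmetric] M pq[symmetric]
    by (simp add: D_def power2_eq_square power3_eq_cube algebra_simps)
qed

end

section \<open>From the frame to the manifold\<close>

lemma (in principal_frame) impossible: "S = {}"
proof (rule ccontr)
  assume ne: "S \<noteq> {}"
  from not_all_L_zero[OF ne] obtain U1 where U1: "open U1" "U1 \<noteq> {}" "U1 \<subseteq> S" and L: "\<And>x. x \<in> U1 \<Longrightarrow> L x \<noteq> 0"
    by (rule_tac smooth_dichotomy[OF open_S smooth_L]) auto
  interpret P1: principal_frame U1 g T h \<phi> e E c m by (rule restrict_principal[OF U1(1,3)])
  from P1.not_all_LM[OF U1(2)] obtain U2 where U2: "open U2" "U2 \<noteq> {}" "U2 \<subseteq> U1"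
    and LM: "\<And>x. x \<in> U2 \<Longrightarrow> L x - M x \<noteq> 0"
    by (rule_tac smooth_dichotomy[OF U1(1) smooth_on_diff[OF U1(1) P1.smooth_L P1.smooth_M]]) auto
  interpret P2: principal_frame U2 g T h \<phi> e E c m by (rule P1.restrict_principal[OF U2(1,3)])
  from P2.not_all_LK[OF U2(2)] obtain U3 where U3: "open U3" "U3 \<noteq> {}" "U3 \<subseteq> U2"
    and LK: "\<And>x. x \<in> U3 \<Longrightarrow> L x - K x \<noteq> 0"
    by (rule_tac smooth_dichotomy[OF U2(1) smooth_on_diff[OF U2(1) P2.smooth_L P2.smooth_K]]) auto
  interpret P3: principal_frame U3 g T h \<phi> e E c m by (rule P2.restrict_principal[OF U3(1,3)])
  have gen: "generic_frame V g T h \<phi> e E c m" if V: "open V" "V \<subseteq> U3" for V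
  proof (intro generic_frame.intro generic_frame_axioms.intro P3.restrict_principal V)
    fix x assume "x \<in> V"
    then show "L x \<noteq> 0" "L x \<noteq> M x" "L x \<noteq> K x"
      using L[of x] LM[of x] LK[of x] V U3 U2 by auto
  qed
  show False
  proof (rule smooth_dichotomy[OF U3(1) smooth_on_diff[OF U3(1) P3.smooth_M P3.smooth_K]])
    assume "\<And>x. x \<in> U3 \<Longrightarrow> M x - K x = 0"
    then have "U3 = {}" by (intro generic_frame.umbilic_impossible[OF gen[OF U3(1) order_refl]]) simp
    then show False using U3(2) by simp
  next
    fix U4 assume U4: "open U4" "U4 \<noteq> {}" "U4 \<subseteq> U3" and MK: "\<And>x. x \<in> U4 \<Longrightarrow> M x - K x \<noteq> 0"
    have "U4 = {}" using MK by (intro generic_frame.distinct_impossible[OF gen[OF U4(1,3)]]) force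
    then show False using U4(2) by simp
  qed
qed

lemma symmetric_2x2_rotation:
  fixes \<alpha> \<beta> \<delta> :: real
  assumes "\<beta> \<noteq> 0"
  defines "u \<equiv> (\<delta> - \<alpha>) / 2 + sqrt (((\<alpha> - \<delta>) / 2)^2 + \<beta>^2)"
  defines "n \<equiv> sqrt (\<beta>^2 + u^2)"
  shows "n > 0" "(\<beta> / n)^2 + (u / n)^2 = 1"
    "- (\<beta> / n) * (u / n) * \<alpha> + ((\<beta> / n)^2 - (u / n)^2) * \<beta> + (\<beta> / n) * (u / n) * \<delta> = 0"
proof -
  have "\<beta>^2 + u^2 > 0" using assms(1) by (simp add: add_pos_nonneg)
  then show n: "n > 0" by (simp add: n_def)
  have n2: "n^2 = \<beta>^2 + u^2" by (simp add: n_def)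
  show "(\<beta> / n)^2 + (u / n)^2 = 1" using n by (simp add: power_divide add_divide_distrib[symmetric] n2[symmetric])
  define s where "s = sqrt (((\<alpha> - \<delta>) / 2)^2 + \<beta>^2)"
  have "4 * s^2 = (\<alpha> - \<delta>)^2 + 4 * \<beta>^2" by (simp add: s_def power_divide)
  moreover have "2 * u = (\<delta> - \<alpha>) + 2 * s" by (simp add: u_def s_def)
  ultimately have "- \<beta> * u * \<alpha> + (\<beta>^2 - u^2) * \<beta> + \<beta> * u * \<delta> = 0" by algebra
  moreover have "- (\<beta> / n) * (u / n) * \<alpha> + ((\<beta> / n)^2 - (u / n)^2) * \<beta> + (\<beta> / n) * (u / n) * \<delta>
      = (- \<beta> * u * \<alpha> + (\<beta>^2 - u^2) * \<beta> + \<beta> * u * \<delta>) / n^2"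
    using n by (simp add: power2_eq_square field_simps)
  ultimately show "- (\<beta> / n) * (u / n) * \<alpha> + ((\<beta> / n)^2 - (u / n)^2) * \<beta> + (\<beta> / n) * (u / n) * \<delta> = 0"
    by simp
qed

lemma less3_cases: "(i::nat) < 3 \<Longrightarrow> i = 0 \<or> i = 1 \<or> i = 2"
  by (simp add: One_nat_def) linarith

locale H_tensional_chart = isometric_chart S g T h \<phi>
  for S :: "'e::euclidean_space set" and g and T :: "'f::euclidean_space set" and h \<phi> +
  fixes c :: real
  assumes dim3: "DIM('e) = 3" and dim4: "DIM('f) = 4"
    and curv: "y \<in> T \<Longrightarrow> h y (h.Rm y u v w) z = c * (h y v w * h y u z - h y u w * h y v z)"
    and H_tensional: "open U \<Longrightarrow> U \<subseteq> S \<Longrightarrow> orthonormal_frame_on U g e' \<Longrightarrow> x \<in> U \<Longrightarrow>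
      rough_laplacian g h \<phi> e' (tension_field g h \<phi>) x = 0"
begin

lemma hypersurface3I:
  assumes "open U" "U \<subseteq> S" and f: "adapted_frame U g T h \<phi> e E c 3"
  shows "hypersurface3 U g T h \<phi> e E c 3"
  by (intro hypersurface3.intro hypersurface3_axioms.intro f refl
      adapted_frame.lap_eq_zero[OF f] H_tensional[OF assms(1,2)])

lemma diagonalised_frame_impossible:
  assumes U: "open U" "U \<subseteq> S" and f: "adapted_frame U g T h \<phi> e E c 3"
    and D0: "\<And>x. x \<in> U \<Longrightarrow> adapted_frame.D e 0 (adapted_frame.mean h \<phi> e E 3) x \<noteq> 0"
    and D1: "\<And>x. x \<in> U \<Longrightarrow> adapted_frame.D e 1 (adapted_frame.mean h \<phi> e E 3) x = 0"
    and D2: "\<And>x. x \<in> U \<Longrightarrow> adapted_frame.D e 2 (adapted_frame.mean h \<phi> e E 3) x = 0"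
    and W: "\<And>x. x \<in> U \<Longrightarrow> adapted_frame.W h \<phi> e E 1 2 3 x = 0"
  shows "U = {}"
  by (rule principal_frame.impossible[of U g T h \<phi> e E c 3], intro principal_frame.intro principal_frame_axioms.intro hypersurface3I[OF U f])
    (fact D0 D1 D2 W)+

lemma change_frame_mean:
  assumes U: "open U" "U \<subseteq> V" "V \<subseteq> S" and f: "adapted_frame V g T h \<phi> e E c 3"
    and f': "adapted_frame U g T h \<phi> e' E' c 3" and E: "E' 3 = E 3" and x: "x \<in> U"
  shows "adapted_frame.D e' i (adapted_frame.mean h \<phi> e' E' 3) x = FD (adapted_frame.mean h \<phi> e E 3) x (e' i x)"
proof -
  interpret F: adapted_frame V g T h \<phi> e E c 3 by (rule f)
  interpret F': adapted_frame U g T h \<phi> e' E' c 3 by (rule f')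
  have "F'.mean y = F.mean y" if y: "y \<in> U" for y
  proof -
    have yV: "y \<in> V" using y U by blast
    have "F'.mean y *\<^sub>R E 3 y = F.mean y *\<^sub>R E 3 y"
      using F.tension_eq[OF yV] F'.tension_eq[OF y] E by simp
    moreover have "E 3 y \<noteq> 0"
      using F.ortho_E[OF yV, of 3 3] inner_form.zero_left[OF F.form_phi[OF yV]] by auto
    ultimately show ?thesis by simp
  qed
  then show ?thesis unfolding F'.D_def by (rule FD_cong[OF U(1) x])
qed

lemma gradient_frame_impossible:
  assumes U: "open U" "U \<subseteq> S" and f: "adapted_frame U g T h \<phi> e E c 3"
    and D0: "\<And>x. x \<in> U \<Longrightarrow> adapted_frame.D e 0 (adapted_frame.mean h \<phi> e E 3) x \<noteq> 0"
    and D1: "\<And>x. x \<in> U \<Longrightarrow> adapted_frame.D e 1 (adapted_frame.mean h \<phi> e E 3) x = 0"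
    and D2: "\<And>x. x \<in> U \<Longrightarrow> adapted_frame.D e 2 (adapted_frame.mean h \<phi> e E 3) x = 0"
  shows "U = {}"
proof -
  interpret F: adapted_frame U g T h \<phi> e E c 3 by (rule f)
  have sW: "smooth_on U (F.W i j 3)" if "i < 3" "j < 3" for i j
    using that by (intro F.smooth_W) auto
  show ?thesis
  proof (rule smooth_dichotomy[OF U(1) sW[of 1 2]])
    assume b0: "\<And>x. x \<in> U \<Longrightarrow> F.W 1 2 3 x = 0"
    show ?thesis by (rule diagonalised_frame_impossible[OF U f]) (fact D0 D1 D2 b0)+
  next
    fix V assume V: "open V" "V \<noteq> {}" "V \<subseteq> U" and b: "\<And>x. x \<in> V \<Longrightarrow> F.W 1 2 3 x \<noteq> 0"
    define \<alpha> \<beta> \<delta> where "\<alpha> = F.W 1 1 3" and "\<beta> = F.W 1 2 3" and "\<delta> = F.W 2 2 3"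
    define u where "u x = (\<delta> x - \<alpha> x) / 2 + sqrt (((\<alpha> x - \<delta> x) / 2)^2 + (\<beta> x)^2)" for x
    define n where "n x = sqrt ((\<beta> x)^2 + (u x)^2)" for x
    define cs sn where "cs x = \<beta> x / n x" and "sn x = u x / n x" for x
    have \<beta>0: "\<beta> x \<noteq> 0" if "x \<in> V" for x using b[OF that] by (simp add: \<beta>_def)
    have rot: "n x > 0" "(cs x)^2 + (sn x)^2 = 1"
      "- cs x * sn x * \<alpha> x + ((cs x)^2 - (sn x)^2) * \<beta> x + cs x * sn x * \<delta> x = 0" if "x \<in> V" for x
      unfolding cs_def sn_def n_def u_def
      by (fact symmetric_2x2_rotation[OF \<beta>0[OF that], where \<alpha> = "\<alpha> x" and \<delta> = "\<delta> x"])+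
    have s: "smooth_on V \<alpha>" "smooth_on V \<beta>" "smooth_on V \<delta>"
      unfolding \<alpha>_def \<beta>_def \<delta>_def by (auto intro!: smooth_on_subset[OF sW V(3)])
    have su: "smooth_on V u"
      unfolding u_def[abs_def]
    proof (intro smooth_on_add[OF V(1)] smooth_on_divide[OF V(1)] smooth_on_diff[OF V(1)] smooth_on_const
        smooth_on_sqrt[OF V(1)] smooth_on_power[OF V(1)] s)
      show "0 < ((\<alpha> x - \<delta> x) / 2)^2 + (\<beta> x)^2" if "x \<in> V" for x
        using \<beta>0[OF that] by (simp add: add_nonneg_pos)
    qed auto
    have sn': "smooth_on V n"
      unfolding n_def[abs_def]
    proof (intro smooth_on_sqrt[OF V(1)] smooth_on_add[OF V(1)] smooth_on_power[OF V(1)] s su)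
      show "0 < (\<beta> x)^2 + (u x)^2" if "x \<in> V" for x
        using \<beta>0[OF that] by (simp add: add_pos_nonneg)
    qed
    have n0: "n x \<noteq> 0" if "x \<in> V" for x using rot(1)[OF that] by simp
    have scs: "smooth_on V cs" "smooth_on V sn"
      unfolding cs_def[abs_def] sn_def[abs_def] by (intro smooth_on_divide[OF V(1)] s su sn' n0; assumption)+
    define e' where "e' i = (if i = 1 then (\<lambda>x. cs x *\<^sub>R e 1 x + sn x *\<^sub>R e 2 x)
      else if i = 2 then (\<lambda>x. - sn x *\<^sub>R e 1 x + cs x *\<^sub>R e 2 x) else e i)" for i
    have e'_simps: "e' 0 = e 0" "e' 1 x = cs x *\<^sub>R e 1 x + sn x *\<^sub>R e 2 x"
      "e' 2 x = - sn x *\<^sub>R e 1 x + cs x *\<^sub>R e 2 x" for x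
      by (simp_all add: e'_def)
    have se: "smooth_on V (e i)" if "i < 3" for i
      by (rule smooth_on_subset[OF F.smooth_e[OF that] V(3)])
    have s1: "smooth_on V (\<lambda>x. cs x *\<^sub>R e 1 x + sn x *\<^sub>R e 2 x)"
      by (intro smooth_on_add[OF V(1)] smooth_on_scaleR[OF V(1)] scs se) auto
    have s2: "smooth_on V (\<lambda>x. - sn x *\<^sub>R e 1 x + cs x *\<^sub>R e 2 x)"
      by (intro smooth_on_add[OF V(1)] smooth_on_scaleR[OF V(1)] smooth_on_minus[OF V(1)] scs se) auto
    have smooth_e': "smooth_on V (e' i)" if "i < 3" for i
      using s1 s2 se[OF that] by (simp add: e'_def)
    have on: "orthonormal_family 3 (g x) (\<lambda>i. e' i x)" if x: "x \<in> V" for x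
    proof -
      have xU: "x \<in> U" using x V by blast
      interpret G: inner_form "g x" by (rule F.g.form[OF xU])
      have o: "g x (e i x) (e j x) = (if i = j then 1 else 0)" if "i < 3" "j < 3" for i j
        using F.ortho_e[OF xU] that by (simp add: orthonormal_family_def)
      have r: "cs x * cs x + sn x * sn x = 1" using rot(2)[OF x] by (simp add: power2_eq_square)
      show ?thesis
        unfolding orthonormal_family_def
      proof (intro allI impI)
        fix i j :: nat assume "i < 3" "j < 3"
        then have "i = 0 \<or> i = 1 \<or> i = 2" "j = 0 \<or> j = 1 \<or> j = 2" using less3_cases by blast+
        then show "g x (e' i x) (e' j x) = (if i = j then 1 else 0)"
          using r by (elim disjE) (simp_all add: e'_simps G.form_simps o algebra_simps)
      qed
    qed
    define E' where "E' a = (if a < 3 then F.push (e' a) else E 3)" for a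
    have f': "adapted_frame V g T h \<phi> e' E' c 3"
      unfolding E'_def[abs_def] by (rule F.change_frame[OF V(1,3) smooth_e' on])
    interpret F': adapted_frame V g T h \<phi> e' E' c 3 by (rule f')
    have E3: "E' 3 = E 3" by (simp add: E'_def)
    have VS: "V \<subseteq> S" using V U by blast
    note cm = change_frame_mean[OF V(1,3) U(2) f f' E3]
    have Dsub: "FD F.mean x (e i x) = F.D i F.mean x" for i x by (simp add: F.D_def)
    have l: "linear (FD F.mean x)" if "x \<in> V" for x
      using linear_FD[OF U(1) F.smooth_mean] that V by blast
    have "V = {}"
    proof (rule diagonalised_frame_impossible[OF V(1) VS f'])
      fix x assume x: "x \<in> V"
      then have xU: "x \<in> U" using V by blast
      show "F'.D 0 F'.mean x \<noteq> 0" using D0[OF xU] by (simp add: cm[OF x] e'_simps Dsub)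
      show "F'.D 1 F'.mean x = 0" "F'.D 2 F'.mean x = 0"
        using D1[OF xU] D2[OF xU]
        by (simp_all add: cm[OF x] e'_simps linear_add[OF l[OF x]] linear_diff[OF l[OF x]] linear_cmul[OF l[OF x]] linear_neg[OF l[OF x]] Dsub)
      have hess: "F'.W 1 2 3 x = h (\<phi> x) (hess x (e' 1 x) (e' 2 x)) (E 3 x)"
        using F'.W_normal_hess[OF x, of 2 1] E3 by simp
      have Wij: "F.W i j 3 x = h (\<phi> x) (hess x (e i x) (e j x)) (E 3 x)" if "j < 3" for i j
        by (rule F.W_normal_hess[OF xU that])
      have sym21: "F.W 2 1 3 x = F.W 1 2 3 x" by (rule F.W_normal_sym[OF xU]) simp_all
      note bh = F.bilinear_hess[OF xU]
      have "F'.W 1 2 3 x = - cs x * sn x * \<alpha> x + ((cs x)^2 - (sn x)^2) * \<beta> x + cs x * sn x * \<delta> x"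
        unfolding hess e'_simps
        by (simp add: bilinear_ladd[OF bh] bilinear_radd[OF bh] bilinear_lmul[OF bh] bilinear_rmul[OF bh]
            bilinear_lsub[OF bh] bilinear_rsub[OF bh] bilinear_lneg[OF bh] bilinear_rneg[OF bh]
            inner_form.form_simps[OF F.form_phi[OF xU]] Wij[symmetric] sym21 \<alpha>_def \<beta>_def \<delta>_def
            power2_eq_square algebra_simps)
      also have "\<dots> = 0" using rot(3)[OF x] by simp
      finally show "F'.W 1 2 3 x = 0" .
    qed
    then show ?thesis using V(2) by simp
  qed simp_all
qed

lemma mean_locally_constant:
  assumes U: "open U" "U \<subseteq> S" and f: "adapted_frame U g T h \<phi> e E c 3"
    and x0: "x0 \<in> U" and i0: "i0 < 3"
  shows "adapted_frame.D e i0 (adapted_frame.mean h \<phi> e E 3) x0 = 0"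
proof (rule ccontr)
  interpret F: adapted_frame U g T h \<phi> e E c 3 by (rule f)
  assume ne: "F.D i0 F.mean x0 \<noteq> 0"
  define G where "G x = (\<Sum>k<3. F.D k F.mean x *\<^sub>R e k x)" for x
  have sD: "smooth_on U (F.D k F.mean)" if "k < 3" for k
    by (rule F.smooth_D[OF that F.smooth_mean])
  have sG: "smooth_on U G"
    unfolding G_def[abs_def]
    by (intro smooth_on_sum[OF U(1)] smooth_on_scaleR[OF U(1)] sD F.smooth_e) auto
  have grad: "g x v (G x) = FD F.mean x v" if "x \<in> U" for x v
    using F.gradient[OF that F.smooth_mean, of v]
    by (simp add: G_def inner_form.form_simps[OF F.g.form[OF that]])
  define Q where "Q x = g x (G x) (G x)" for x
  have sQ: "smooth_on U Q"
    unfolding Q_def[abs_def] by (rule smooth_on_bilinear_field[OF U(1) F.g.bilinear_h F.g.smooth_h sG sG])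
  have "G x0 \<noteq> 0"
    using grad[OF x0, of "e i0 x0"] ne inner_form.zero_right[OF F.g.form[OF x0]] by (auto simp: F.D_def)
  then have Q0: "Q x0 > 0" unfolding Q_def by (rule inner_form.pos[OF F.g.form[OF x0]])
  define V where "V = {x \<in> U. Q x > 0}"
  have V: "open V" "x0 \<in> V" "V \<subseteq> U" using open_smooth_pos[OF U(1) sQ] Q0 x0 by (auto simp: V_def)
  have Qpos: "Q x > 0" if "x \<in> V" for x using that by (simp add: V_def)
  define n where "n x = sqrt (Q x)" for x
  have n: "n x > 0" "n x * n x = Q x" if "x \<in> V" for x using Qpos[OF that] by (simp_all add: n_def)
  have sn: "smooth_on V n"
    unfolding n_def[abs_def] by (rule smooth_on_sqrt[OF V(1) smooth_on_subset[OF sQ V(3)] Qpos])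
  define e0 where "e0 x = (1 / n x) *\<^sub>R G x" for x
  have se0: "smooth_on V e0"
    unfolding e0_def[abs_def]
    using n(1) by (intro smooth_on_scaleR[OF V(1)] smooth_on_divide[OF V(1)] smooth_on_const sn smooth_on_subset[OF sG V(3)]) force
  have "\<exists>U' e'. open U' \<and> x0 \<in> U' \<and> U' \<subseteq> V \<and> (\<forall>i<1. e' i = e0) \<and> (\<forall>i<3. smooth_on U' (e' i)) \<and>
    (\<forall>x\<in>U'. orthonormal_family 3 (g x) (\<lambda>i. e' i x))"
  proof (rule orthonormal_frame_extend[OF V(1,2)])
    fix x assume x: "x \<in> V"
    then have xU: "x \<in> U" using V by blast
    show "inner_form (g x)" by (rule F.g.form[OF xU])
    have "g x (e0 x) (e0 x) = 1"
      using n[OF x] Qpos[OF x] by (simp add: e0_def inner_form.form_simps[OF F.g.form[OF xU]] Q_def[symmetric])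
    then show "orthonormal_family 1 (g x) (\<lambda>i. e0 x)" by (simp add: orthonormal_family_def)
  next
    show "smooth_on V (\<lambda>x. g x v w)" for v w by (rule smooth_on_subset[OF F.g.smooth_h V(3)])
  qed (use se0 dim3 in auto)
  then obtain U' e' where U': "open U'" "x0 \<in> U'" "U' \<subseteq> V" and e'0: "e' 0 = e0"
    and se': "\<And>i. i < 3 \<Longrightarrow> smooth_on U' (e' i)"
    and on: "\<And>x. x \<in> U' \<Longrightarrow> orthonormal_family 3 (g x) (\<lambda>i. e' i x)" by auto
  have U'U: "U' \<subseteq> U" and U'S: "U' \<subseteq> S" using U' V U by auto
  define E' where "E' a = (if a < 3 then F.push (e' a) else E 3)" for a
  have f': "adapted_frame U' g T h \<phi> e' E' c 3"
    unfolding E'_def[abs_def] by (rule F.change_frame[OF U'(1) U'U se' on])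
  interpret F': adapted_frame U' g T h \<phi> e' E' c 3 by (rule f')
  have E3: "E' 3 = E 3" by (simp add: E'_def)
  have D: "F'.D i F'.mean x = n x * (if i = 0 then 1 else 0)" if x: "x \<in> U'" and i: "i < 3" for i x
  proof -
    have xV: "x \<in> V" and xU: "x \<in> U" using x U' V by auto
    have "F'.D i F'.mean x = g x (e' i x) (G x)"
      using change_frame_mean[OF U'(1) U'U U(2) f f' E3 x] grad[OF xU] by simp
    also have "G x = n x *\<^sub>R e' 0 x" using n(1)[OF xV] by (simp add: e'0 e0_def)
    also have "g x (e' i x) (n x *\<^sub>R e' 0 x) = n x * (if i = 0 then 1 else 0)"
      using on[OF x] i by (simp add: inner_form.form_simps[OF F.g.form[OF xU]] orthonormal_family_def)
    finally show ?thesis .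
  qed
  have "U' = {}"
  proof (rule gradient_frame_impossible[OF U'(1) U'S f'])
    fix x assume x: "x \<in> U'"
    then have "n x > 0" using n(1) U' by blast
    then show "F'.D 0 F'.mean x \<noteq> 0" "F'.D 1 F'.mean x = 0" "F'.D 2 F'.mean x = 0"
      using D[OF x] by simp_all
  qed
  then show False using U'(2) by simp
qed

theorem tension_zero:
  assumes x: "x \<in> S"
  shows "tension_field g h \<phi> x = 0"
proof -
  have "\<exists>U e E. open U \<and> x \<in> U \<and> U \<subseteq> S \<and> adapted_frame U g T h \<phi> e E c DIM('e)"
    by (rule adapted_frame_exists[OF x]) (use dim3 dim4 curv in auto)
  then obtain U e E where U: "open U" "x \<in> U" "U \<subseteq> S" and f: "adapted_frame U g T h \<phi> e E c 3"
    unfolding dim3 by blast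
  interpret F: hypersurface3 U g T h \<phi> e E c 3 by (rule hypersurface3I[OF U(1,3) f])
  have "F.mean x = 0"
    by (rule F.mean_zero_if_locally_constant[OF U(2) mean_locally_constant[OF U(1,3) f]])
  then show ?thesis using F.tension_eq[OF U(2)] by simp
qed

end

lemma chart_of_inj:
  assumes "chart_of X a"
  shows "inj_on (snd a) (fst a)"
proof -
  obtain U \<psi> where a: "a = (U, \<psi>)" by (cases a)
  then have "openin X U" "homeomorphic_map (subtopology X U) (top_of_set (\<psi> ` U)) \<psi>"
    using assms by (auto simp: chart_of_def)
  then show ?thesis
    using a homeomorphic_imp_injective_map[of "subtopology X U"] openin_subset[of X U]
    by (simp add: Int_absorb1)
qed

lemma open_local_dom:
  assumes a: "chart_of X a" and b: "chart_of Y b" and F: "continuous_map X Y F"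
  shows "open (local_dom a b F)"
proof -
  obtain U \<psi> where aU: "a = (U, \<psi>)" by (cases a)
  then have U: "openin X U" "open (\<psi> ` U)" and hom: "homeomorphic_map (subtopology X U) (top_of_set (\<psi> ` U)) \<psi>"
    using a by (auto simp: chart_of_def)
  have "openin Y (fst b)" using b by (auto simp: chart_of_def)
  then have "openin X {x \<in> topspace X. F x \<in> fst b}" using F by (simp add: continuous_map)
  then have "openin (subtopology X U) (U \<inter> {x \<in> topspace X. F x \<in> fst b})"
    by (simp add: openin_subtopology_Int2)
  then have "openin (top_of_set (\<psi> ` U)) (\<psi> ` (U \<inter> {x \<in> topspace X. F x \<in> fst b}))"
    using homeomorphic_imp_open_map[OF hom] unfolding open_map_def by blast
  moreover have "U \<inter> {x \<in> topspace X. F x \<in> fst b} = U \<inter> F -` fst b"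
    using openin_subset[OF U(1)] by auto
  ultimately have "openin (top_of_set (\<psi> ` U)) (\<psi> ` (U \<inter> F -` fst b))" by simp
  then show ?thesis using openin_open_eq[OF U(2)] by (simp add: local_dom_def aU)
qed

lemma isometric_immersion_chart:
  assumes M: "riemannian_manifold M" and N: "riemannian_manifold N" and F: "isometric_immersion M N F"
    and a: "a \<in> atlas M" and b: "b \<in> atlas N"
  shows "isometric_chart (local_dom a b F) (metric M a) (snd b ` fst b) (metric N b) (local_rep a b F)"
proof -
  have ca: "chart_of (mtop M) a" and cb: "chart_of (mtop N) b"
    using M N a b by (auto simp: riemannian_manifold_def smooth_manifold_def)
  have cont: "continuous_map (mtop M) (mtop N) F"
    and smooth: "smooth_on (local_dom a b F) (local_rep a b F)"
    using F a b by (auto simp: isometric_immersion_def immersion_def smooth_map_def)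
  have gM: "riemannian_metric_on (snd a ` fst a) (metric M a)" and hN: "riemannian_metric_on (snd b ` fst b) (metric N b)"
    using M N a b by (auto simp: riemannian_manifold_def)
  have sub: "local_dom a b F \<subseteq> snd a ` fst a" by (auto simp: local_dom_def)
  have into: "local_rep a b F ` local_dom a b F \<subseteq> snd b ` fst b"
    using chart_of_inj[OF ca] by (auto simp: local_rep_def local_dom_def inv_into_f_f)
  have "open (snd b ` fst b)" using cb by (auto simp: chart_of_def)
  show ?thesis
  proof
    show "open (local_dom a b F)" by (rule open_local_dom[OF ca cb cont])
    show "riemannian_metric_on (local_dom a b F) (metric M a)"
      using gM sub smooth_on_subset[OF _ sub] unfolding riemannian_metric_on_def by blast
    show "metric N b (local_rep a b F x) (FD (local_rep a b F) x v) (FD (local_rep a b F) x w) = metric M a x v w"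
      if "x \<in> local_dom a b F" for x v w
      using F a b that by (auto simp: isometric_immersion_def pulls_back_metric_def)
  qed fact+
qed

theorem theorem2p2:
  fixes M :: "('p, real^3) mfd" and N :: "('q, real^4) mfd"
    and \<iota> :: "'p \<Rightarrow> 'q" and c :: real
  assumes "riemannian_manifold M"
    and "riemannian_manifold N"
    and "constant_sectional_curvature N c"
    and "isometric_immersion M N \<iota>"
  shows "H_tensional M N \<iota> \<longleftrightarrow> minimal_immersion M N \<iota>"
proof
  note chart = isometric_immersion_chart[OF assms(1,2,4)]
  show "minimal_immersion M N \<iota>" if H: "H_tensional M N \<iota>"
    unfolding minimal_immersion_def
  proof (intro ballI)
    fix a b x assume a: "a \<in> atlas M" and b: "b \<in> atlas N" and x: "x \<in> local_dom a b \<iota>"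
    interpret I: isometric_chart "local_dom a b \<iota>" "metric M a" "snd b ` fst b" "metric N b" "local_rep a b \<iota>"
      by (rule chart[OF a b])
    interpret J: H_tensional_chart "local_dom a b \<iota>" "metric M a" "snd b ` fst b" "metric N b" "local_rep a b \<iota>" c
    proof
      fix y u v w z assume y: "y \<in> snd b ` fst b"
      show "metric N b y (I.h.Rm y u v w) z =
        c * (metric N b y v w * metric N b y u z - metric N b y u w * metric N b y v z)"
        by (rule I.h.Rm_constant_curvature[OF y])
          (use assms(3) b y in \<open>auto simp: constant_sectional_curvature_def\<close>)
    next
      show "rough_laplacian (metric M a) (metric N b) (local_rep a b \<iota>) e
          (tension_field (metric M a) (metric N b) (local_rep a b \<iota>)) y = 0"
        if "open U" "U \<subseteq> local_dom a b \<iota>" "orthonormal_frame_on U (metric M a) e" "y \<in> U" for U e y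
        using H a b that unfolding H_tensional_def by blast
    qed simp_all
    show "mean_curvature_field (metric M a) (metric N b) (local_rep a b \<iota>) x = 0"
      using J.tension_zero[OF x] I.minimal_iff_tension_zero[OF x] by blast
  qed
  show "H_tensional M N \<iota>" if min: "minimal_immersion M N \<iota>"
    unfolding H_tensional_def
  proof (intro ballI allI impI)
    fix a b S e x
    assume a: "a \<in> atlas M" and b: "b \<in> atlas N"
      and S: "open S \<and> S \<subseteq> local_dom a b \<iota> \<and> orthonormal_frame_on S (metric M a) e" and x: "x \<in> S"
    interpret I: isometric_chart "local_dom a b \<iota>" "metric M a" "snd b ` fst b" "metric N b" "local_rep a b \<iota>"
      by (rule chart[OF a b])
    show "rough_laplacian (metric M a) (metric N b) (local_rep a b \<iota>) e
        (tension_field (metric M a) (metric N b) (local_rep a b \<iota>)) x = 0"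
    proof (rule I.rough_laplacian_zero_section)
      show "x \<in> local_dom a b \<iota>" using S x by blast
      show "tension_field (metric M a) (metric N b) (local_rep a b \<iota>) y = 0" if "y \<in> local_dom a b \<iota>" for y
        using min a b that I.minimal_iff_tension_zero[OF that] unfolding minimal_immersion_def by blast
    qed
  qed
qed

end
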